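(* Let $g_0(t) = 2^{1/4} e^{-\pi t^2}$ on $\mathbb{R}$ and fix $n \in \mathbb{N}$. For $\alpha, \beta > 0$ with $\alpha\beta = 1/n$, let $A(\alpha,\beta)$ and $B(\alpha,\beta)$ denote the optimal lower and upper frame bounds of the Gabor system $\mathcal{G}(g_0, \alpha\mathbb{Z}\times\beta\mathbb{Z})$. Then, among all such pairs $(\alpha,\beta)$ with $\alpha\beta = 1/n$, the square lattice $\alpha = \beta = n^{-1/2}$ maximizes $A(\alpha,\beta)$ and minimizes $B(\alpha,\beta)$. That is, for all $\alpha,\beta>0$ with $\alpha\beta = 1/n$, $$A(\alpha,\beta) \le A(n^{-1/2},n^{-1/2}) \quad\text{and}\quad B(\alpha,\beta) \ge B(n^{-1/2},n^{-1/2}).$$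
   Context: For $\lambda = (x,\omega)\in\mathbb{R}^2$, the time-frequency shift is $\pi(\lambda)g(t) = e^{2\pi i \omega t} g(t-x)$. For a window $g\in L^2(\mathbb{R})$ and a set $\Lambda\subset\mathbb{R}^2$, the Gabor system is $\mathcal{G}(g,\Lambda) = \{\pi(\lambda) g : \lambda\in\Lambda\}$. The optimal lower frame bound $A$ is the largest constant $A \ge 0$ and the optimal upper frame bound $B$ is the smallest constant $B$ such that $A\|f\|_2^2 \le \sum_{\lambda\in\Lambda} |\langle f, \pi(\lambda) g\rangle|^2 \le B\|f\|_2^2$ for all $f\in L^2(\mathbb{R})$. *)

theory Defs
  imports "HOL-Analysis.Analysis"
begin

definition L2 :: "(real \<Rightarrow> complex) set" where
  "L2 = {f. f \<in> borel_measurable lborel \<and> integrable lborel (\<lambda>t. (cmod (f t))\<^sup>2)}"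

definition L2_norm_sq :: "(real \<Rightarrow> complex) \<Rightarrow> real" where
  "L2_norm_sq f = (LINT t|lborel. (cmod (f t))\<^sup>2)"

definition L2_inner :: "(real \<Rightarrow> complex) \<Rightarrow> (real \<Rightarrow> complex) \<Rightarrow> complex" where
  "L2_inner f h = (LINT t|lborel. f t * cnj (h t))"

definition tf_shift :: "real \<times> real \<Rightarrow> (real \<Rightarrow> complex) \<Rightarrow> real \<Rightarrow> complex" where
  "tf_shift lam g t = exp (2 * complex_of_real pi * \<i> * complex_of_real (snd lam * t)) * g (t - fst lam)"

definition frame_sum :: "(real \<Rightarrow> complex) \<Rightarrow> (real \<times> real) set \<Rightarrow> (real \<Rightarrow> complex) \<Rightarrow> ennreal" where
  "frame_sum g \<Lambda> f = (\<integral>\<^sup>+ lam. ennreal ((cmod (L2_inner f (tf_shift lam g)))\<^sup>2) \<partial>count_space \<Lambda>)"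

definition lower_frame_bound :: "(real \<Rightarrow> complex) \<Rightarrow> (real \<times> real) set \<Rightarrow> ennreal" where
  "lower_frame_bound g \<Lambda> =
     Sup {A. \<forall>f\<in>L2. A * ennreal (L2_norm_sq f) \<le> frame_sum g \<Lambda> f}"

definition upper_frame_bound :: "(real \<Rightarrow> complex) \<Rightarrow> (real \<times> real) set \<Rightarrow> ennreal" where
  "upper_frame_bound g \<Lambda> =
     Inf {B. \<forall>f\<in>L2. frame_sum g \<Lambda> f \<le> B * ennreal (L2_norm_sq f)}"

definition rect_lattice :: "real \<Rightarrow> real \<Rightarrow> (real \<times> real) set" where
  "rect_lattice \<alpha> \<beta> = {(\<alpha> * of_int k, \<beta> * of_int l) | k l. True}"

definition gauss0 :: "real \<Rightarrow> complex" where
  "gauss0 t = complex_of_real (2 powr (1/4) * exp (- pi * t\<^sup>2))"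

end

theory Submission
  imports Defs "HOL-Probability.Probability"
begin

text \<open>
  Write \<open>s = \<alpha> / \<beta>\<close>. For continuous \<open>f\<close> of compact support, Parseval's identity in the frequency
  variable and Poisson summation in the time variable turn the frame sum into an integral of Toeplitz
  forms whose symbols are \<open>n\<close> times Janssen's series
  \<open>J\<^sub>s(u, v) = \<Sum> (-1)\<^bsup>nkl\<^esup> exp (- \<pi>n/2 (k\<^sup>2 s + l\<^sup>2 / s)) cos (2\<pi>ku) cos (2\<pi>lv)\<close>, summed over all
  integers \<open>k, l\<close>. Truncated modulated bumps show that the optimal bounds satisfy
  \<open>A \<le> n J\<^sub>s(1/2, 1/2)\<close> and \<open>B \<ge> n J\<^sub>s(0, 0)\<close> for every lattice, and density of compactly supported
  functions shows \<open>A \<ge> n inf J\<^sub>1\<close> and \<open>B \<le> n sup J\<^sub>1\<close> for the square one. What remains is that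
  \<open>J\<^sub>1\<close> has its minimum at \<open>(1/2, 1/2)\<close> and its maximum at \<open>(0, 0)\<close>, and that these two values are
  extremal at \<open>s = 1\<close>.

  With \<open>x = exp (- \<pi>ns/2)\<close>, \<open>y = exp (- \<pi>n/(2s))\<close>, \<open>q = exp (- \<pi>n/2)\<close>, for \<open>n \<ge> 2\<close> and,
  by symmetry, \<open>s \<ge> 1\<close>, the four terms of index \<open>k\<^sup>2 + l\<^sup>2 = 1\<close> change by a multiple of \<open>G = x + y - 2q\<close>, and as long as \<open>y \<le> 1/8\<close> all other
  terms together change by less, whatever their signs; this treats even and odd \<open>n\<close>, and both bounds, at
  once. For \<open>y > 1/8\<close> crude numerical estimates suffice. For \<open>n = 1\<close>, Poisson summation gives
  \<open>J\<^sub>s(1/2, 1/2) = 0\<close> and reduces the upper bound to \<open>n = 2\<close>.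
\<close>

section \<open>Comparison of the weights of two nomes\<close>

text \<open>The obstacle is the sign (-1)^(nkl). For even n it is trivial and the series is a
  product of two theta functions; for odd n no such factorisation is at hand, so the comparison in s
  has to be blind to signs. It succeeds because every change is of first order in the same quantity
  G >= 0. The product xy is not constant in s, but its defect q^2 - xy is at most 2qG; and (y - x)^2
  = 4qG + G^2 + 4(q^2 - xy), so the second-order remainders of higher powers are linear in G as
  well. After symmetrising in (k, l) the four unit terms give 4G, everything else at most 2.96G. The
  smallness behind these constants is pi n/2 >= 3, true from n = 2 on and false for n = 1, which
  explains the separate route for that case. The comparison in (u, v) on the square lattice is
  content with exp(-pi n/2) <= 1/4 and covers n = 1 directly. Maximum and minimum share one proof:
  an overall sign sigma, the common coefficient of the four units, is 1 at (0, 0) and -1 at (1/2,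
  1/2), where the cosines contribute (-1)^(k+l).\<close>

lemma power_diff_le:
  fixes x y :: real
  assumes "0 \<le> x" "x \<le> y"
  shows "y ^ Suc N - x ^ Suc N \<le> real (Suc N) * y ^ N * (y - x)"
proof -
  have "(\<Sum>p<Suc N. y ^ p * x ^ (N - p)) \<le> (\<Sum>p<Suc N. y ^ N)"
  proof (rule sum_mono)
    fix p assume "p \<in> {..<Suc N}"
    then have "y ^ N = y ^ p * y ^ (N - p)" by (simp flip: power_add)
    then show "y ^ p * x ^ (N - p) \<le> y ^ N"
      using assms by (simp add: mult_left_mono power_mono)
  qed
  then have "(y - x) * (\<Sum>p<Suc N. y ^ p * x ^ (N - p)) \<le> (y - x) * (real (Suc N) * y ^ N)"
    using assms by (intro mult_left_mono) simp_all
  then show ?thesis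
    using power_diff_sumr2[of y "Suc N" x] by (simp add: mult_ac)
qed

text \<open>The slope of t^(N+1) is at most (N+1) y^N on [q, y] and at least (N+1) x^N on [x, q].
  Regrouping isolates x + y - 2q; the remainder is a product of two differences and hence of second
  order in the spread.\<close>

lemma power_sum_le:
  fixes x y q :: real
  assumes "0 \<le> x" "x \<le> q" "q \<le> y"
  shows "x ^ Suc N + y ^ Suc N - 2 * q ^ Suc N
     \<le> real (Suc N) * (y ^ N * (x + y - 2 * q) + (y ^ N - x ^ N) * (q - x))"
proof -
  have up: "y ^ Suc N - q ^ Suc N \<le> real (Suc N) * y ^ N * (y - q)"
    using assms by (intro power_diff_le) auto
  have lo: "q ^ Suc N - x ^ Suc N \<ge> real (Suc N) * x ^ N * (q - x)"
  proof -
    have "(\<Sum>p<Suc N. x ^ N) \<le> (\<Sum>p<Suc N. q ^ p * x ^ (N - p))"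
    proof (rule sum_mono)
      fix p assume "p \<in> {..<Suc N}"
      then have "x ^ N = x ^ p * x ^ (N - p)" by (simp flip: power_add)
      then show "x ^ N \<le> q ^ p * x ^ (N - p)"
        using assms by (simp add: mult_right_mono power_mono)
    qed
    then have "(q - x) * (real (Suc N) * x ^ N) \<le> (q - x) * (\<Sum>p<Suc N. q ^ p * x ^ (N - p))"
      using assms by (intro mult_left_mono) simp_all
    also have "\<dots> = q ^ Suc N - x ^ Suc N"
      using power_diff_sumr2[of q "Suc N" x] by (simp add: mult.commute)
    finally show ?thesis by (simp add: mult_ac)
  qed
  have "x ^ Suc N + y ^ Suc N - 2 * q ^ Suc N \<le> real (Suc N) * y ^ N * (y - q) - real (Suc N) * x ^ N * (q - x)"
    using up lo by linarith
  also have "\<dots> = real (Suc N) * (y ^ N * (x + y - 2 * q) + (y ^ N - x ^ N) * (q - x))"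
    by (simp add: algebra_simps)
  finally show ?thesis .
qed

text \<open>\<open>x\<close> and \<open>y\<close> play the nomes of a rectangular lattice,
  \<open>q\<close> that of the square one. These inequalities are all that the comparison uses about
  the exponentials; the last one bounds the defect of the product by the defect of the sum.\<close>

locale nome_pair =
  fixes x y q :: real
  assumes x_pos: "0 < x" and x_le: "x \<le> q" and q_le: "q \<le> 1/20" and y_ge: "q \<le> y"
    and prod_le: "x * y \<le> q\<^sup>2" and defect_le: "q\<^sup>2 - x * y \<le> 2 * q * (x + y - 2 * q)"
begin

definition "G = x + y - 2 * q"

lemma defect_le_G: "q\<^sup>2 - x * y \<le> 2 * q * G"
  using defect_le by (simp add: G_def)

lemma q_pos: "0 < q" and y_pos: "0 < y"
  using x_pos x_le y_ge by linarith+

lemma G_nonneg: "0 \<le> G"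
proof -
  have "0 \<le> 2 * q * G" using prod_le defect_le_G by linarith
  then show ?thesis using q_pos by (simp add: zero_le_mult_iff)
qed

text \<open>Mean value bound for the m-th power between xy and q^2, with the defect replaced by 2qG.
  For \<open>m = 0\<close> the truncated exponent \<open>2 * m - 1\<close> does no harm, since the
  factor m vanishes.\<close>

lemma prod_power_ge: "(x * y) ^ m \<ge> q ^ (2 * m) - 2 * real m * q ^ (2 * m - 1) * G" 
proof (cases m)
  case 0
  then show ?thesis by simp
next
  case (Suc k)
  have "(q\<^sup>2) ^ Suc k - (x * y) ^ Suc k \<le> real (Suc k) * (q\<^sup>2) ^ k * (q\<^sup>2 - x * y)"
    using x_pos y_pos prod_le by (intro power_diff_le) auto
  also have "\<dots> \<le> real (Suc k) * (q\<^sup>2) ^ k * (2 * q * G)"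
    using defect_le_G q_pos by (intro mult_left_mono) auto
  also have "\<dots> = 2 * real m * q ^ (2 * m - 1) * G"
    using Suc by (simp flip: power_mult)
  finally show ?thesis using Suc by (simp only: power_mult)
qed

lemma prod_power_le: "(x * y) ^ m \<le> q ^ (2 * m)"
  using power_mono[OF prod_le, of m] x_pos y_pos by (simp add: power_mult)

text \<open>From above, the second-order remainder is at most a multiple of (y - x)^2, and x + y =
  2q + G turns this square into (12q + G) G at most. From below, the product bound forces the sum of
  the powers to be nearly 2q^N.\<close>

lemma power_sum_bounds:
  assumes y: "y \<le> 1/8" and N: "2 \<le> N"
  shows "\<bar>x ^ N + y ^ N - 2 * q ^ N\<bar> \<le> (real N)\<^sup>2 * (1/8) ^ (N - 2) * G"
proof -
  obtain K where K: "N = Suc (Suc K)" using N by (metis Suc_le_D numeral_2_eq_2 Suc_le_mono)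
  have xy: "x \<le> y" using x_le y_ge by linarith
  have sq: "(y - x)\<^sup>2 \<le> (12 * q + G) * G"
  proof -
    have "(y - x)\<^sup>2 = 4 * q * G + G\<^sup>2 + 4 * (q\<^sup>2 - x * y)"
      by (simp add: G_def power2_eq_square algebra_simps)
    also have "\<dots> \<le> 4 * q * G + G\<^sup>2 + 4 * (2 * q * G)"
      using mult_left_mono[OF defect_le_G, of 4] by (intro add_left_mono) simp
    finally show ?thesis by (simp add: power2_eq_square algebra_simps)
  qed
  have G8: "G \<le> 1/8" using x_le y q_pos unfolding G_def by linarith
  have yk: "y ^ K \<le> (1/8) ^ K" using y y_pos by (intro power_mono) auto
  have "x ^ N + y ^ N - 2 * q ^ N \<le> real N * (y ^ Suc K * G + (y ^ Suc K - x ^ Suc K) * (q - x))"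
    using power_sum_le[of x q y "Suc K"] x_pos x_le y_ge K by (simp add: G_def)
  also have "\<dots> \<le> real N * (y ^ Suc K * G + (real N - 1) * y ^ K * ((12 * q + G) * G))"
  proof (intro mult_left_mono add_left_mono)
    have "(y ^ Suc K - x ^ Suc K) * (q - x) \<le> (real (Suc K) * y ^ K * (y - x)) * (y - x)"
      using power_diff_le[of x y K] x_pos xy x_le y_ge y_pos by (intro mult_mono) auto
    also have "\<dots> = (real N - 1) * y ^ K * (y - x)\<^sup>2" using K by (simp add: power2_eq_square)
    also have "\<dots> \<le> (real N - 1) * y ^ K * ((12 * q + G) * G)"
      using sq y_pos N by (intro mult_left_mono) auto
    finally show "(y ^ Suc K - x ^ Suc K) * (q - x) \<le> (real N - 1) * y ^ K * ((12 * q + G) * G)" .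
  qed simp
  also have "\<dots> = (y ^ K * G) * (real N * (y + (real N - 1) * (12 * q + G)))"
    by (simp add: algebra_simps)
  also have "\<dots> \<le> (y ^ K * G) * (real N * real N)"
  proof (intro mult_left_mono)
    \<comment> \<open>12/20 + 1/8 = 0.725 stays below 3/4.\<close>
    have "(real N - 1) * (12 * q + G) \<le> (real N - 1) * (3/4)"
      using q_le G8 N by (intro mult_left_mono) auto
    then show "y + (real N - 1) * (12 * q + G) \<le> real N" using y N by simp
  qed (use y_pos G_nonneg in auto)
  also have "\<dots> \<le> ((1/8) ^ K * G) * (real N * real N)"
    using yk G_nonneg by (intro mult_right_mono) auto
  finally have up: "x ^ N + y ^ N - 2 * q ^ N \<le> (real N)\<^sup>2 * (1/8) ^ (N - 2) * G"
    using K by (simp add: power2_eq_square mult_ac)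
  have "x ^ N + y ^ N \<ge> 2 * (q ^ N - real N * q ^ (N - 1) * G)"
  proof -
    \<comment> \<open>AM-GM for the powers, via squares to stay with integer exponents.\<close>
    have a: "(x * y) ^ N \<ge> q ^ (2 * N) - 2 * real N * q ^ (2 * N - 1) * G" by (rule prod_power_ge)
    have "2 * N - 1 = N + (N - 1)" using N by simp
    then have e: "q ^ (2 * N - 1) = q ^ N * q ^ (N - 1)" by (simp only: power_add)
    define A where "A = q ^ N"
    define B where "B = real N * q ^ (N - 1) * G"
    have "2 * (A - B) \<le> x ^ N + y ^ N"
    proof (rule ccontr)
      assume "\<not> ?thesis"
      then have lt: "x ^ N + y ^ N < 2 * (A - B)" by simp
      have xN: "x ^ N \<le> A" unfolding A_def using x_pos x_le by (intro power_mono) auto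
      have "y ^ N \<ge> A" unfolding A_def using q_pos y_ge by (intro power_mono) auto
      have "x ^ N * y ^ N \<ge> A * A - 2 * A * B"
      proof -
        have "(x * y) ^ N = x ^ N * y ^ N" by (rule power_mult_distrib)
        moreover have "q ^ (2 * N) = A * A" unfolding A_def by (simp only: mult_2 power_add)
        ultimately show ?thesis using a unfolding e A_def B_def by (simp add: mult_ac)
      qed
      moreover have "y ^ N < 2 * A - 2 * B - x ^ N" using lt by simp
      then have "x ^ N * y ^ N < x ^ N * (2 * A - 2 * B - x ^ N)"
        using x_pos by (intro mult_strict_left_mono) auto
      ultimately have "A * A - 2 * A * B < x ^ N * (2 * A - 2 * B - x ^ N)" by linarith
      then have "(A - x ^ N) * (A - x ^ N) < 2 * B * (A - x ^ N)"
        by (simp add: algebra_simps)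
      then have "A - x ^ N < 2 * B" using xN
        by (metis diff_ge_0_iff_ge mult_right_mono not_less)
      then have "A + (A - 2 * B) < y ^ N + x ^ N" using \<open>y ^ N \<ge> A\<close>
        by (intro add_le_less_mono) auto
      then show False using lt by simp
    qed
    then show ?thesis by (simp add: A_def B_def)
  qed
  moreover have "2 * (real N * q ^ (N - 1) * G) \<le> (real N)\<^sup>2 * (1/8) ^ (N - 2) * G"
  proof -
    have "q ^ (N - 1) \<le> (1/8) ^ (N - 1)" using q_pos q_le by (intro power_mono) auto
    also have "\<dots> \<le> (1/8) ^ (N - 2)" by (rule power_decreasing) auto
    finally have "2 * (real N * q ^ (N - 1)) \<le> real N * (real N * (1/8) ^ (N - 2))"
      using N q_pos by (subst mult.left_commute) (intro mult_left_mono mult_mono, auto)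
    then have "2 * (real N * q ^ (N - 1)) * G \<le> real N * (real N * (1/8) ^ (N - 2)) * G"
      using G_nonneg by (rule mult_right_mono)
    then show ?thesis by (simp add: power2_eq_square mult_ac)
  qed
  ultimately show ?thesis using up by argo
qed

text \<open>Factoring out (xy)^a leaves the power sum of exponent N = b - a and the deviation of
  (xy)^a from q^(2a). The exclusion of b = a + 1 keeps N away from 1; for squares a and b that case
  occurs only as (0, 1), that is at the unit indices, which are treated exactly.\<close>

lemma pair_sum_bound:
  assumes y: "y \<le> 1/8" and ab: "a \<le> b" "b \<noteq> Suc a" "2 \<le> a + b"
  shows "\<bar>x ^ a * y ^ b + x ^ b * y ^ a - 2 * q ^ (a + b)\<bar> \<le> (real (a + b))\<^sup>2 * (1/8) ^ (a + b - 2) * G"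
proof -
  define N where "N = b - a"
  have b: "b = a + N" and N: "N = 0 \<or> 2 \<le> N" using ab by (auto simp: N_def)
  have eq: "x ^ a * y ^ b + x ^ b * y ^ a - 2 * q ^ (a + b)
      = (x * y) ^ a * (x ^ N + y ^ N - 2 * q ^ N) + 2 * q ^ N * ((x * y) ^ a - q ^ (2 * a))"
  proof -
    have "q ^ (2 * a) = q ^ a * q ^ a" "q ^ (a + b) = q ^ a * q ^ a * q ^ N"
      by (simp_all only: b mult_2 power_add mult.assoc)
    then show ?thesis by (simp add: b power_add power_mult_distrib algebra_simps)
  qed
  have d2: "\<bar>(x * y) ^ a - q ^ (2 * a)\<bar> \<le> 2 * real a * q ^ (2 * a - 1) * G"
    using prod_power_ge[of a] prod_power_le[of a] by linarith
  have d1: "\<bar>x ^ N + y ^ N - 2 * q ^ N\<bar> * (x * y) ^ a \<le> (real N)\<^sup>2 * (1/8) ^ (a + b - 2) * G"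
  proof (cases "N = 0")
    case False
    with N have N2: "2 \<le> N" by simp
    have "(x * y) ^ a \<le> (1/8) ^ (2 * a)"
      using prod_power_le[of a] power_mono[of q "1/8" "2 * a"] q_le q_pos by linarith
    then have "\<bar>x ^ N + y ^ N - 2 * q ^ N\<bar> * (x * y) ^ a \<le> ((real N)\<^sup>2 * (1/8) ^ (N - 2) * G) * (1/8) ^ (2 * a)"
      using power_sum_bounds[OF y N2] x_pos y_pos G_nonneg by (intro mult_mono) auto
    also have "\<dots> = (real N)\<^sup>2 * ((1/8) ^ (N - 2) * (1/8) ^ (2 * a)) * G" by simp
    also have "(1/8 :: real) ^ (N - 2) * (1/8) ^ (2 * a) = (1/8) ^ (N - 2 + 2 * a)"
      by (simp only: power_add)
    also have "N - 2 + 2 * a = a + b - 2" using b N2 by simp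
    finally show ?thesis .
  qed simp
  have d3: "2 * q ^ N * \<bar>(x * y) ^ a - q ^ (2 * a)\<bar> \<le> 4 * real a * (1/8) ^ (a + b - 2) * G"
  proof (cases "a = 0")
    case False
    have "2 * q ^ N * \<bar>(x * y) ^ a - q ^ (2 * a)\<bar> \<le> 2 * q ^ N * (2 * real a * q ^ (2 * a - 1) * G)"
      using d2 q_pos by (intro mult_left_mono) auto
    also have "\<dots> = 4 * real a * (q ^ N * q ^ (2 * a - 1)) * G" by simp
    also have "q ^ N * q ^ (2 * a - 1) = q ^ (N + (2 * a - 1))" by (simp only: power_add)
    also have "N + (2 * a - 1) = a + b - 1" using b False by simp
    also have "4 * real a * q ^ (a + b - 1) * G \<le> 4 * real a * (1/8) ^ (a + b - 2) * G"
    proof (intro mult_right_mono mult_left_mono)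
      have "q ^ (a + b - 1) \<le> (1/8) ^ (a + b - 1)" using q_pos q_le by (intro power_mono) auto
      also have "\<dots> \<le> (1/8) ^ (a + b - 2)" by (rule power_decreasing) auto
      finally show "q ^ (a + b - 1) \<le> (1/8) ^ (a + b - 2)" .
    qed (use G_nonneg in auto)
    finally show ?thesis .
  qed simp
  have "\<bar>x ^ a * y ^ b + x ^ b * y ^ a - 2 * q ^ (a + b)\<bar>
      \<le> \<bar>x ^ N + y ^ N - 2 * q ^ N\<bar> * (x * y) ^ a + 2 * q ^ N * \<bar>(x * y) ^ a - q ^ (2 * a)\<bar>"
    unfolding eq using x_pos y_pos q_pos
    by (intro order_trans[OF abs_triangle_ineq]) (simp add: abs_mult mult_ac)
  also have "\<dots> \<le> ((real N)\<^sup>2 + 4 * real a) * ((1/8) ^ (a + b - 2) * G)"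
    using d1 d3 by (simp add: algebra_simps)
  also have "\<dots> \<le> (real (a + b))\<^sup>2 * ((1/8) ^ (a + b - 2) * G)"
  proof (intro mult_right_mono)
    have "real a \<le> real a * real a" by (metis le_square of_nat_le_iff of_nat_mult)
    then have "(real N)\<^sup>2 + 4 * real a \<le> (real N)\<^sup>2 + 4 * (real a * real a) + 4 * (real a * real N)"
      using mult_nonneg_nonneg[of "real a" "real N", OF of_nat_0_le_iff of_nat_0_le_iff] by linarith
    also have "\<dots> = (real (a + b))\<^sup>2" by (simp add: b power2_eq_square algebra_simps)
    finally show "(real N)\<^sup>2 + 4 * real a \<le> (real (a + b))\<^sup>2" .
  qed (use G_nonneg in auto)
  finally show ?thesis by (simp add: mult_ac)
qed

end

section \<open>The defect inequality for exponential nomes\<close>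

lemma exp_neg_le_one_twentieth:
  fixes X :: real assumes "3 \<le> X" shows "exp (- X) \<le> 1/20"
proof -
  \<comment> \<open>2.71 * 1.003 = 2.71813 lies just below e, and its cube is about 20.08.\<close>
  have "20 \<le> (271/100 * 1.003 :: real) ^ 3" by (simp add: power3_eq_cube)
  also have "\<dots> \<le> exp 1 ^ 3"
  proof (intro power_mono)
    have "5837465777 / 2147483648 - exp (1::real) \<le> inverse (2 ^ 32)"
      using e_approx_32 by linarith
    then show "271/100 * 1.003 \<le> exp (1::real)" by simp
  qed simp
  also have "\<dots> = exp (3::real)" by (simp flip: exp_of_nat_mult)
  also have "exp 3 \<le> exp X" using assms by simp
  finally have "20 \<le> exp X" .
  then show ?thesis by (simp add: exp_minus field_simps)
qed

text \<open>With v = 1 - 1/s, h = Xv and w = s + 1/s - 2 one has y = q exp(h), x = q \<tau> exp(-h)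
  and xy = q^2 \<tau>, where \<tau> = exp(-Xw). Dividing the defect inequality by q^2 leaves the
  inequality \<open>key\<close> between \<tau> and h.\<close>

lemma nome_pair_exp:
  fixes X s :: real
  assumes X: "3 \<le> X" and s: "1 \<le> s"
  shows "nome_pair (exp (- X * s)) (exp (- X / s)) (exp (- X))"
proof
  define v where "v = 1 - 1 / s"
  have v: "0 \<le> v" "v < 1" using s by (auto simp: v_def)
  define h where "h = X * v"
  define w where "w = s - 1 - v"
  have sv: "1 / s = 1 - v" by (simp add: v_def)
  have s': "s = 1 / (1 - v)" using s by (simp add: v_def)
  have w: "w * (1 - v) = v\<^sup>2" using v by (simp add: w_def s' field_simps power2_eq_square)
  have w0: "0 \<le> w" using w v by (smt (verit) mult_neg_pos zero_le_power2)
  have h0: "0 \<le> h" using X v by (simp add: h_def)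
  define q where "q = exp (- X)"
  define \<tau> where "\<tau> = exp (- (X * w))"
  have y: "exp (- X / s) = q * exp h"
  proof -
    have "- X / s = - X * (1 / s)" by simp
    also have "\<dots> = - X + h" unfolding sv h_def by (simp add: algebra_simps)
    finally show ?thesis unfolding q_def by (simp only: exp_add)
  qed
  have x: "exp (- X * s) = q * (\<tau> * exp (- h))"
  proof -
    have "- X * s = - X + (- (X * w) + - h)" unfolding w_def h_def by (simp add: algebra_simps)
    then show ?thesis unfolding q_def \<tau>_def by (simp only: exp_add)
  qed
  have q0: "0 < q" by (simp add: q_def)
  have tau: "0 < \<tau>" "\<tau> \<le> 1" "1 - \<tau> \<le> X * w"
    using X w0 exp_ge_add_one_self[of "- (X * w)"] by (auto simp: \<tau>_def)
  have eh: "exp (-h) \<le> 1" using h0 by simp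
  \<comment> \<open>The right-hand side is (exp z - exp (-z))^2 for z = h/2, so the claim is 2z <=
    exp z - exp (-z). The bound for exp (-z) comes from (1 - z + z^2/2)(1 + z + z^2/2) = 1 +
    z^4/4.\<close>
  have ch: "h\<^sup>2 \<le> exp h + exp (- h) - 2"
  proof -
    define z where "z = h / 2"
    have z0: "0 \<le> z" using h0 by (simp add: z_def)
    have a: "1 + z + z\<^sup>2 / 2 \<le> exp z" using z0 by (rule exp_lower_Taylor_quadratic)
    have "1 \<le> 1 + z ^ 4 / 4" by simp
    also have "\<dots> = (1 - z + z\<^sup>2 / 2) * (1 + z + z\<^sup>2 / 2)"
      by (simp add: power2_eq_square power4_eq_xxxx field_simps)
    also have "\<dots> \<le> (1 - z + z\<^sup>2 / 2) * exp z"
      using a sum_squares_ge_zero[of "z - 1" 1]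
      by (intro mult_left_mono) (auto simp: power2_eq_square algebra_simps)
    finally have "exp (- z) \<le> 1 - z + z\<^sup>2 / 2" by (simp add: exp_minus field_simps)
    with a have "2 * z \<le> exp z - exp (- z)" by linarith
    then have "(2 * z)\<^sup>2 \<le> (exp z - exp (- z))\<^sup>2" using z0 by (intro power_mono) auto
    also have "\<dots> = exp h + exp (- h) - 2"
      by (simp add: power2_eq_square algebra_simps z_def flip: exp_add)
    finally show ?thesis by (simp add: z_def)
  qed
  \<comment> \<open>For v <= 1/2 the left side is at most 3Xw <= 6Xv^2, which is at most 2h^2
    precisely because X >= 3. For larger v the left side is at most 3, while h >= 3/2 makes 2h^2 at
    least 9/2.\<close>
  have key: "(1 - \<tau>) * (1 + 2 * exp (- h)) \<le> 2 * (exp h + exp (- h) - 2)"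
  proof (cases "v \<le> 1/2")
    case True
    have "X * w * 3 \<le> 2 * h\<^sup>2"
    proof -
      have "w \<le> 2 * v\<^sup>2" using w True w0 mult_left_mono[of "1/2" "1 - v" w] by simp
      then have "X * w * 3 \<le> X * (2 * v\<^sup>2) * X" using X w0 by (intro mult_mono) auto
      then show ?thesis by (simp add: h_def power2_eq_square mult_ac)
    qed
    moreover have "(1 - \<tau>) * (1 + 2 * exp (- h)) \<le> (X * w) * 3"
      using tau eh X w0 by (intro mult_mono) auto
    ultimately show ?thesis using ch by argo
  next
    case False
    have "3/2 \<le> h" using X False mult_mono[of 3 X "1/2" v] by (simp add: h_def)
    then have "(3/2)\<^sup>2 \<le> h\<^sup>2" by (intro power_mono) auto
    moreover have "(1 - \<tau>) * (1 + 2 * exp (- h)) \<le> 1 * 3"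
      using tau eh by (intro mult_mono) auto
    ultimately show ?thesis using ch by (simp add: power2_eq_square)
  qed
  show "0 < exp (- X * s)" by simp
  show "exp (- X * s) \<le> exp (- X)" using X s by simp
  show "exp (- X) \<le> 1/20" using X by (rule exp_neg_le_one_twentieth)
  show "exp (- X) \<le> exp (- X / s)" using h0 q0 y by (simp add: q_def)
  have xy: "exp (- X * s) * exp (- X / s) = q\<^sup>2 * \<tau>"
    unfolding x y by (simp add: power2_eq_square mult_ac flip: exp_add)
  show "exp (- X * s) * exp (- X / s) \<le> (exp (- X))\<^sup>2"
    unfolding xy using tau by (simp add: q_def)
  have "q\<^sup>2 * (1 - \<tau>) \<le> q\<^sup>2 * (2 * (exp h + \<tau> * exp (- h) - 2))"
    using key by (intro mult_left_mono) (auto simp: algebra_simps)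
  then show "(exp (- X))\<^sup>2 - exp (- X * s) * exp (- X / s)
      \<le> 2 * exp (- X) * (exp (- X * s) + exp (- X / s) - 2 * exp (- X))"
    unfolding xy unfolding x y q_def[symmetric] by (simp add: algebra_simps power2_eq_square)
qed

section \<open>Signed Gaussian double series\<close>

lemma has_sum_int_geometric:
  fixes r :: real
  assumes r: "0 \<le> r" "r < 1"
  shows "((\<lambda>k::int. r ^ nat \<bar>k\<bar>) has_sum ((1 + r) / (1 - r))) UNIV"
proof -
  have g: "((\<lambda>n::nat. r ^ n) has_sum (1 / (1 - r))) UNIV"
    using r geometric_sums[of r] by (intro sums_nonneg_imp_has_sum) auto
  have "((\<lambda>k::int. r ^ nat \<bar>k\<bar>) has_sum (1 / (1 - r))) (range int)"
    using g by (subst has_sum_reindex) (auto simp: o_def)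
  moreover have "((\<lambda>k::int. r ^ nat \<bar>k\<bar>) has_sum (r * (1 / (1 - r)))) (range (\<lambda>n. - int (Suc n)))"
  proof (subst has_sum_reindex)
    show "inj (\<lambda>n. - int (Suc n))" by (auto intro: injI)
    have "nat \<bar>- int (Suc n)\<bar> = Suc n" for n by linarith
    then show "((\<lambda>k. r ^ nat \<bar>k\<bar>) \<circ> (\<lambda>n. - int (Suc n)) has_sum r * (1 / (1 - r))) UNIV"
      using has_sum_cmult_right[OF g, of r] by (simp add: o_def)
  qed
  moreover have "range int \<inter> range (\<lambda>n. - int (Suc n)) = {}" by auto
  ultimately have "((\<lambda>k::int. r ^ nat \<bar>k\<bar>) has_sum (1 / (1 - r) + r * (1 / (1 - r)))) (range int \<union> range (\<lambda>n. - int (Suc n)))"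
    by (rule has_sum_Un_disjoint)
  moreover have "range int \<union> range (\<lambda>n. - int (Suc n)) = UNIV"
  proof -
    have "k \<in> range int \<union> range (\<lambda>n. - int (Suc n))" for k
      by (cases k) auto
    then show ?thesis by auto
  qed
  moreover have "1 / (1 - r) + r * (1 / (1 - r)) = (1 + r) / (1 - r)" by (simp add: add_divide_distrib)
  ultimately show ?thesis by simp
qed

lemma
  fixes f g :: "'a \<Rightarrow> 'b::{banach}"
  assumes f: "f summable_on A" and g: "g summable_on A"
  shows summable_on_diff: "(\<lambda>x. f x - g x) summable_on A"
    and infsum_diff: "infsum (\<lambda>x. f x - g x) A = infsum f A - infsum g A"
proof -
  have "((\<lambda>x. f x + - g x) has_sum (infsum f A + - infsum g A)) A"
    using f g by (intro has_sum_add) (auto simp: has_sum_uminus)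
  then show "(\<lambda>x. f x - g x) summable_on A" "infsum (\<lambda>x. f x - g x) A = infsum f A - infsum g A"
    by (auto simp: summable_on_def intro: infsumI)
qed

lemma summable_on_int_square_power:
  fixes r :: real
  assumes r: "0 \<le> r" "r < 1"
  shows "(\<lambda>k::int. r ^ nat (k\<^sup>2)) summable_on UNIV"
proof (rule summable_on_comparison_test)
  show "(\<lambda>k::int. r ^ nat \<bar>k\<bar>) summable_on UNIV"
    using has_sum_int_geometric[OF r] by (auto simp: summable_on_def)
  fix k :: int
  have "\<bar>k\<bar> \<le> \<bar>k\<bar> * \<bar>k\<bar>" using mult_right_mono[of 1 "\<bar>k\<bar>" "\<bar>k\<bar>"] by (cases "k = 0") auto
  then have "nat \<bar>k\<bar> \<le> nat (k\<^sup>2)" by (simp add: power2_eq_square abs_mult_self_eq)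
  then show "r ^ nat (k\<^sup>2) \<le> r ^ nat \<bar>k\<bar>" using r by (intro power_decreasing) auto
qed (use r in auto)

lemma has_sum_prod_nonneg:
  fixes f g :: "int \<Rightarrow> real"
  assumes f: "(f has_sum a) UNIV" and g: "(g has_sum b) UNIV"
    and "\<And>k. 0 \<le> f k" "\<And>k. 0 \<le> g k"
  shows "((\<lambda>(k, l). f k * g l) has_sum (a * b)) UNIV"
proof -
  have 1: "((\<lambda>l. case (k, l) of (k, l) \<Rightarrow> f k * g l) has_sum (f k * b)) UNIV" for k
    using has_sum_cmult_right[OF g] by simp
  have 2: "((\<lambda>k. f k * b) has_sum (a * b)) UNIV" using has_sum_cmult_left[OF f] by simp
  have "(\<lambda>(k, l). f k * g l) summable_on UNIV \<times> UNIV"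
    by (rule summable_on_SigmaI[OF 1 has_sum_imp_summable[OF 2]]) (use assms in auto)
  from has_sum_SigmaI[OF 1 2 this] show ?thesis by simp
qed

definition gauss_weight :: "real \<Rightarrow> real \<Rightarrow> int \<times> int \<Rightarrow> real" where
  "gauss_weight x y = (\<lambda>(k, l). x ^ nat (k\<^sup>2) * y ^ nat (l\<^sup>2))"

lemma gauss_weight_nonneg: "0 \<le> x \<Longrightarrow> 0 \<le> y \<Longrightarrow> 0 \<le> gauss_weight x y p"
  by (auto simp: gauss_weight_def split: prod.split)

lemma has_sum_gauss_weight:
  assumes "0 \<le> x" "x < 1" "0 \<le> y" "y < 1"
  shows "(gauss_weight x y has_sum (\<Sum>\<^sub>\<infinity>k::int. x ^ nat (k\<^sup>2)) * (\<Sum>\<^sub>\<infinity>l::int. y ^ nat (l\<^sup>2))) UNIV"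
  unfolding gauss_weight_def
  by (rule has_sum_prod_nonneg) (use assms in \<open>auto intro!: has_sum_infsum summable_on_int_square_power\<close>)

lemma summable_gauss_weight:
  assumes "0 \<le> x" "x < 1" "0 \<le> y" "y < 1"
  shows "gauss_weight x y summable_on A"
  using has_sum_gauss_weight[OF assms] summable_on_subset[of "gauss_weight x y" UNIV A]
  by (auto simp: summable_on_def)

lemma summable_gauss_weight_mult:
  fixes c :: "int \<times> int \<Rightarrow> real"
  assumes "0 \<le> x" "x < 1" "0 \<le> y" "y < 1" and c: "\<And>p. \<bar>c p\<bar> \<le> C"
  shows "(\<lambda>p. c p * gauss_weight x y p) summable_on A"
proof (rule Infinite_Sum.abs_summable_summable, rule Infinite_Sum.abs_summable_on_comparison_test')
  show "(\<lambda>p. C * gauss_weight x y p) summable_on A"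
    by (intro summable_on_cmult_right summable_gauss_weight assms)
  show "norm (c p * gauss_weight x y p) \<le> C * gauss_weight x y p" for p
    using gauss_weight_nonneg[of x y p] assms(1,3) mult_right_mono[OF c[of p], of "gauss_weight x y p"]
    by (simp add: abs_mult)
qed

section \<open>The nine central indices and a universal tail constant\<close>

definition unit_box :: "(int \<times> int) set" where "unit_box = {-1..1} \<times> {-1..1}"

lemma unit_box_eq: "unit_box = {(-1,-1), (-1,0), (-1,1), (0,-1), (0,0), (0,1), (1,-1), (1,0), (1,1)}"
proof -
  have "{-1..1} = {-1, 0, 1 :: int}" by auto
  then show ?thesis by (auto simp: unit_box_def)
qed

lemma finite_unit_box: "finite unit_box" by (simp add: unit_box_def)

lemma infsum_split_unit_box:
  fixes f :: "int \<times> int \<Rightarrow> real"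
  assumes "f summable_on UNIV"
  shows "infsum f UNIV = sum f unit_box + infsum f (- unit_box)"
proof -
  have "infsum f (unit_box \<union> - unit_box) = infsum f unit_box + infsum f (- unit_box)"
    using assms by (intro infsum_Un_disjoint) (auto intro: summable_on_subset)
  then show ?thesis by (simp add: finite_unit_box)
qed

text \<open>The terms with |k| <= 2 are summed exactly; beyond them k^2 >= 3|k| allows comparison
  with the geometric series of ratio 1/8. The result is 17/8 + 9/7 - 41/32 < 2.13.\<close>

lemma infsum_half_square_le: "(\<Sum>\<^sub>\<infinity>k::int. (1/2::real) ^ nat (k\<^sup>2)) \<le> 213/100"
proof -
  define f where "f k = (1/2::real) ^ nat (k\<^sup>2)" for k :: int
  define g where "g k = (1/8::real) ^ nat \<bar>k\<bar>" for k :: int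
  define S where "S = {-2..2::int}"
  have S: "S = {-2,-1,0,1,2}" by (auto simp: S_def)
  have gs: "(g has_sum (9/7)) UNIV" using has_sum_int_geometric[of "1/8"] by (simp add: g_def [abs_def])
  have fs: "f summable_on UNIV" unfolding f_def by (rule summable_on_int_square_power) auto
  have sf: "f summable_on A" and sg: "g summable_on A" for A
    using summable_on_subset[OF fs] summable_on_subset[OF has_sum_imp_summable[OF gs]] by auto
  have split: "infsum h UNIV = sum h S + infsum h (- S)" if "\<And>A. h summable_on A" for h :: "int \<Rightarrow> real"
  proof -
    have "infsum h (S \<union> - S) = infsum h S + infsum h (- S)"
      by (rule infsum_Un_disjoint[OF that that]) simp
    then show ?thesis by (simp add: S_def)
  qed
  have "infsum f (- S) \<le> infsum g (- S)"
  proof (rule infsum_mono[OF sf sg])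
    fix k :: int assume "k \<in> - S"
    then have "3 \<le> \<bar>k\<bar>" by (auto simp: S_def)
    then have "3 * \<bar>k\<bar> \<le> \<bar>k\<bar> * \<bar>k\<bar>" by (intro mult_right_mono) auto
    then have "nat (3 * \<bar>k\<bar>) \<le> nat (k\<^sup>2)" by (intro nat_mono) (simp add: power2_eq_square)
    then have "3 * nat \<bar>k\<bar> \<le> nat (k\<^sup>2)" by (simp add: nat_mult_distrib)
    then have "f k \<le> (1/2) ^ (3 * nat \<bar>k\<bar>)" unfolding f_def by (intro power_decreasing) auto
    also have "\<dots> = g k" by (simp add: g_def power_mult power3_eq_cube)
    finally show "f k \<le> g k" .
  qed
  moreover have "sum f S = 17/8" "sum g S = 41/32"
    by (simp_all add: S f_def g_def power2_eq_square eval_nat_numeral)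
  moreover have "infsum g UNIV = 9/7" using gs by (rule infsumI)
  ultimately have "infsum f UNIV \<le> 213/100"
    using split[of f, OF sf] split[of g, OF sg] by simp
  then show ?thesis by (simp only: f_def [abs_def])
qed

text \<open>2.13^2 = 4.5369, and the nine central weights add up to (1 + 1/2 + 1/2)^2 = 4.\<close>

lemma infsum_half_tail_le: "infsum (gauss_weight (1/2) (1/2)) (- unit_box) \<le> 54/100"
proof -
  define t where "t = (\<Sum>\<^sub>\<infinity>k::int. (1/2::real) ^ nat (k\<^sup>2))"
  have "infsum (gauss_weight (1/2) (1/2)) UNIV = t * t"
    unfolding t_def by (rule infsumI, rule has_sum_gauss_weight) auto
  also have "\<dots> \<le> (213/100) * (213/100)"
    unfolding t_def by (intro mult_mono infsum_half_square_le infsum_nonneg) auto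
  finally have "infsum (gauss_weight (1/2) (1/2)) UNIV \<le> (213/100) * (213/100)" .
  moreover have "sum (gauss_weight (1/2) (1/2)) unit_box = 4"
    by (simp add: unit_box_eq gauss_weight_def)
  moreover have "infsum (gauss_weight (1/2) (1/2)) UNIV = sum (gauss_weight (1/2) (1/2)) unit_box
      + infsum (gauss_weight (1/2) (1/2)) (- unit_box)"
    by (rule infsum_split_unit_box, rule summable_gauss_weight) auto
  ultimately show ?thesis by simp
qed

text \<open>All tail estimates for double series go through this comparison: a pointwise bound by C
  2^(-k^2-l^2) costs 0.54 C.\<close>

lemma infsum_outside_le:
  fixes f :: "int \<times> int \<Rightarrow> real"
  assumes f: "\<And>p. p \<notin> unit_box \<Longrightarrow> \<bar>f p\<bar> \<le> C * gauss_weight (1/2) (1/2) p" and C: "0 \<le> C"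
  shows "\<bar>infsum f (- unit_box)\<bar> \<le> C * (54/100)"
proof -
  define g where "g = gauss_weight (1/2) (1/2)"
  have g: "g summable_on (- unit_box)"
    unfolding g_def by (rule summable_gauss_weight) simp_all
  have s: "(\<lambda>p. C * g p) summable_on (- unit_box)"
    by (rule summable_on_cmult_right[OF g])
  have le: "norm (f p) \<le> C * g p" if "p \<in> - unit_box" for p
    using f[of p] that by (simp add: g_def)
  have "norm (infsum f (- unit_box)) \<le> infsum (\<lambda>p. C * g p) (- unit_box)"
  proof (rule norm_infsum_le)
    have "(\<lambda>p. norm (f p)) summable_on (- unit_box)"
      by (rule Infinite_Sum.abs_summable_on_comparison_test'[OF s le])
    then show "(f has_sum infsum f (- unit_box)) (- unit_box)"
      by (rule has_sum_infsum[OF Infinite_Sum.abs_summable_summable])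
    show "((\<lambda>p. C * g p) has_sum infsum (\<lambda>p. C * g p) (- unit_box)) (- unit_box)"
      using s by (rule has_sum_infsum)
  qed (rule le)
  also have "\<dots> = C * infsum g (- unit_box)"
    by (rule infsum_cmult_right')
  also have "\<dots> \<le> C * (54/100)" unfolding g_def using infsum_half_tail_le C by (rule mult_left_mono)
  finally show ?thesis by simp
qed

text \<open>Two squares differ by 1 only if they are 0 and 1, so outside the box the exceptional
  case b = a + 1 of \<open>pair_sum_bound\<close> does not occur.\<close>

lemma outside_unit_box_squares:
  assumes "(k, l) \<notin> unit_box"
  shows "4 \<le> nat (k\<^sup>2) + nat (l\<^sup>2)" "nat (l\<^sup>2) \<noteq> Suc (nat (k\<^sup>2))" "nat (k\<^sup>2) \<noteq> Suc (nat (l\<^sup>2))"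
proof -
  have big: "4 \<le> j\<^sup>2" if "2 \<le> \<bar>j\<bar>" for j :: int
    using power_mono[OF that, of 2] by simp
  have one: "\<bar>i\<bar> \<le> 1 \<and> \<bar>j\<bar> \<le> 1" if "nat (i\<^sup>2) = Suc (nat (j\<^sup>2))" for i j :: int
  proof -
    have "i\<^sup>2 = j\<^sup>2 + 1" using that by (simp add: Suc_as_int nat_eq_iff)
    then have eq: "\<bar>i\<bar>\<^sup>2 = \<bar>j\<bar>\<^sup>2 + 1" by simp
    have "\<bar>i\<bar> > \<bar>j\<bar>" using eq by (intro power_less_imp_less_base[of "\<bar>j\<bar>" 2]) auto
    then have "(\<bar>j\<bar> + 1)\<^sup>2 \<le> \<bar>i\<bar>\<^sup>2" by (intro power_mono) auto
    then have "2 * \<bar>j\<bar> \<le> 0" unfolding eq by (simp add: power2_eq_square algebra_simps)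
    then have "j = 0" by simp
    moreover have "\<bar>i\<bar> \<le> 1"
    proof (rule ccontr)
      assume "\<not> ?thesis" then show False using big[of i] eq \<open>j = 0\<close> by simp
    qed
    ultimately show ?thesis by simp
  qed
  have ge: "2 \<le> \<bar>k\<bar> \<or> 2 \<le> \<bar>l\<bar>" using assms by (auto simp: unit_box_def)
  then show "4 \<le> nat (k\<^sup>2) + nat (l\<^sup>2)" using big[of k] big[of l] by linarith
  show "nat (l\<^sup>2) \<noteq> Suc (nat (k\<^sup>2))" "nat (k\<^sup>2) \<noteq> Suc (nat (l\<^sup>2))"
    using one[of l k] one[of k l] ge by linarith+
qed

text \<open>Trades the factor M^2 (1/8)^(M-2) of the pair bound for 4 (1/2)^M, which fits the
  universal tail. The base case M = 4 is an equality, and 4 is the least exponent outside the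
  box.\<close>

lemma sixteen_square_le_power: "4 \<le> M \<Longrightarrow> 16 * (real M)\<^sup>2 \<le> 4 ^ M"
proof (induction M rule: nat_induct_at_least)
  case (Suc M)
  have "(real (Suc M))\<^sup>2 \<le> 4 * (real M)\<^sup>2"
    using power_mono[of "real (Suc M)" "2 * real M" 2] Suc.hyps by (simp add: power_mult_distrib)
  then show ?case using Suc.IH by simp
qed simp

context nome_pair
begin

text \<open>By the symmetry of c, twice the difference of the two sums is the sum of c T with T
  symmetrised. T vanishes at the origin and equals G at the four units; only there does the actual
  value of c matter, elsewhere |c| <= 1 is enough. Multiplying by \<sigma> makes the unit
  contribution positive in either case.\<close>

lemma signed_sum_compare:
  fixes c :: "int \<times> int \<Rightarrow> real"
  assumes y: "y \<le> 1/8"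
    and c: "\<And>p. \<bar>c p\<bar> \<le> 1" and sym: "\<And>k l. c (k, l) = c (l, k)"
    and units: "\<And>e. \<bar>e\<bar> = 1 \<Longrightarrow> c (e, 0) = \<sigma>" and \<sigma>: "\<sigma> * \<sigma> = 1"
  shows "\<sigma> * (\<Sum>\<^sub>\<infinity>p. c p * gauss_weight q q p) \<le> \<sigma> * (\<Sum>\<^sub>\<infinity>p. c p * gauss_weight x y p)"
proof -
  have lt: "0 \<le> x" "x < 1" "0 \<le> y" "y < 1" "0 \<le> q" "q < 1"
    using x_pos y_pos q_pos x_le q_le y by auto
  define T where "T p = gauss_weight x y p + gauss_weight y x p - 2 * gauss_weight q q p" for p
  have sw: "(\<Sum>\<^sub>\<infinity>p. c p * gauss_weight x y p) = (\<Sum>\<^sub>\<infinity>p. c p * gauss_weight y x p)"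
  proof (rule infsum_reindex_bij_witness[of _ prod.swap prod.swap])
    show "c (prod.swap a) * gauss_weight y x (prod.swap a) = c a * gauss_weight x y a" for a
      using sym[of "fst a" "snd a"] by (cases a) (auto simp: gauss_weight_def)
  qed auto
  have s: "(\<lambda>p. c p * gauss_weight x y p) summable_on A" "(\<lambda>p. c p * gauss_weight y x p) summable_on A"
    "(\<lambda>p. c p * gauss_weight q q p) summable_on A" for A
    by (rule summable_gauss_weight_mult[where C = 1], (rule lt c)+)+
  have cT: "(\<lambda>p. c p * T p) = (\<lambda>p. c p * gauss_weight x y p + c p * gauss_weight y x p - 2 * (c p * gauss_weight q q p))"
    by (auto simp: T_def algebra_simps)
  have sT: "(\<lambda>p. c p * T p) summable_on A" for A
    unfolding cT by (intro summable_on_diff summable_on_add s summable_on_cmult_right)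
  have "(\<Sum>\<^sub>\<infinity>p. c p * T p) = (\<Sum>\<^sub>\<infinity>p. c p * gauss_weight x y p) + (\<Sum>\<^sub>\<infinity>p. c p * gauss_weight y x p)
      - 2 * (\<Sum>\<^sub>\<infinity>p. c p * gauss_weight q q p)"
    unfolding cT
    by (simp add: infsum_diff infsum_add s summable_on_add summable_on_cmult_right infsum_cmult_right')
  then have tot: "(\<Sum>\<^sub>\<infinity>p. c p * T p) = 2 * ((\<Sum>\<^sub>\<infinity>p. c p * gauss_weight x y p) - (\<Sum>\<^sub>\<infinity>p. c p * gauss_weight q q p))"
    using sw by simp
  have split: "(\<Sum>\<^sub>\<infinity>p. c p * T p) = (\<Sum>p\<in>unit_box. c p * T p) + infsum (\<lambda>p. c p * T p) (- unit_box)"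
    by (rule infsum_split_unit_box[OF sT])
  have out: "\<bar>infsum (\<lambda>p. c p * T p) (- unit_box)\<bar> \<le> (4 * G) * (54/100)"
  proof (rule infsum_outside_le)
    fix p :: "int \<times> int" assume "p \<notin> unit_box"
    then obtain k l where p: "p = (k, l)" and kl: "(k, l) \<notin> unit_box" by (cases p) auto
    define a where "a = nat (k\<^sup>2)"
    define b where "b = nat (l\<^sup>2)"
    note ob = outside_unit_box_squares[OF kl, folded a_def b_def]
    have T: "T p = x ^ a * y ^ b + x ^ b * y ^ a - 2 * q ^ (a + b)"
      by (simp add: T_def p gauss_weight_def a_def b_def power_add mult_ac)
    have "\<bar>T p\<bar> \<le> (real (a + b))\<^sup>2 * (1/8) ^ (a + b - 2) * G"
    proof (cases "a \<le> b")
      case True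
      then show ?thesis unfolding T using ob by (intro pair_sum_bound y) auto
    next
      case False
      then have "\<bar>x ^ b * y ^ a + x ^ a * y ^ b - 2 * q ^ (b + a)\<bar> \<le> (real (b + a))\<^sup>2 * (1/8) ^ (b + a - 2) * G"
        using ob by (intro pair_sum_bound y) auto
      then show ?thesis unfolding T by (simp add: add_ac)
    qed
    also have "\<dots> \<le> 4 * G * (1/2) ^ (a + b)"
    proof -
      define M where "M = a + b - 2"
      have M: "a + b = M + 2" using ob(1) by (simp add: M_def)
      have "16 * (real (M + 2))\<^sup>2 \<le> 4 ^ (M + 2)" using ob(1) M by (intro sixteen_square_le_power) auto
      then have "(real (M + 2))\<^sup>2 * (1/8) ^ M \<le> 4 ^ M * (1/8) ^ M" by (intro mult_right_mono) auto
      also have "\<dots> = (1/2) ^ M" by (simp flip: power_mult_distrib)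
      finally have "(real (M + 2))\<^sup>2 * (1/8) ^ M * G \<le> (1/2) ^ M * G" using G_nonneg by (rule mult_right_mono)
      then show ?thesis unfolding M by (simp add: mult_ac)
    qed
    finally have T4: "\<bar>T p\<bar> \<le> 4 * G * (1/2) ^ (a + b)" .
    have "\<bar>c p * T p\<bar> \<le> \<bar>T p\<bar>" using c[of p] by (simp add: abs_mult mult_left_le_one_le)
    also note T4
    finally show "\<bar>c p * T p\<bar> \<le> 4 * G * gauss_weight (1/2) (1/2) p"
      by (simp add: p gauss_weight_def a_def b_def power_add)
  qed (use G_nonneg in auto)
  have u: "c (1, 0) = \<sigma>" "c (-1, 0) = \<sigma>" "c (0, 1) = \<sigma>" "c (0, -1) = \<sigma>"
    using units[of 1] units[of "-1"] sym[of 0 1] sym[of 0 "-1"] by auto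
  define Q where "Q = c (1, 1) + c (1, -1) + c (-1, 1) + c (-1, -1)"
  have box: "(\<Sum>p\<in>unit_box. c p * T p) = 4 * \<sigma> * G - 2 * Q * (q\<^sup>2 - x * y)"
    by (simp add: unit_box_eq T_def gauss_weight_def u G_def Q_def power2_eq_square algebra_simps)
  have s1: "\<bar>\<sigma>\<bar> = 1" using \<sigma> by (metis power2_eq_square power2_eq_1_iff abs_1 abs_minus_cancel)
  have "\<bar>Q\<bar> \<le> 4" using c[of "(1,1)"] c[of "(1,-1)"] c[of "(-1,1)"] c[of "(-1,-1)"] unfolding Q_def by linarith
  then have "\<bar>\<sigma> * (2 * Q * (q\<^sup>2 - x * y))\<bar> \<le> 2 * 4 * (2 * q * G)"
  proof -
    assume Q: "\<bar>Q\<bar> \<le> 4"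
    have "\<bar>\<sigma> * (2 * Q * (q\<^sup>2 - x * y))\<bar> = (2 * \<bar>Q\<bar>) * (q\<^sup>2 - x * y)"
      using prod_le by (simp add: abs_mult s1)
    also have "\<dots> \<le> (2 * 4) * (2 * q * G)"
      using Q defect_le_G prod_le by (intro mult_mono) auto
    finally show ?thesis .
  qed
  also have "\<dots> \<le> 2 * 4 * (2 * (1/20) * G)"
    using q_le G_nonneg by (intro mult_left_mono mult_right_mono) auto
  finally have corner: "\<bar>\<sigma> * (2 * Q * (q\<^sup>2 - x * y))\<bar> \<le> 8/10 * G" by simp
  have "\<bar>\<sigma> * infsum (\<lambda>p. c p * T p) (- unit_box)\<bar> \<le> (216/100) * G"
    using out by (simp add: abs_mult s1)
  moreover have "\<sigma> * (\<Sum>\<^sub>\<infinity>p. c p * T p) = (\<sigma> * \<sigma>) * (4 * G) - \<sigma> * (2 * Q * (q\<^sup>2 - x * y))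
      + \<sigma> * infsum (\<lambda>p. c p * T p) (- unit_box)"
    unfolding split box by (simp add: algebra_simps)
  \<comment> \<open>Balance: 4 from the units, at most 16q <= 0.8 from the corners, at most 4 * 0.54
    = 2.16 from the tail. The remaining margin is 1.04 G.\<close>
  ultimately have "\<sigma> * (\<Sum>\<^sub>\<infinity>p. c p * T p) \<ge> 4 * G - 8/10 * G - 216/100 * G"
    unfolding \<sigma> using corner by linarith
  then have "0 \<le> \<sigma> * (\<Sum>\<^sub>\<infinity>p. c p * T p)" using G_nonneg by linarith
  then show ?thesis unfolding tot by (simp add: algebra_simps)
qed

end

section \<open>Dependence on the phases for the square lattice\<close>

lemma abs_sin_nat_mult_le: "\<bar>sin (real n * z)\<bar> \<le> real n * \<bar>sin z\<bar>"
proof (induction n)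
  case (Suc n)
  have "\<bar>sin (real (Suc n) * z)\<bar> = \<bar>sin (real n * z) * cos z + cos (real n * z) * sin z\<bar>"
    by (simp add: distrib_right sin_add add.commute mult.commute[of "cos _"])
  also have "\<dots> \<le> \<bar>sin (real n * z)\<bar> * \<bar>cos z\<bar> + \<bar>cos (real n * z)\<bar> * \<bar>sin z\<bar>"
    by (rule order_trans[OF abs_triangle_ineq]) (simp add: abs_mult)
  also have "\<dots> \<le> \<bar>sin (real n * z)\<bar> * 1 + 1 * \<bar>sin z\<bar>"
    by (intro add_mono mult_left_mono mult_right_mono) auto
  finally show ?case using Suc by (simp add: distrib_right)
qed simp

text \<open>Since 1 - cos w = 2 sin(w/2)^2, this is the square of |sin(kz)| <= |k| |sin z|. It
  measures the loss of a high harmonic by that of the first one.\<close>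

lemma one_minus_cos_int_mult_le: "1 - cos (real_of_int k * A) \<le> (real_of_int k)\<^sup>2 * (1 - cos A)"
proof -
  have half: "1 - cos w = 2 * (sin (w / 2))\<^sup>2" for w :: real
    using cos_double_sin[of "w / 2"] by simp
  have "\<bar>sin (real_of_int k * (A / 2))\<bar> \<le> \<bar>real_of_int k\<bar> * \<bar>sin (A / 2)\<bar>"
    using abs_sin_nat_mult_le[of "nat \<bar>k\<bar>" "A / 2"] by (cases "0 \<le> k") auto
  then have "(sin (real_of_int k * (A / 2)))\<^sup>2 \<le> (real_of_int k)\<^sup>2 * (sin (A / 2))\<^sup>2"
    by (metis abs_mult abs_le_square_iff power_mult_distrib)
  then show ?thesis unfolding half by simp
qed

text \<open>1 - ab = (1 - a) + (1 - b) - (1 - a)(1 - b), and the last product is nonnegative for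
  cosines.\<close>

lemma one_minus_cos_cos_le:
  "1 - cos (real_of_int k * A) * cos (real_of_int l * B)
     \<le> (real_of_int k)\<^sup>2 * (1 - cos A) + (real_of_int l)\<^sup>2 * (1 - cos B)"
proof -
  have "0 \<le> (1 - cos (real_of_int k * A)) * (1 - cos (real_of_int l * B))" by simp
  then show ?thesis using one_minus_cos_int_mult_le[of k A] one_minus_cos_int_mult_le[of l B]
    by (simp add: algebra_simps)
qed

text \<open>Equivalent to 2(M + 1) <= 2^M, which starts with equality at M = 3.\<close>

lemma mult_quarter_power_le:
  assumes "3 \<le> M"
  shows "real (Suc M) * (1/4) ^ M \<le> (1/2) ^ Suc M"
proof -
  have "2 * real (Suc M) \<le> 2 ^ M" using assms
  proof (induction M rule: nat_induct_at_least)
    case (Suc M)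
    then show ?case by simp
  qed simp
  then have "2 * real (Suc M) * (1/4) ^ M \<le> 2 ^ M * (1/4) ^ M" by (intro mult_right_mono) auto
  also have "\<dots> = (1/2) ^ M" by (simp flip: power_mult_distrib)
  finally show ?thesis by (simp add: algebra_simps)
qed

text \<open>The cosines lower the unit terms by 2qS in total, where S = (1 - cos A) + (1 - cos B).
  By \<open>one_minus_cos_cos_le\<close> the loss at any other index is at most (k^2 + l^2) S
  q^(k^2+l^2), so that all of them can be compared with the same qS.\<close>

lemma signed_sum_cos_compare:
  fixes c :: "int \<times> int \<Rightarrow> real" and q A B :: real
  assumes q: "0 < q" "q \<le> 1/4" and c: "\<And>p. \<bar>c p\<bar> \<le> 1"
    and units: "c (1,0) = \<sigma>" "c (-1,0) = \<sigma>" "c (0,1) = \<sigma>" "c (0,-1) = \<sigma>" and \<sigma>: "\<sigma> * \<sigma> = 1"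
  shows "\<sigma> * (\<Sum>\<^sub>\<infinity>(k, l). c (k, l) * cos (real_of_int k * A) * cos (real_of_int l * B) * gauss_weight q q (k, l))
     \<le> \<sigma> * (\<Sum>\<^sub>\<infinity>p. c p * gauss_weight q q p)"
proof -
  define d where "d = (\<lambda>(k, l). c (k, l) * cos (real_of_int k * A) * cos (real_of_int l * B))"
  define S where "S = (1 - cos A) + (1 - cos B)"
  have S0: "0 \<le> S" unfolding S_def by (intro add_nonneg_nonneg) auto
  have dc: "\<bar>d p\<bar> \<le> 1" for p
    using c[of p] by (cases p) (auto simp: d_def abs_mult intro!: mult_le_one)
  have s1: "\<bar>\<sigma>\<bar> = 1" using \<sigma> by (metis power2_eq_square power2_eq_1_iff abs_1 abs_minus_cancel)
  have s: "(\<lambda>p. c p * gauss_weight q q p) summable_on X" "(\<lambda>p. d p * gauss_weight q q p) summable_on X" for X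
    by (rule summable_gauss_weight_mult[where C = 1], (use q c dc in auto)[5])+
  define e where "e p = (c p - d p) * gauss_weight q q p" for p
  have e: "e = (\<lambda>p. c p * gauss_weight q q p - d p * gauss_weight q q p)"
    by (auto simp: e_def algebra_simps)
  have se: "e summable_on X" for X unfolding e by (intro summable_on_diff s)
  have tot: "infsum e UNIV = (\<Sum>\<^sub>\<infinity>p. c p * gauss_weight q q p) - (\<Sum>\<^sub>\<infinity>p. d p * gauss_weight q q p)"
    unfolding e by (intro infsum_diff s)
  have cd: "\<bar>c (k,l) - d (k,l)\<bar> \<le> (real_of_int k)\<^sup>2 * (1 - cos A) + (real_of_int l)\<^sup>2 * (1 - cos B)" for k l
  proof -
    have "c (k,l) - d (k,l) = c (k,l) * (1 - cos (real_of_int k * A) * cos (real_of_int l * B))"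
      by (simp add: d_def algebra_simps)
    moreover have "\<bar>cos (real_of_int k * A) * cos (real_of_int l * B)\<bar> \<le> 1"
      unfolding abs_mult by (intro mult_le_one) auto
    then have "0 \<le> 1 - cos (real_of_int k * A) * cos (real_of_int l * B)" by linarith
    ultimately have "\<bar>c (k,l) - d (k,l)\<bar> \<le> 1 - cos (real_of_int k * A) * cos (real_of_int l * B)"
      using c[of "(k,l)"] by (simp add: abs_mult mult_left_le_one_le)
    then show ?thesis using one_minus_cos_cos_le[of k A l B] by linarith
  qed
  have out: "\<bar>infsum e (- unit_box)\<bar> \<le> (q * S) * (54/100)"
  proof (rule infsum_outside_le)
    fix p :: "int \<times> int" assume "p \<notin> unit_box"
    then obtain k l where p: "p = (k, l)" and kl: "(k, l) \<notin> unit_box" by (cases p) auto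
    define a where "a = nat (k\<^sup>2)"
    define b where "b = nat (l\<^sup>2)"
    have ab: "(real_of_int k)\<^sup>2 = real a" "(real_of_int l)\<^sup>2 = real b" by (auto simp: a_def b_def)
    define M where "M = a + b - 1"
    have M: "a + b = Suc M" "3 \<le> M"
      using outside_unit_box_squares(1)[OF kl] unfolding M_def a_def b_def by linarith+
    have "\<bar>c p - d p\<bar> \<le> real a * (1 - cos A) + real b * (1 - cos B)" using cd[of k l] by (simp add: p ab)
    also have "\<dots> \<le> real (a + b) * (1 - cos A) + real (a + b) * (1 - cos B)"
      by (intro add_mono mult_right_mono) auto
    also have "\<dots> = real (a + b) * S" by (simp add: S_def algebra_simps)
    finally have "\<bar>e p\<bar> \<le> real (a + b) * S * q ^ (a + b)"
      using q by (auto simp: e_def p gauss_weight_def abs_mult a_def b_def power_add intro!: mult_right_mono)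
    also have "\<dots> = real (Suc M) * q ^ M * (q * S)" by (simp add: M mult_ac)
    also have "\<dots> \<le> (1/2) ^ Suc M * (q * S)"
    proof (intro mult_right_mono)
      have "real (Suc M) * q ^ M \<le> real (Suc M) * (1/4) ^ M"
        using q by (intro mult_left_mono power_mono) auto
      also have "\<dots> \<le> (1/2) ^ Suc M" using M(2) by (rule mult_quarter_power_le)
      finally show "real (Suc M) * q ^ M \<le> (1/2) ^ Suc M" .
    qed (use q S0 in auto)
    also have "(1/2::real) ^ Suc M = gauss_weight (1/2) (1/2) p"
      unfolding M(1)[symmetric] by (simp add: p gauss_weight_def power_add a_def b_def)
    finally show "\<bar>e p\<bar> \<le> q * S * gauss_weight (1/2) (1/2) p" by (simp add: mult_ac)
  qed (use q S0 in auto)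
  have cor: "\<bar>e (i, j)\<bar> \<le> q * S * (1/4)" if "\<bar>i\<bar> = 1" "\<bar>j\<bar> = 1" for i j
  proof -
    have ij: "i\<^sup>2 = 1" "j\<^sup>2 = 1" using that by (metis power2_abs power_one)+
    then have "(real_of_int i)\<^sup>2 = 1" "(real_of_int j)\<^sup>2 = 1" by (metis of_int_1 of_int_power)+
    then have "\<bar>c (i,j) - d (i,j)\<bar> \<le> S" using cd[of i j] by (simp add: S_def)
    then have "\<bar>e (i, j)\<bar> \<le> S * (q * q)"
      using q ij by (auto simp: e_def gauss_weight_def abs_mult intro!: mult_right_mono)
    also have "\<dots> \<le> S * (q * (1/4))" using q S0 by (intro mult_left_mono) auto
    finally show ?thesis by (simp add: mult_ac)
  qed
  have box: "sum e unit_box = 2 * \<sigma> * q * S + (e (1,1) + e (1,-1) + e (-1,1) + e (-1,-1))"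
    by (simp add: unit_box_eq S_def e_def d_def gauss_weight_def units algebra_simps)
  have "infsum e UNIV = 2 * \<sigma> * q * S + (e (1,1) + e (1,-1) + e (-1,1) + e (-1,-1)) + infsum e (- unit_box)"
    using infsum_split_unit_box[OF se] box by simp
  then have "\<sigma> * infsum e UNIV = (\<sigma> * \<sigma>) * (2 * (q * S)) + \<sigma> * (e (1,1) + e (1,-1) + e (-1,1) + e (-1,-1) + infsum e (- unit_box))"
    by (simp add: algebra_simps)
  \<comment> \<open>The four corners contribute at most 4 * qS/4 and the tail 0.54 qS, together less
    than the 2qS of the units.\<close>
  moreover have "\<bar>\<sigma> * (e (1,1) + e (1,-1) + e (-1,1) + e (-1,-1) + infsum e (- unit_box))\<bar> \<le> 2 * (q * S)"
  proof -
    have "0 \<le> q * S" using q S0 by simp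
    then show ?thesis
      using out cor[of 1 1] cor[of 1 "-1"] cor[of "-1" 1] cor[of "-1" "-1"]
      unfolding abs_mult s1 by simp
  qed
  ultimately have "0 \<le> \<sigma> * infsum e UNIV" unfolding \<sigma> by linarith
  then have "\<sigma> * (\<Sum>\<^sub>\<infinity>p. d p * gauss_weight q q p) \<le> \<sigma> * (\<Sum>\<^sub>\<infinity>p. c p * gauss_weight q q p)"
    unfolding tot by (simp add: algebra_simps)
  then show ?thesis by (simp add: d_def case_prod_unfold)
qed

section \<open>Parseval for continuous periodic functions\<close>

lemma cis_2pi_eq_cases:
  assumes "t \<in> {0..1}" "u \<in> {0..1}" "cis (2 * pi * t) = cis (2 * pi * u)"
  shows "t = u \<or> (t = 0 \<and> u = 1) \<or> (t = 1 \<and> u = 0)"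
proof -
  have "sin (2 * pi * t) = sin (2 * pi * u) \<and> cos (2 * pi * t) = cos (2 * pi * u)"
    using assms(3) by (simp add: complex_eq_iff)
  then obtain n :: int where n: "2 * pi * t = 2 * pi * u + 2 * pi * real_of_int n"
    using sin_cos_eq_iff[of "2 * pi * t" "2 * pi * u"] by auto
  then have "2 * pi * t = 2 * pi * (u + real_of_int n)" by (simp add: algebra_simps)
  then have tu: "t = u + real_of_int n" by simp
  then have "real_of_int (-1) \<le> real_of_int n" "real_of_int n \<le> real_of_int 1" using assms(1,2) by auto
  then have "-1 \<le> n" "n \<le> 1" unfolding of_int_le_iff by auto
  then consider "n = -1" | "n = 0" | "n = 1" by linarith
  then show ?thesis using tu assms(1,2) by cases (simp; linarith)+
qed

lemma cis_2pi_image: "(\<lambda>t. cis (2 * pi * t)) ` {0..1} = sphere 0 1"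
proof
  show "(\<lambda>t. cis (2 * pi * t)) ` {0..1} \<subseteq> sphere 0 1" by (simp add: image_subset_iff)
  show "sphere 0 1 \<subseteq> (\<lambda>t. cis (2 * pi * t)) ` {0..1}"
  proof
    fix z :: complex assume "z \<in> sphere 0 1"
    then have "(Re z)\<^sup>2 + (Im z)\<^sup>2 = 1" using cmod_power2[of z] by simp
    then obtain a where a: "0 \<le> a" "a < 2 * pi" "Re z = cos a" "Im z = sin a"
      by (rule sincos_total_2pi)
    have "z = cis (2 * pi * (a / (2 * pi)))" using a by (simp add: complex_eq_iff)
    moreover have "a / (2 * pi) \<in> {0..1}" using a by simp
    ultimately show "z \<in> (\<lambda>t. cis (2 * pi * t)) ` {0..1}" by (rule image_eqI)
  qed
qed

text \<open>The parametrisation of the circle by [0, 1] is a closed map: the preimage of a closed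
  set under H is the image of a compact subset of [0, 1]. The choice of a parameter is ambiguous
  only at the point 1, where h 0 = h 1 resolves it.\<close>

lemma lift_to_circle:
  fixes h :: "real \<Rightarrow> complex"
  assumes h: "continuous_on {0..1} h" "h 0 = h 1"
  obtains H where "continuous_on (sphere 0 1) H" "\<And>t. t \<in> {0..1} \<Longrightarrow> H (cis (2 * pi * t)) = h t"
proof -
  define H where "H z = h (SOME t. t \<in> {0..1} \<and> cis (2 * pi * t) = z)" for z
  have H: "H (cis (2 * pi * t)) = h t" if t: "t \<in> {0..1}" for t
  proof -
    let ?u = "SOME u. u \<in> {0..1} \<and> cis (2 * pi * u) = cis (2 * pi * t)"
    have "?u \<in> {0..1} \<and> cis (2 * pi * ?u) = cis (2 * pi * t)"
      by (rule someI[of _ t]) (use t in simp)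
    then have "?u = t \<or> (?u = 0 \<and> t = 1) \<or> (?u = 1 \<and> t = 0)"
      using t by (intro cis_2pi_eq_cases) auto
    then have "h ?u = h t" using h(2) by auto
    then show ?thesis by (simp only: H_def)
  qed
  have "closed (H -` B \<inter> sphere 0 1)" if B: "closed B" for B
  proof -
    have "H -` B \<inter> sphere 0 1 = (\<lambda>t. cis (2 * pi * t)) ` ({0..1} \<inter> h -` B)"
    proof (intro set_eqI iffI)
      fix z assume z: "z \<in> H -` B \<inter> sphere 0 1"
      then have "z \<in> (\<lambda>t. cis (2 * pi * t)) ` {0..1}" by (simp only: cis_2pi_image Int_iff)
      then obtain t where t: "t \<in> {0..1}" "z = cis (2 * pi * t)" by (rule imageE)
      then have "h t \<in> B" using z H[OF t(1)] by (simp only: vimage_eq Int_iff)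
      then show "z \<in> (\<lambda>t. cis (2 * pi * t)) ` ({0..1} \<inter> h -` B)" using t by blast
    next
      fix z assume "z \<in> (\<lambda>t. cis (2 * pi * t)) ` ({0..1} \<inter> h -` B)"
      then obtain t where t: "t \<in> {0..1}" "h t \<in> B" "z = cis (2 * pi * t)" by blast
      then show "z \<in> H -` B \<inter> sphere 0 1" using H[OF t(1)] by simp
    qed
    moreover have "compact ({0..1} \<inter> h -` B)"
      using continuous_closed_preimage[OF h(1) _ B] bounded_subset[OF bounded_closed_interval, of "{0..1} \<inter> h -` B" 0 1]
      by (auto simp: compact_eq_bounded_closed)
    then have "compact ((\<lambda>t. cis (2 * pi * t)) ` ({0..1} \<inter> h -` B))"
      by (intro compact_continuous_image continuous_intros)
    ultimately show ?thesis by (simp add: compact_imp_closed)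
  qed
  then have "continuous_on (sphere 0 1) H" by (subst continuous_on_closed_vimage) auto
  then show ?thesis using that H by blast
qed

section \<open>Characters and trigonometric polynomials\<close>

definition fchar :: "int \<Rightarrow> real \<Rightarrow> complex" where
  "fchar l t = cis (2 * pi * of_int l * t)"

lemma fchar_0: "fchar 0 = (\<lambda>t. 1)"
  and fchar_add: "fchar (k + l) t = fchar k t * fchar l t"
  and fchar_cnj: "cnj (fchar l t) = fchar (- l) t"
  and fchar_norm: "cmod (fchar l t) = 1"
  by (simp_all add: fchar_def fun_eq_iff cis_mult ring_distribs cis_cnj)

lemma continuous_on_fchar [continuous_intros]: "continuous_on A (fchar l)"
  unfolding fchar_def by (intro continuous_intros)

lemma fchar_add_int: "fchar l (t + of_int m) = fchar l t"
proof -
  have "cis (2 * pi * of_int l * (t + of_int m)) = cis (2 * pi * of_int l * t) * cis (2 * pi * of_int (l * m))"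
    by (simp add: cis_mult algebra_simps)
  also have "cis (2 * pi * of_int (l * m)) = 1" by (rule cis_multiple_2pi) simp
  finally show ?thesis by (simp add: fchar_def)
qed

lemma integral_fchar: "integral {0..1} (fchar l) = (if l = 0 then 1 else 0)"
proof (cases "l = 0")
  case False
  define w where "w = 2 * complex_of_real pi * \<i> * of_int l"
  have w: "w \<noteq> 0" using False by (simp add: w_def)
  have f: "fchar l t = exp (w * of_real t)" for t
    by (simp add: fchar_def cis_conv_exp w_def mult_ac)
  have "((\<lambda>t. exp (w * of_real t)) has_integral (exp (w * of_real 1) / w - exp (w * of_real 0) / w)) {0..1}"
  proof (rule fundamental_theorem_of_calculus)
    fix x :: real
    have "((\<lambda>z. exp (w * z) / w) has_field_derivative exp (w * of_real x)) (at (of_real x))"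
      using w by (auto intro!: derivative_eq_intros)
    then have "((\<lambda>x. exp (w * of_real x) / w) has_vector_derivative exp (w * of_real x)) (at x within {0..1})"
      by (intro has_vector_derivative_real_field)
    then show "((\<lambda>x. exp (w * of_real x) / w) has_vector_derivative exp (w * of_real x)) (at x within {0..1})" .
  qed simp
  moreover have "exp (w * of_real 1) = 1"
    using fchar_add_int[of l 0 1] f[of 1] f[of 0] by simp
  moreover have "fchar l = (\<lambda>t. exp (w * of_real t))" using f by auto
  ultimately show ?thesis using False by (simp add: integral_unique)
qed (simp add: fchar_0)

inductive trig_poly :: "(real \<Rightarrow> complex) \<Rightarrow> bool" where
  fchar: "trig_poly (\<lambda>t. c * fchar l t)"
| add: "trig_poly p \<Longrightarrow> trig_poly r \<Longrightarrow> trig_poly (\<lambda>t. p t + r t)"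

lemma trig_poly_const: "trig_poly (\<lambda>t. c)"
  using trig_poly.fchar[of c 0] by (simp add: fchar_0)

lemma trig_poly_fchar_mult: "trig_poly p \<Longrightarrow> trig_poly (\<lambda>t. c * fchar l t * p t)"
proof (induction rule: trig_poly.induct)
  case (fchar d m)
  have "(\<lambda>t. c * fchar l t * (d * fchar m t)) = (\<lambda>t. (c * d) * fchar (l + m) t)"
    by (simp add: fchar_add mult_ac)
  then show ?case by (simp add: trig_poly.fchar)
next
  case (add p r)
  then show ?case using trig_poly.add[OF add.IH] by (simp add: distrib_left)
qed

lemma trig_poly_mult: "trig_poly p \<Longrightarrow> trig_poly r \<Longrightarrow> trig_poly (\<lambda>t. p t * r t)"
proof (induction rule: trig_poly.induct)
  case (add p1 p2)
  then show ?case using trig_poly.add[OF add.IH] by (simp add: distrib_right)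
qed (rule trig_poly_fchar_mult)

lemma trig_poly_sum_form:
  "trig_poly p \<Longrightarrow> \<exists>A a. finite A \<and> p = (\<lambda>t. \<Sum>l\<in>A. a l * fchar l t)"
proof (induction rule: trig_poly.induct)
  case (fchar c l)
  show ?case by (rule exI[of _ "{l}"], rule exI[of _ "\<lambda>_. c"]) simp
next
  case (add p r)
  then obtain A a B b where A: "finite A" "p = (\<lambda>t. \<Sum>l\<in>A. a l * fchar l t)"
    and B: "finite B" "r = (\<lambda>t. \<Sum>l\<in>B. b l * fchar l t)" by blast
  define d where "d l = (if l \<in> A then a l else 0) + (if l \<in> B then b l else 0)" for l
  have "p t = (\<Sum>l\<in>A \<union> B. (if l \<in> A then a l else 0) * fchar l t)" for t
    unfolding A(2) by (rule sum.mono_neutral_cong_left) (use A B in auto)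
  moreover have "r t = (\<Sum>l\<in>A \<union> B. (if l \<in> B then b l else 0) * fchar l t)" for t
    unfolding B(2) by (rule sum.mono_neutral_cong_left) (use A B in auto)
  ultimately have "(\<lambda>t. p t + r t) = (\<lambda>t. \<Sum>l\<in>A \<union> B. d l * fchar l t)"
    by (simp add: d_def distrib_right sum.distrib)
  then show ?case using A B by (intro exI[of _ "A \<union> B"] exI[of _ d]) simp
qed

lemma trig_poly_real_polynomial:
  fixes r :: "complex \<Rightarrow> real"
  assumes "real_polynomial_function r"
  shows "trig_poly (\<lambda>t. complex_of_real (r (cis (2 * pi * t))))"
  using assms
proof (induction rule: real_polynomial_function.induct)
  case (linear f)
  then interpret bounded_linear f .
  have f: "f z = Re z * f 1 + Im z * f \<i>" for z
  proof -
    have "f z = f (Re z *\<^sub>R 1 + Im z *\<^sub>R \<i>)" by (rule arg_cong[where f = f]) (simp add: complex_eq_iff)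
    then show ?thesis by (simp only: add scaleR real_scaleR_def)
  qed
  \<comment> \<open>For z = cis(2 pi t), Re z and Im z are (fchar 1 + fchar (-1))/2 and (fchar 1 -
    fchar (-1))/(2i); collecting the coefficients of the two characters gives c and d.\<close>
  define c where "c = complex_of_real (f 1) / 2 - \<i> * complex_of_real (f \<i>) / 2"
  define d where "d = complex_of_real (f 1) / 2 + \<i> * complex_of_real (f \<i>) / 2"
  have "complex_of_real (f (cis (2 * pi * t))) = c * fchar 1 t + d * fchar (-1) t" for t
    by (subst f) (simp add: fchar_def c_def d_def complex_eq_iff)
  then show ?case by (simp add: trig_poly.intros)
qed (simp_all add: trig_poly_const trig_poly.add trig_poly_mult)

lemma trig_poly_dense:
  fixes h :: "real \<Rightarrow> complex"
  assumes h: "continuous_on {0..1} h" "h 0 = h 1" and e: "0 < e"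
  obtains p where "trig_poly p" "\<And>t. t \<in> {0..1} \<Longrightarrow> cmod (h t - p t) < e"
proof -
  obtain H where H: "continuous_on (sphere 0 1) H" "\<And>t. t \<in> {0..1} \<Longrightarrow> H (cis (2 * pi * t)) = h t"
    using lift_to_circle[OF h] by blast
  obtain g where g: "polynomial_function g" "\<And>z. z \<in> sphere 0 1 \<Longrightarrow> norm (H z - g z) < e"
    using Stone_Weierstrass_polynomial_function[OF compact_sphere H(1) e] by blast
  define p where "p t = complex_of_real (Re (g (cis (2 * pi * t)))) + \<i> * complex_of_real (Im (g (cis (2 * pi * t))))" for t
  have "real_polynomial_function (Re \<circ> g)" "real_polynomial_function (Im \<circ> g)"
    using g(1) bounded_linear_Re bounded_linear_Im by (auto simp: polynomial_function_def)
  then have "trig_poly p" unfolding p_def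
    using trig_poly_real_polynomial[of "Re \<circ> g"] trig_poly_real_polynomial[of "Im \<circ> g"]
      trig_poly_mult[OF trig_poly_const] by (intro trig_poly.add) auto
  moreover have "cmod (h t - p t) < e" if "t \<in> {0..1}" for t
    using g(2)[of "cis (2 * pi * t)"] H(2)[OF that] by (simp add: p_def flip: complex_eq)
  ultimately show ?thesis using that by blast
qed

definition fcoeff :: "(real \<Rightarrow> complex) \<Rightarrow> int \<Rightarrow> complex" where
  "fcoeff h l = integral {0..1} (\<lambda>t. h t * fchar (- l) t)"

text \<open>Completion of the square in the coefficients. With a = fcoeff h the last sum vanishes
  and Bessel's inequality results; with a uniformly close trigonometric polynomial the same identity
  yields the reverse estimate.\<close>

lemma integral_norm_diff_trig:
  fixes h :: "real \<Rightarrow> complex"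
  assumes h: "continuous_on {0..1} h" and A: "finite A"
  shows "integral {0..1} (\<lambda>t. (cmod (h t - (\<Sum>l\<in>A. a l * fchar l t)))\<^sup>2)
     = integral {0..1} (\<lambda>t. (cmod (h t))\<^sup>2) - (\<Sum>l\<in>A. (cmod (fcoeff h l))\<^sup>2) + (\<Sum>l\<in>A. (cmod (fcoeff h l - a l))\<^sup>2)"
proof -
  define p where "p t = (\<Sum>l\<in>A. a l * fchar l t)" for t
  define J where "J f = integral {0..1::real} f" for f :: "real \<Rightarrow> complex"
  note cont = continuous_on_mult continuous_on_cnj continuous_on_fchar h continuous_on_const continuous_on_sum continuous_on_diff continuous_on_add
  have cp: "continuous_on {0..1} p" unfolding p_def by (intro cont)
  have cJ: "f integrable_on {0..1}" if "continuous_on {0..1} f" for f :: "real \<Rightarrow> complex"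
    using that by (rule integrable_continuous_real)
  have sq: "complex_of_real (integral {0..1} (\<lambda>t. (cmod (f t))\<^sup>2)) = J (\<lambda>t. f t * cnj (f t))"
    if "continuous_on {0..1} f" for f
  proof -
    have "(\<lambda>t. (cmod (f t))\<^sup>2) integrable_on {0..1}"
      by (intro integrable_continuous_real continuous_intros that)
    then have "((\<lambda>t. (cmod (f t))\<^sup>2) has_integral integral {0..1} (\<lambda>t. (cmod (f t))\<^sup>2)) {0..1}"
      by (rule integrable_integral)
    then have "((\<lambda>t. complex_of_real ((cmod (f t))\<^sup>2)) has_integral complex_of_real (integral {0..1} (\<lambda>t. (cmod (f t))\<^sup>2))) {0..1}"
      by (rule has_integral_of_real)
    then show ?thesis unfolding J_def complex_norm_square by (simp add: integral_unique)
  qed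
  have hp: "J (\<lambda>t. f t * cnj (p t)) = (\<Sum>l\<in>A. cnj (a l) * fcoeff f l)" if f: "continuous_on {0..1} f" for f
  proof -
    have "(\<lambda>t. f t * cnj (p t)) = (\<lambda>t. \<Sum>l\<in>A. cnj (a l) * (f t * fchar (- l) t))"
      by (simp add: p_def sum_distrib_left fchar_cnj mult_ac)
    then have "J (\<lambda>t. f t * cnj (p t)) = (\<Sum>l\<in>A. J (\<lambda>t. cnj (a l) * (f t * fchar (- l) t)))"
      unfolding J_def using A by (simp only:) (intro integral_sum cJ cont f, auto)
    then show ?thesis by (simp add: J_def fcoeff_def)
  qed
  have coeffp: "fcoeff p l = a l" if l: "l \<in> A" for l
  proof -
    have "(\<lambda>t. p t * fchar (- l) t) = (\<lambda>t. \<Sum>m\<in>A. a m * fchar (m - l) t)"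
      by (simp add: p_def sum_distrib_right mult.assoc flip: fchar_add)
    then have "fcoeff p l = (\<Sum>m\<in>A. integral {0..1} (\<lambda>t. a m * fchar (m - l) t))"
      unfolding fcoeff_def using A by (simp only:) (intro integral_sum cJ cont, auto)
    also have "\<dots> = (\<Sum>m\<in>A. if m = l then a m else 0)"
      by (rule sum.cong) (auto simp: integral_fchar)
    finally show ?thesis using A l by simp
  qed
  have conj: "J (\<lambda>t. cnj (f t)) = cnj (J f)" for f
    unfolding J_def by (rule integral_cnj[symmetric])
  have ph: "J (\<lambda>t. p t * cnj (h t)) = (\<Sum>l\<in>A. a l * cnj (fcoeff h l))"
    using conj[of "\<lambda>t. h t * cnj (p t)"] hp[OF h] by (simp add: mult.commute)
  have "complex_of_real (integral {0..1} (\<lambda>t. (cmod (h t - p t))\<^sup>2))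
      = J (\<lambda>t. (h t - p t) * cnj (h t - p t))"
    by (rule sq) (intro cont cp)
  also have "(\<lambda>t. (h t - p t) * cnj (h t - p t))
      = (\<lambda>t. (h t * cnj (h t) - h t * cnj (p t)) - (p t * cnj (h t) - p t * cnj (p t)))"
    by (simp add: algebra_simps)
  also have "J \<dots> = (J (\<lambda>t. h t * cnj (h t)) - J (\<lambda>t. h t * cnj (p t))) - (J (\<lambda>t. p t * cnj (h t)) - J (\<lambda>t. p t * cnj (p t)))"
  proof -
    have d: "J (\<lambda>t. f t - g t) = J f - J g" if "continuous_on {0..1} f" "continuous_on {0..1} g" for f g
      unfolding J_def by (rule integral_diff[OF cJ cJ]) (fact that)+
    have c: "continuous_on {0..1} (\<lambda>t. h t * cnj (h t))" "continuous_on {0..1} (\<lambda>t. h t * cnj (p t))"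
      "continuous_on {0..1} (\<lambda>t. p t * cnj (h t))" "continuous_on {0..1} (\<lambda>t. p t * cnj (p t))"
      by (intro continuous_intros h cp)+
    show ?thesis
      by (subst d[OF continuous_on_diff[OF c(1,2)] continuous_on_diff[OF c(3,4)]], subst d[OF c(1,2)], subst d[OF c(3,4)]) simp
  qed
  also have "\<dots> = complex_of_real (integral {0..1} (\<lambda>t. (cmod (h t))\<^sup>2)) - (\<Sum>l\<in>A. cnj (a l) * fcoeff h l)
      - (\<Sum>l\<in>A. a l * cnj (fcoeff h l)) + (\<Sum>l\<in>A. cnj (a l) * a l)"
    using coeffp by (simp add: sq[OF h] hp[OF h] hp[OF cp] ph)
  also have "\<dots> = complex_of_real (integral {0..1} (\<lambda>t. (cmod (h t))\<^sup>2)
      - (\<Sum>l\<in>A. (cmod (fcoeff h l))\<^sup>2) + (\<Sum>l\<in>A. (cmod (fcoeff h l - a l))\<^sup>2))"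
  proof -
    have "complex_of_real ((cmod c)\<^sup>2 - (cmod (c - b))\<^sup>2) = cnj b * c + b * cnj c - cnj b * b" for b c :: complex
      unfolding of_real_diff complex_norm_square by (simp add: algebra_simps)
    then have "complex_of_real ((\<Sum>l\<in>A. (cmod (fcoeff h l))\<^sup>2) - (\<Sum>l\<in>A. (cmod (fcoeff h l - a l))\<^sup>2))
        = (\<Sum>l\<in>A. cnj (a l) * fcoeff h l) + (\<Sum>l\<in>A. a l * cnj (fcoeff h l)) - (\<Sum>l\<in>A. cnj (a l) * a l)"
      unfolding sum_subtractf[symmetric] sum.distrib[symmetric] of_real_sum by simp
    then show ?thesis unfolding of_real_diff of_real_add by (simp add: algebra_simps)
  qed
  finally show ?thesis unfolding p_def of_real_eq_iff .
qed

text \<open>Bessel bounds every finite sum by the integral, and a trigonometric polynomial within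
  sqrt e of h shows that some finite sum misses it by at most e. The condition h 0 = h 1 enters
  through the uniform density.\<close>

theorem Parseval_periodic:
  fixes h :: "real \<Rightarrow> complex"
  assumes h: "continuous_on {0..1} h" "h 0 = h 1"
  shows "((\<lambda>l. (cmod (fcoeff h l))\<^sup>2) has_sum integral {0..1} (\<lambda>t. (cmod (h t))\<^sup>2)) UNIV"
proof -
  let ?c = "\<lambda>l. (cmod (fcoeff h l))\<^sup>2" and ?I = "integral {0..1} (\<lambda>t. (cmod (h t))\<^sup>2)"
  have bessel: "sum ?c A \<le> ?I" if "finite A" for A
  proof -
    have "0 \<le> integral {0..1} (\<lambda>t. (cmod (h t - (\<Sum>l\<in>A. fcoeff h l * fchar l t)))\<^sup>2)"
      by (rule Henstock_Kurzweil_Integration.integral_nonneg) (intro integrable_continuous_real continuous_intros h, simp)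
    then show ?thesis using integral_norm_diff_trig[OF h(1) that, of "fcoeff h"] by simp
  qed
  have bdd: "bdd_above (sum ?c ` {A. finite A})" using bessel by (auto intro!: bdd_aboveI2)
  have near: "\<exists>A. finite A \<and> ?I - e \<le> sum ?c A" if e: "0 < e" for e
  proof -
    obtain p where p: "trig_poly p" "\<And>t. t \<in> {0..1} \<Longrightarrow> cmod (h t - p t) < sqrt e"
      using trig_poly_dense[OF h] e by (metis real_sqrt_gt_zero)
    obtain A a where A: "finite A" "p = (\<lambda>t. \<Sum>l\<in>A. a l * fchar l t)"
      using trig_poly_sum_form[OF p(1)] by blast
    have "integral {0..1} (\<lambda>t. (cmod (h t - p t))\<^sup>2) \<le> integral {0..1} (\<lambda>t::real. e)"
    proof (rule integral_le)
      show "(\<lambda>t. (cmod (h t - p t))\<^sup>2) integrable_on {0..1}"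
        unfolding A(2) by (intro integrable_continuous_real continuous_intros h)
      fix t :: real assume "t \<in> {0..1}"
      then have "(cmod (h t - p t))\<^sup>2 \<le> (sqrt e)\<^sup>2" using p(2)[of t] by (intro power_mono) auto
      then show "(cmod (h t - p t))\<^sup>2 \<le> e" using e by simp
    qed (intro integrable_continuous_real continuous_intros)
    also have "\<dots> = e" by simp
    finally have "?I - sum ?c A + (\<Sum>l\<in>A. (cmod (fcoeff h l - a l))\<^sup>2) \<le> e"
      using integral_norm_diff_trig[OF h(1) A(1), of a] by (simp add: A(2))
    then have "?I - e \<le> sum ?c A" using sum_nonneg[of A "\<lambda>l. (cmod (fcoeff h l - a l))\<^sup>2"] by simp
    then show ?thesis using A by blast
  qed
  have "(?c has_sum (SUP A\<in>{A. finite A \<and> A \<subseteq> UNIV}. sum ?c A)) UNIV"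
    using bdd by (intro nonneg_bdd_above_has_sum) (auto simp: conj_commute)
  moreover have "(SUP A\<in>{A. finite A \<and> A \<subseteq> UNIV}. sum ?c A) = ?I"
  proof (rule antisym)
    show "(SUP A\<in>{A. finite A \<and> A \<subseteq> UNIV}. sum ?c A) \<le> ?I"
      using bessel by (intro cSUP_least) auto
    show "?I \<le> (SUP A\<in>{A. finite A \<and> A \<subseteq> UNIV}. sum ?c A)"
    proof (rule field_le_epsilon)
      fix e :: real assume "0 < e"
      then obtain A where A: "finite A" "?I - e \<le> sum ?c A" using near by blast
      have "sum ?c A \<le> (SUP A\<in>{A. finite A \<and> A \<subseteq> UNIV}. sum ?c A)"
        using A bdd by (intro cSUP_upper) auto
      then show "?I \<le> (SUP A\<in>{A. finite A \<and> A \<subseteq> UNIV}. sum ?c A) + e" using A by linarith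
    qed
  qed
  ultimately show ?thesis by simp
qed

section \<open>Poisson summation for Gaussians\<close>

text \<open>The Weierstrass test makes the convergence uniform, which preserves continuity and
  permits termwise integration against a character. It serves both sides of Poisson's formula: the
  periodised Gaussian and the character series.\<close>

lemma infsum_uniform:
  fixes F :: "int \<Rightarrow> real \<Rightarrow> complex"
  assumes M: "M summable_on UNIV" and F: "\<And>k v. v \<in> {0..1} \<Longrightarrow> cmod (F k v) \<le> M k"
    and c: "\<And>k. continuous_on {0..1} (F k)"
  shows "continuous_on {0..1} (\<lambda>v. \<Sum>\<^sub>\<infinity>k. F k v)"
    and "((\<lambda>k. fcoeff (F k) l) has_sum fcoeff (\<lambda>v. \<Sum>\<^sub>\<infinity>k. F k v) l) UNIV"
proof -
  have u: "uniform_limit {0..1} (\<lambda>X v. \<Sum>k\<in>X. F k v) (\<lambda>v. \<Sum>\<^sub>\<infinity>k. F k v) (finite_subsets_at_top UNIV)"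
    by (rule Weierstrass_m_test_general[OF _ M]) (rule F)
  show "continuous_on {0..1} (\<lambda>v. \<Sum>\<^sub>\<infinity>k. F k v)"
    by (rule uniform_limit_theorem[OF _ u]) (auto intro!: always_eventually continuous_on_sum c)
  have "uniform_limit {0..1} (\<lambda>X v. \<Sum>k\<in>X. F k v * fchar (- l) v) (\<lambda>v. \<Sum>\<^sub>\<infinity>k. F k v * fchar (- l) v) (finite_subsets_at_top UNIV)"
    by (rule Weierstrass_m_test_general[OF _ M]) (simp add: norm_mult fchar_norm F)
  moreover have "continuous_on {0..1} (\<lambda>v. \<Sum>k\<in>X. F k v * fchar (- l) v)" for X
    by (intro continuous_intros c)
  ultimately obtain I J where
    I: "\<And>X. ((\<lambda>v. \<Sum>k\<in>X. F k v * fchar (- l) v) has_integral I X) {0..1}"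
    and J: "((\<lambda>v. \<Sum>\<^sub>\<infinity>k. F k v * fchar (- l) v) has_integral J) {0..1}"
    and lim: "(I \<longlongrightarrow> J) (finite_subsets_at_top UNIV)"
    by (rule uniform_limit_integral) auto
  have "fcoeff (\<lambda>v. \<Sum>\<^sub>\<infinity>k. F k v) l = J"
    unfolding fcoeff_def using J by (intro integral_unique) (simp add: infsum_cmult_left')
  moreover have "\<forall>\<^sub>F X in finite_subsets_at_top UNIV. I X = (\<Sum>k\<in>X. fcoeff (F k) l)"
  proof (rule eventually_finite_subsets_at_top_weakI)
    fix X :: "int set" assume "finite X"
    have "I X = integral {0..1} (\<lambda>v. \<Sum>k\<in>X. F k v * fchar (- l) v)" using I[of X] by (simp add: integral_unique)
    also have "\<dots> = (\<Sum>k\<in>X. fcoeff (F k) l)"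
      unfolding fcoeff_def using \<open>finite X\<close>
      by (rule integral_sum) (intro integrable_continuous_real continuous_intros c)
    finally show "I X = (\<Sum>k\<in>X. fcoeff (F k) l)" .
  qed
  ultimately show "((\<lambda>k. fcoeff (F k) l) has_sum fcoeff (\<lambda>v. \<Sum>\<^sub>\<infinity>k. F k v) l) UNIV"
    unfolding has_sum_def using lim by (auto intro: Lim_transform_eventually)
qed

lemma fcoeff_fchar_series:
  fixes \<kappa> :: "int \<Rightarrow> complex"
  assumes M: "M summable_on UNIV" "\<And>d. cmod (\<kappa> d) \<le> M d"
  shows "continuous_on {0..1} (\<lambda>\<xi>. \<Sum>\<^sub>\<infinity>d. \<kappa> d * fchar d \<xi>)"
    and "fcoeff (\<lambda>\<xi>. \<Sum>\<^sub>\<infinity>d. \<kappa> d * fchar d \<xi>) l = \<kappa> l"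
proof -
  have b: "cmod (\<kappa> d * fchar d \<xi>) \<le> M d" for d \<xi> using M(2) by (simp add: norm_mult fchar_norm)
  have c: "continuous_on A (\<lambda>\<xi>. \<kappa> d * fchar d \<xi>)" for A d by (intro continuous_intros)
  show "continuous_on {0..1} (\<lambda>\<xi>. \<Sum>\<^sub>\<infinity>d. \<kappa> d * fchar d \<xi>)"
    by (rule infsum_uniform(1)[OF M(1) b c])
  have "((\<lambda>k. fcoeff (\<lambda>\<xi>. \<kappa> k * fchar k \<xi>) l) has_sum fcoeff (\<lambda>\<xi>. \<Sum>\<^sub>\<infinity>d. \<kappa> d * fchar d \<xi>) l) UNIV"
    by (rule infsum_uniform(2)[OF M(1) b c])
  moreover have "fcoeff (\<lambda>\<xi>. \<kappa> k * fchar k \<xi>) l = (if k = l then \<kappa> k else 0)" for k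
    by (simp add: fcoeff_def mult.assoc integral_fchar flip: fchar_add)
  ultimately have "((\<lambda>k. if k = l then \<kappa> k else 0) has_sum fcoeff (\<lambda>\<xi>. \<Sum>\<^sub>\<infinity>d. \<kappa> d * fchar d \<xi>) l) UNIV"
    by (simp only:)
  moreover have "((\<lambda>k. if k = l then \<kappa> k else 0) has_sum \<kappa> l) UNIV"
    by (rule has_sum_finite_neutralI[of "{l}"]) auto
  ultimately show "fcoeff (\<lambda>\<xi>. \<Sum>\<^sub>\<infinity>d. \<kappa> d * fchar d \<xi>) l = \<kappa> l" by (rule has_sum_unique)
qed

lemma sum_unit_integrals:
  fixes g :: "real \<Rightarrow> 'a::banach"
  assumes g: "continuous_on UNIV g"
  shows "(\<Sum>k\<in>{- int N..<int N}. integral {0..1} (\<lambda>v. g (v + of_int k))) = integral {- real N..real N} g"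
proof -
  have i: "g integrable_on {a..b}" for a b
    by (rule integrable_continuous_real) (rule continuous_on_subset[OF g], simp)
  have shift: "integral {0..1} (\<lambda>v. g (v + c)) = integral {c..c + 1} g" for c
    using integral_shift_real_ivl[of c c "c + 1" g] by simp
  show ?thesis
  proof (induction N)
    case (Suc N)
    have "{- int (Suc N)..<int (Suc N)} = insert (- int (Suc N)) (insert (int N) {- int N..<int N})" by auto
    then have "(\<Sum>k\<in>{- int (Suc N)..<int (Suc N)}. integral {0..1} (\<lambda>v. g (v + of_int k)))
        = integral {- real (Suc N)..- real N} g + (integral {real N..real (Suc N)} g + integral {- real N..real N} g)"
      using Suc by (simp add: shift add_ac)
    also have "\<dots> = (integral {- real (Suc N)..- real N} g + integral {- real N..real N} g) + integral {real N..real (Suc N)} g"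
      by (simp only: add_ac)
    also have "integral {- real (Suc N)..- real N} g + integral {- real N..real N} g = integral {- real (Suc N)..real N} g"
      by (rule Henstock_Kurzweil_Integration.integral_combine) (auto intro: i)
    also have "integral {- real (Suc N)..real N} g + integral {real N..real (Suc N)} g = integral {- real (Suc N)..real (Suc N)} g"
      by (rule Henstock_Kurzweil_Integration.integral_combine) (auto intro: i)
    finally show ?case .
  qed simp
qed

lemma integral_symmetric_tendsto:
  fixes g :: "real \<Rightarrow> complex"
  assumes g: "integrable lborel g"
  shows "(\<lambda>N. integral {- real N..real N} g) \<longlonglongrightarrow> (LINT v|lborel. g v)"
proof -
  have gm [measurable]: "g \<in> borel_measurable borel" using g by simp
  have "integral {- real N..real N} g = (LINT v|lborel. indicator {- real N..real N} v *\<^sub>R g v)" for N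
    using g by (subst set_borel_integral_eq_integral(2)[symmetric])
      (auto simp: set_lebesgue_integral_def set_integrable_def intro: integrable_mult_indicator)
  moreover have "(\<lambda>N. LINT v|lborel. indicator {- real N..real N} v *\<^sub>R g v) \<longlonglongrightarrow> (LINT v|lborel. g v)"
  proof (rule integral_dominated_convergence[where w = "\<lambda>v. norm (g v)"])
    show "AE v in lborel. (\<lambda>N. indicator {- real N..real N} v *\<^sub>R g v) \<longlonglongrightarrow> g v"
    proof (rule AE_I2)
      fix v :: real
      have "\<forall>\<^sub>F N in sequentially. g v = indicator {- real N..real N} v *\<^sub>R g v"
        using eventually_ge_at_top[of "nat \<lceil>\<bar>v\<bar>\<rceil>"]
      proof eventually_elim
        case (elim N)
        then have "\<bar>v\<bar> \<le> real N" by linarith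
        then have "v \<in> {- real N..real N}" by auto
        then show ?case by simp
      qed
      then show "(\<lambda>N. indicator {- real N..real N} v *\<^sub>R g v) \<longlonglongrightarrow> g v"
        by (rule Lim_transform_eventually[OF tendsto_const])
    qed
    show "AE v in lborel. norm (indicator {- real N..real N} v *\<^sub>R g v) \<le> norm (g v)" for N
      by (auto simp: indicator_def)
  qed (use g in auto)
  ultimately show ?thesis by simp
qed

text \<open>The characteristic function of the standard normal law after the substitution x = cv.
  Here c^2 = 2 pi / y turns x^2/2 into pi v^2 / y, and the frequency t = -2 pi l / c turns exp(i t
  x) into the character.\<close>

lemma gaussian_fourier:
  assumes y: "0 < y"
  shows "integrable lborel (\<lambda>v. complex_of_real (exp (- pi * v\<^sup>2 / y)) * fchar (- l) v)"
    and "(LINT v|lborel. complex_of_real (exp (- pi * v\<^sup>2 / y)) * fchar (- l) v)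
           = complex_of_real (sqrt y * exp (- pi * y * (of_int l)\<^sup>2))"
proof -
  define c where "c = sqrt (2 * pi / y)"
  have c: "0 < c" "c\<^sup>2 = 2 * pi / y" using y by (simp_all add: c_def)
  define t where "t = - 2 * pi * of_int l / c"
  define f where "f x = std_normal_density x *\<^sub>R iexp (t * x)" for x
  have fm: "f \<in> borel_measurable lborel" unfolding f_def by measurable
  have fi: "integrable lborel f"
  proof (rule Bochner_Integration.integrable_bound)
    show "integrable lborel std_normal_density" using integrable_std_normal_moment[of 0] by simp
    show "AE x in lborel. norm (f x) \<le> norm (std_normal_density x)"
      by (simp add: f_def norm_mult)
  qed (rule fm)
  have "(LINT x|lborel. f x) = char std_normal_distribution t"
    unfolding f_def char_def by (subst integral_density) auto
  then have fv: "(LINT x|lborel. f x) = complex_of_real (exp (- (t\<^sup>2) / 2))"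
    by (simp add: char_std_normal_distribution)
  have fc: "f (0 + c * v) = complex_of_real (1 / sqrt (2 * pi)) * (complex_of_real (exp (- pi * v\<^sup>2 / y)) * fchar (- l) v)" for v
  proof -
    have "- (c * v)\<^sup>2 / 2 = - pi * v\<^sup>2 / y" using c by (simp add: power_mult_distrib)
    moreover have "iexp (t * (c * v)) = fchar (- l) v"
      using c by (simp add: fchar_def cis_conv_exp t_def field_simps)
    ultimately show ?thesis
      unfolding f_def std_normal_density_def by (simp add: scaleR_conv_of_real)
  qed
  have "integrable lborel (\<lambda>v. f (0 + c * v))" by (rule lborel_integrable_real_affine[OF fi]) (use c in simp)
  then show "integrable lborel (\<lambda>v. complex_of_real (exp (- pi * v\<^sup>2 / y)) * fchar (- l) v)"
  proof -
    assume "integrable lborel (\<lambda>v. f (0 + c * v))"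
    then have "integrable lborel (\<lambda>v. complex_of_real (sqrt (2 * pi)) * f (0 + c * v))" by (rule integrable_mult_right)
    moreover have "complex_of_real (sqrt (2 * pi)) * f (0 + c * v) = complex_of_real (exp (- pi * v\<^sup>2 / y)) * fchar (- l) v" for v
      unfolding fc by simp
    ultimately show ?thesis by simp
  qed
  have "(LINT x|lborel. f x) = \<bar>c\<bar> *\<^sub>R (LINT v|lborel. f (0 + c * v))"
    by (rule lborel_integral_real_affine) (use c in simp)
  then have e: "complex_of_real (exp (- (t\<^sup>2) / 2)) = complex_of_real (c / sqrt (2 * pi)) * (LINT v|lborel. complex_of_real (exp (- pi * v\<^sup>2 / y)) * fchar (- l) v)"
    unfolding fv fc using c by (simp add: scaleR_conv_of_real)
  have "c / sqrt (2 * pi) = 1 / sqrt y" using y by (simp add: c_def real_sqrt_divide)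
  moreover have "- (t\<^sup>2) / 2 = - pi * y * (of_int l)\<^sup>2"
    unfolding t_def using c y by (simp add: power_divide power_mult_distrib power2_eq_square)
  ultimately have "complex_of_real (sqrt y) * complex_of_real (exp (- pi * y * (of_int l)\<^sup>2))
     = (LINT v|lborel. complex_of_real (exp (- pi * v\<^sup>2 / y)) * fchar (- l) v)"
    using e y by simp
  then show "(LINT v|lborel. complex_of_real (exp (- pi * v\<^sup>2 / y)) * fchar (- l) v)
           = complex_of_real (sqrt y * exp (- pi * y * (of_int l)\<^sup>2))" by simp
qed

lemma exp_int_square: "exp (- (a::real) * (of_int k)\<^sup>2) = exp (- a) ^ nat (k\<^sup>2)"
proof -
  have "(real_of_int k)\<^sup>2 = real (nat (k\<^sup>2))" by simp
  then show ?thesis by (simp only: exp_of_nat_mult[symmetric] mult.commute)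
qed

lemma summable_gaussian_int:
  assumes "0 < (a::real)" shows "(\<lambda>k::int. exp (- a * (of_int k)\<^sup>2)) summable_on A"
proof -
  have "(\<lambda>k::int. exp (- a * (of_int k)\<^sup>2)) summable_on UNIV"
    unfolding exp_int_square using assms by (intro summable_on_int_square_power) auto
  then show ?thesis by (rule summable_on_subset) simp
qed

text \<open>A majorant independent of v: 2(k + v)^2 + 2v^2 - k^2 = (k + 2v)^2 >= 0, and v^2 <=
  1.\<close>

lemma shifted_gaussian_le:
  assumes a: "0 < (a::real)" and v: "v \<in> {0..1}"
  shows "exp (- a * (of_int k + v)\<^sup>2) \<le> exp a * exp (- (a / 2) * (of_int k)\<^sup>2)"
proof -
  have "0 \<le> (of_int k + 2 * v)\<^sup>2" by simp
  then have "(of_int k)\<^sup>2 \<le> 2 * (of_int k + v)\<^sup>2 + 2 * v\<^sup>2" by (simp add: power2_eq_square algebra_simps)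
  also have "v\<^sup>2 \<le> 1" using v by (auto intro: power_le_one)
  finally have "a * (of_int k)\<^sup>2 \<le> a * (2 * (of_int k + v)\<^sup>2 + 2)" using a by simp
  then show ?thesis by (simp add: field_simps flip: exp_add)
qed

lemma summable_shifted_gaussian:
  assumes a: "0 < (a::real)" shows "(\<lambda>k::int. exp (- a * (of_int k + v)\<^sup>2)) summable_on UNIV"
proof -
  have "(\<lambda>k::int. exp (- a * (of_int k + frac v)\<^sup>2)) summable_on UNIV"
  proof (rule summable_on_comparison_test)
    show "(\<lambda>k::int. exp a * exp (- (a / 2) * (of_int k)\<^sup>2)) summable_on UNIV"
      using a by (intro summable_on_cmult_right summable_gaussian_int) auto
    show "exp (- a * (of_int k + frac v)\<^sup>2) \<le> exp a * exp (- (a / 2) * (of_int k)\<^sup>2)" for k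
      using a by (rule shifted_gaussian_le) (simp add: frac_lt_1 less_imp_le)
  qed auto
  also have "?this \<longleftrightarrow> ?thesis"
    by (rule summable_on_reindex_bij_witness[of _ "\<lambda>k. k + \<lfloor>v\<rfloor>" "\<lambda>k. k - \<lfloor>v\<rfloor>"]) (auto simp: frac_def algebra_simps)
  finally show ?thesis .
qed

lemma infsum_shifted_gaussian_int:
  "(\<Sum>\<^sub>\<infinity>k::int. exp (- a * (of_int k + (v + of_int m))\<^sup>2)) = (\<Sum>\<^sub>\<infinity>k::int. exp (- (a::real) * (of_int k + v)\<^sup>2))"
  by (rule infsum_reindex_bij_witness[of _ "\<lambda>k. k - m" "\<lambda>k. k + m"]) (auto simp: algebra_simps)

text \<open>The periodised Gaussian \<Phi> and the character series \<Psi> are continuous, periodic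
  and have the same Fourier coefficients. Parseval, applied to their difference, serves as the
  uniqueness theorem.\<close>

theorem Poisson_gaussian:
  assumes y: "0 < (y::real)"
  shows "(\<Sum>\<^sub>\<infinity>k::int. exp (- (pi / y) * (of_int k + v)\<^sup>2))
     = sqrt y * (\<Sum>\<^sub>\<infinity>l::int. exp (- (pi * y) * (of_int l)\<^sup>2) * cos (2 * pi * of_int l * v))"
proof -
  define f where "f v = exp (- (pi / y) * v\<^sup>2)" for v
  define \<Phi> where "\<Phi> v = (\<Sum>\<^sub>\<infinity>k::int. complex_of_real (f (of_int k + v)))" for v
  define \<Psi> where "\<Psi> v = (\<Sum>\<^sub>\<infinity>l::int. complex_of_real (sqrt y * exp (- (pi * y) * (of_int l)\<^sup>2)) * fchar l v)" for v
  have py: "0 < pi / y" "0 < pi * y" using y by auto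
  have M1: "(\<lambda>k::int. exp (pi / y) * exp (- (pi / y / 2) * (of_int k)\<^sup>2)) summable_on UNIV"
    using py by (intro summable_on_cmult_right summable_gaussian_int) auto
  have M2: "(\<lambda>k::int. sqrt y * exp (- (pi * y) * (of_int k)\<^sup>2)) summable_on UNIV"
    using py by (intro summable_on_cmult_right summable_gaussian_int) auto
  have b1: "cmod (complex_of_real (f (of_int k + v))) \<le> exp (pi / y) * exp (- (pi / y / 2) * (of_int k)\<^sup>2)"
    if "v \<in> {0..1}" for k v
    using shifted_gaussian_le[OF py(1) that, of k] by (simp add: f_def)
  have c1: "continuous_on A (\<lambda>v. complex_of_real (f (of_int k + v)))" for A k
    unfolding f_def by (intro continuous_intros)
  have b2: "cmod (complex_of_real (sqrt y * exp (- (pi * y) * (of_int k)\<^sup>2)) * fchar k v) \<le> sqrt y * exp (- (pi * y) * (of_int k)\<^sup>2)" for k v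
    using y by (simp add: norm_mult fchar_norm)
  have c2: "continuous_on A (\<lambda>v. complex_of_real (sqrt y * exp (- (pi * y) * (of_int k)\<^sup>2)) * fchar k v)" for A k
    by (intro continuous_intros)
  have c\<Phi>: "continuous_on {0..1} \<Phi>" unfolding \<Phi>_def by (rule infsum_uniform(1)[OF M1 b1 c1])
  have c\<Psi>: "continuous_on {0..1} \<Psi>" unfolding \<Psi>_def by (rule infsum_uniform(1)[OF M2 b2 c2])
  have cont: "continuous_on {0..1} (\<lambda>v. \<Phi> v - \<Psi> v)" by (rule continuous_on_diff[OF c\<Phi> c\<Psi>])
  have M2': "cmod (complex_of_real (sqrt y * exp (- (pi * y) * (of_int k)\<^sup>2))) \<le> sqrt y * exp (- (pi * y) * (of_int k)\<^sup>2)" for k :: int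
    using y by (simp add: norm_mult)
  have "fcoeff \<Psi> l = complex_of_real (sqrt y * exp (- (pi * y) * (of_int l)\<^sup>2))" for l
    unfolding \<Psi>_def by (rule fcoeff_fchar_series(2)[OF M2 M2'])
  moreover have "fcoeff \<Phi> l = complex_of_real (sqrt y * exp (- (pi * y) * (of_int l)\<^sup>2))" for l
  proof -
    define g where "g v = complex_of_real (exp (- pi * v\<^sup>2 / y)) * fchar (- l) v" for v
    have gc: "continuous_on UNIV g" unfolding g_def by (intro continuous_intros) (use y in auto)
    have "((\<lambda>k. fcoeff (\<lambda>v. complex_of_real (f (of_int k + v))) l) has_sum fcoeff \<Phi> l) UNIV"
      unfolding \<Phi>_def by (rule infsum_uniform(2)[OF M1 b1 c1])
    moreover have "fcoeff (\<lambda>v. complex_of_real (f (of_int k + v))) l = integral {0..1} (\<lambda>v. g (v + of_int k))" for k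
      by (simp add: fcoeff_def f_def g_def fchar_add_int add.commute)
    ultimately have hs: "((\<lambda>k. integral {0..1} (\<lambda>v. g (v + of_int k))) has_sum fcoeff \<Phi> l) UNIV" by simp
    \<comment> \<open>The windows exhaust the integers, so the unordered sum is also the limit along
      them; there the unit integrals telescope into the integral over [-N, N].\<close>
    have "filterlim (\<lambda>N. {- int N..<int N}) (finite_subsets_at_top UNIV) sequentially"
      unfolding filterlim_finite_subsets_at_top
    proof (intro allI impI)
      fix X :: "int set" assume "finite X \<and> X \<subseteq> UNIV"
      then obtain b where b: "\<And>x. x \<in> X \<Longrightarrow> \<bar>x\<bar> \<le> b"
        using bdd_above_finite[of "abs ` X"] unfolding bdd_above_def by auto
      show "\<forall>\<^sub>F N in sequentially. finite {- int N..<int N} \<and> X \<subseteq> {- int N..<int N} \<and> {- int N..<int N} \<subseteq> UNIV"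
        using eventually_gt_at_top[of "nat b"]
      proof eventually_elim
        case (elim N)
        have "x \<in> {- int N..<int N}" if "x \<in> X" for x using b[OF that] elim by auto
        then show ?case by auto
      qed
    qed
    then have "(\<lambda>N. \<Sum>k\<in>{- int N..<int N}. integral {0..1} (\<lambda>v. g (v + of_int k))) \<longlonglongrightarrow> fcoeff \<Phi> l"
      using hs unfolding has_sum_def by (rule filterlim_compose[rotated])
    then have "(\<lambda>N. integral {- real N..real N} g) \<longlonglongrightarrow> fcoeff \<Phi> l"
      by (simp only: sum_unit_integrals[OF gc])
    moreover have "(\<lambda>N. integral {- real N..real N} g) \<longlonglongrightarrow> (LINT v|lborel. g v)"
      unfolding g_def by (rule integral_symmetric_tendsto[OF gaussian_fourier(1)[OF y]])
    ultimately have "fcoeff \<Phi> l = (LINT v|lborel. g v)" by (rule LIMSEQ_unique)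
    then show ?thesis unfolding g_def gaussian_fourier(2)[OF y] by simp
  qed
  moreover have "fcoeff (\<lambda>v. \<Phi> v - \<Psi> v) l = fcoeff \<Phi> l - fcoeff \<Psi> l" for l
    unfolding fcoeff_def left_diff_distrib
    by (intro integral_diff integrable_continuous_real continuous_on_mult continuous_on_fchar c\<Phi> c\<Psi>)
  ultimately have zero: "fcoeff (\<lambda>v. \<Phi> v - \<Psi> v) l = 0" for l by simp
  have \<Psi>per: "\<Psi> (v + of_int m) = \<Psi> v" for v m by (simp add: \<Psi>_def fchar_add_int)
  have f_real: "\<Phi> v = complex_of_real (\<Sum>\<^sub>\<infinity>k::int. f (of_int k + v))" for v
    unfolding \<Phi>_def f_def
    by (rule infsumI, rule has_sum_of_real, rule has_sum_infsum, rule summable_shifted_gaussian[OF py(1)])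
  have \<Phi>per: "\<Phi> (v + of_int m) = \<Phi> v" for v m
    unfolding f_real f_def infsum_shifted_gaussian_int ..
  have "\<Phi> 0 - \<Psi> 0 = \<Phi> 1 - \<Psi> 1" using \<Psi>per[of 0 1] \<Phi>per[of 0 1] by simp
  from Parseval_periodic[OF cont this]
  have "((\<lambda>l::int. 0) has_sum integral {0..1} (\<lambda>t. (cmod (\<Phi> t - \<Psi> t))\<^sup>2)) UNIV"
    by (simp add: zero)
  then have "integral {0..1} (\<lambda>t. (cmod (\<Phi> t - \<Psi> t))\<^sup>2) = 0"
    by (rule has_sum_unique[OF _ has_sum_0]) simp
  then have "\<Phi> t - \<Psi> t = 0" if "t \<in> {0..1}" for t
  proof -
    have c: "continuous_on {0..1} (\<lambda>t. (cmod (\<Phi> t - \<Psi> t))\<^sup>2)"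
      by (intro continuous_on_power continuous_on_norm cont)
    have "((\<lambda>t. (cmod (\<Phi> t - \<Psi> t))\<^sup>2) has_integral 0) (cbox 0 1)"
      using integrable_integral[OF integrable_continuous_real[OF c]] \<open>integral _ _ = 0\<close> by simp
    then have "(cmod (\<Phi> t - \<Psi> t))\<^sup>2 = 0"
      using has_integral_0_cbox_imp_0[of 0 1 "\<lambda>t. (cmod (\<Phi> t - \<Psi> t))\<^sup>2" t] c that by simp
    then show ?thesis by simp
  qed
  then have "\<Phi> (frac v) = \<Psi> (frac v)" using frac_lt_1[of v] by (simp add: less_imp_le)
  moreover have "v = frac v + of_int \<lfloor>v\<rfloor>" by (simp add: frac_def)
  ultimately have "\<Phi> v = \<Psi> v" using \<Phi>per[of "frac v" "\<lfloor>v\<rfloor>"] \<Psi>per[of "frac v" "\<lfloor>v\<rfloor>"] by simp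
  then have "Re (\<Phi> v) = Re (\<Psi> v)" by simp
  also have "Re (\<Psi> v) = (\<Sum>\<^sub>\<infinity>l::int. Re (complex_of_real (sqrt y * exp (- (pi * y) * (of_int l)\<^sup>2)) * fchar l v))"
    unfolding \<Psi>_def
    by (rule infsum_Re[symmetric], rule Infinite_Sum.abs_summable_summable,
        rule Infinite_Sum.abs_summable_on_comparison_test'[OF M2 b2])
  also have "\<dots> = sqrt y * (\<Sum>\<^sub>\<infinity>l::int. exp (- (pi * y) * (of_int l)\<^sup>2) * cos (2 * pi * of_int l * v))"
    by (subst infsum_cmult_right'[symmetric]) (simp add: fchar_def mult.assoc)
  finally show ?thesis unfolding f_real by (simp add: f_def)
qed

section \<open>Janssen's series\<close>

definition janssen_sign :: "nat \<Rightarrow> int \<Rightarrow> int \<Rightarrow> real" where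
  "janssen_sign n k l = (if even (int n * k * l) then 1 else -1)"

definition janssen :: "nat \<Rightarrow> real \<Rightarrow> real \<Rightarrow> real \<Rightarrow> real" where
  "janssen n s u v = (\<Sum>\<^sub>\<infinity>(k, l). janssen_sign n k l * cos (of_int k * (2 * pi * u)) * cos (of_int l * (2 * pi * v))
     * gauss_weight (exp (- (pi * n / 2) * s)) (exp (- (pi * n / 2) / s)) (k, l))"

lemma janssen_sign_commute: "janssen_sign n k l = janssen_sign n l k"
  by (auto simp: janssen_sign_def)

lemma cos_int_pi: "cos (of_int k * pi) = (if even k then 1 else -1)"
proof (cases "even k")
  case True
  then obtain j where "k = 2 * j" by (elim evenE)
  then have "of_int k * pi = 2 * pi * of_int j" by simp
  then show ?thesis using True by (simp only: cos_int_2pin) simp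
next
  case False
  then obtain j where "k = 2 * j + 1" by (elim oddE)
  then have "of_int k * pi = 2 * pi * of_int j + pi" by (simp add: algebra_simps)
  then show ?thesis using False by (simp only: cos_periodic_pi cos_int_2pin) simp
qed

lemma sin_int_pi: "sin (of_int k * pi) = 0"
  by (simp add: mult.commute)

text \<open>Written as a cosine in l, the sign can be absorbed into a translation: in the series
  over l it shifts the argument by nk/2.\<close>

lemma janssen_sign_cos: "janssen_sign n k l = cos (of_int l * (of_int (int n * k) * pi))"
proof -
  have "of_int l * (of_int (int n * k) * pi) = of_int (int n * k * l) * pi" by simp
  then show ?thesis unfolding janssen_sign_def by (simp only: cos_int_pi)
qed

lemma janssen_swap: "janssen n (1 / s) u v = janssen n s v u"
  unfolding janssen_def
proof (rule infsum_reindex_bij_witness[of _ prod.swap prod.swap])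
  fix a :: "int \<times> int"
  show "(case prod.swap a of (k, l) \<Rightarrow> janssen_sign n k l * cos (of_int k * (2 * pi * v)) * cos (of_int l * (2 * pi * u))
     * gauss_weight (exp (- (pi * n / 2) * s)) (exp (- (pi * n / 2) / s)) (k, l))
    = (case a of (k, l) \<Rightarrow> janssen_sign n k l * cos (of_int k * (2 * pi * u)) * cos (of_int l * (2 * pi * v))
     * gauss_weight (exp (- (pi * n / 2) * (1 / s))) (exp (- (pi * n / 2) / (1 / s))) (k, l))"
    by (cases a) (simp add: gauss_weight_def janssen_sign_commute mult_ac)
qed auto

lemma abs_janssen_sign: "\<bar>janssen_sign n k l\<bar> = 1"
  by (simp add: janssen_sign_def)

lemma exp_neg_le_quarter: "3/2 \<le> X \<Longrightarrow> exp (- X) \<le> (1/4 :: real)"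
proof -
  assume "3/2 \<le> X"
  then have "exp (- (2 * X)) \<le> 1/20" by (intro exp_neg_le_one_twentieth) simp
  moreover have "(exp (- X))\<^sup>2 = exp (- (2 * X))" by (simp add: power2_eq_square flip: exp_add)
  ultimately have "(exp (- X))\<^sup>2 \<le> (1/4)\<^sup>2" by (simp add: power2_eq_square)
  then show ?thesis by (rule power2_le_imp_le) simp
qed

text \<open>Moving the origin to (1/2, 1/2) multiplies the coefficients by (-1)^(k+l). The unit
  coefficients become -1, and the minimum follows from the same cosine comparison as the
  maximum.\<close>

lemma janssen_square_bounds:
  assumes n: "1 \<le> n"
  shows "janssen n 1 u v \<le> janssen n 1 0 0" "janssen n 1 (1/2) (1/2) \<le> janssen n 1 u v"
proof -
  define q where "q = exp (- (pi * n / 2))"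
  have "3/2 \<le> pi * n / 2" using n pi_gt3 mult_mono[of 3 pi 1 "real n"] by simp
  then have q: "0 < q" "q \<le> 1/4" unfolding q_def using exp_neg_le_quarter by (simp_all only: exp_gt_zero)
  define c where "c = (\<lambda>(k, l). janssen_sign n k l)"
  define d where "d = (\<lambda>(k, l). janssen_sign n k l * cos (of_int k * pi) * cos (of_int l * pi))"
  have J: "janssen n 1 u v = (\<Sum>\<^sub>\<infinity>(k, l). c (k, l) * cos (of_int k * (2 * pi * u)) * cos (of_int l * (2 * pi * v)) * gauss_weight q q (k, l))" for u v
    by (simp add: janssen_def c_def q_def)
  have J0: "janssen n 1 0 0 = (\<Sum>\<^sub>\<infinity>p. c p * gauss_weight q q p)"
    unfolding J by (rule infsum_cong) auto
  have Jh: "janssen n 1 (1/2) (1/2) = (\<Sum>\<^sub>\<infinity>p. d p * gauss_weight q q p)"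
    unfolding J by (rule infsum_cong) (auto simp: c_def d_def)
  have c1: "\<bar>c p\<bar> \<le> 1" for p by (cases p) (simp add: c_def abs_janssen_sign)
  have d1: "\<bar>d p\<bar> \<le> 1" for p by (cases p) (simp add: d_def abs_mult abs_janssen_sign cos_int_pi)
  have "1 * janssen n 1 u v \<le> 1 * janssen n 1 0 0"
    unfolding J0 unfolding J by (rule signed_sum_cos_compare[OF q c1]) (auto simp: c_def janssen_sign_def)
  then show "janssen n 1 u v \<le> janssen n 1 0 0" by simp
  \<comment> \<open>The addition theorem with phase k pi; the sine part vanishes.\<close>
  have sh: "cos (of_int k * (2 * pi * w)) = cos (of_int k * pi) * cos (of_int k * (2 * pi * (w - 1/2)))" for k w
  proof -
    have "of_int k * (2 * pi * w) = of_int k * (2 * pi * (w - 1/2)) + of_int k * pi" by (simp add: algebra_simps)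
    then show ?thesis by (simp only: cos_add sin_int_pi) simp
  qed
  have Jd: "janssen n 1 u v = (\<Sum>\<^sub>\<infinity>(k, l). d (k, l) * cos (of_int k * (2 * pi * (u - 1/2))) * cos (of_int l * (2 * pi * (v - 1/2))) * gauss_weight q q (k, l))"
    unfolding J d_def c_def sh[of _ u] sh[of _ v] by (rule infsum_cong) auto
  have "(-1) * janssen n 1 u v \<le> (-1) * janssen n 1 (1/2) (1/2)"
    unfolding Jh unfolding Jd by (rule signed_sum_cos_compare[OF q d1]) (auto simp: d_def janssen_sign_def)
  then show "janssen n 1 (1/2) (1/2) \<le> janssen n 1 u v" by simp
qed

section \<open>One-variable theta functions and partial summation\<close>

definition gauss_theta :: "real \<Rightarrow> real \<Rightarrow> real" where
  "gauss_theta y v = (\<Sum>\<^sub>\<infinity>l::int. exp (- (pi * y) * (of_int l)\<^sup>2) * cos (2 * pi * of_int l * v))"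

lemma gauss_theta_Poisson:
  assumes "0 < y"
  shows "gauss_theta y v = (\<Sum>\<^sub>\<infinity>k::int. exp (- (pi / y) * (of_int k + v)\<^sup>2)) / sqrt y"
  using Poisson_gaussian[OF assms, of v] assms by (simp add: gauss_theta_def)

lemma gauss_theta_nonneg: "0 < y \<Longrightarrow> 0 \<le> gauss_theta y v"
  by (simp add: gauss_theta_Poisson infsum_nonneg)

lemma summable_gauss_theta: "0 < y \<Longrightarrow> (\<lambda>l::int. exp (- (pi * y) * (of_int l)\<^sup>2) * cos (2 * pi * of_int l * v)) summable_on A"
  by (rule Infinite_Sum.abs_summable_summable, rule Infinite_Sum.abs_summable_on_comparison_test'[OF summable_gaussian_int[of "pi * y"]])
     (auto simp: abs_mult mult_left_le)

text \<open>The defining series alternates, so the monotonicity is read off its Poisson dual: each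
  term exp(-a/y)/sqrt y increases for y <= 2a, and a = pi (k + 1/2)^2 >= 1/2 covers all y <=
  1.\<close>

lemma gauss_theta_half_mono:
  assumes y: "0 < y" "y \<le> z" "z \<le> 1"
  shows "gauss_theta y (1/2) \<le> gauss_theta z (1/2)"
proof -
  have z: "0 < z" using y by simp
  have "exp (- (pi / y) * (of_int k + 1/2)\<^sup>2) / sqrt y \<le> exp (- (pi / z) * (of_int k + 1/2)\<^sup>2) / sqrt z" for k :: int
  proof -
    define a where "a = pi * (of_int k + 1/2)\<^sup>2"
    have "1/4 \<le> (real_of_int k + 1/2)\<^sup>2"
    proof -
      have "0 \<le> k * (k + 1)" by (cases "0 \<le> k") (auto intro: mult_nonpos_nonpos)
      then have "0 \<le> real_of_int (k * (k + 1))" by (simp only: of_int_0_le_iff)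
      then show ?thesis by (simp add: power2_eq_square algebra_simps)
    qed
    then have "3 * (1/4) \<le> a" unfolding a_def using pi_gt3 by (intro mult_mono) auto
    then have a: "1/2 \<le> a" by simp
    have "z / y \<le> exp (z / y - 1)" using exp_ge_add_one_self[of "z / y - 1"] by simp
    also have "z / y - 1 \<le> 2 * (a / y - a / z)"
    proof -
      have "2 * (a / y - a / z) = 2 * a / z * (z / y - 1)" using y z by (simp add: field_simps)
      moreover have "1 \<le> 2 * a / z" using a y z by (simp add: field_simps)
      moreover have "0 \<le> z / y - 1" using y by simp
      ultimately show ?thesis using mult_right_mono[of 1 "2 * a / z" "z / y - 1"] by simp
    qed
    finally have "z / y \<le> exp (2 * (a / y - a / z))" by simp
    also have "\<dots> = (exp (a / y - a / z))\<^sup>2" by (simp add: power2_eq_square flip: exp_add)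
    finally have "sqrt (z / y) \<le> exp (a / y - a / z)" using real_le_lsqrt y z by simp
    then have "sqrt z / sqrt y \<le> exp (a / y) / exp (a / z)" by (simp add: real_sqrt_divide exp_diff)
    then show ?thesis using y z by (simp add: a_def exp_minus field_simps)
  qed
  moreover have sm: "(\<lambda>k::int. exp (- (pi / w) * (of_int k + 1/2)\<^sup>2) / sqrt w) summable_on UNIV" if "0 < w" for w
    using summable_on_cmult_left[OF summable_shifted_gaussian[of "pi / w" "1/2"], of "1 / sqrt w"] that by simp
  ultimately have "(\<Sum>\<^sub>\<infinity>k::int. exp (- (pi / y) * (of_int k + 1/2)\<^sup>2) / sqrt y) \<le> (\<Sum>\<^sub>\<infinity>k::int. exp (- (pi / z) * (of_int k + 1/2)\<^sup>2) / sqrt z)"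
    using y z by (intro infsum_mono) auto
  then show ?thesis
    using gauss_theta_Poisson[OF y(1), of "1/2"] gauss_theta_Poisson[OF z, of "1/2"]
      infsum_cmult_left'[of "\<lambda>k::int. exp (- (pi / y) * (of_int k + 1/2)\<^sup>2)" "1 / sqrt y" UNIV]
      infsum_cmult_left'[of "\<lambda>k::int. exp (- (pi / z) * (of_int k + 1/2)\<^sup>2)" "1 / sqrt z" UNIV] by simp
qed

lemma infsum_split_pm1:
  fixes f :: "int \<Rightarrow> real"
  assumes "\<And>A. f summable_on A"
  shows "infsum f UNIV = f (-1) + f 0 + f 1 + infsum f (- {-1..1})"
proof -
  have "infsum f ({-1..1} \<union> - {-1..1}) = infsum f {-1..1} + infsum f (- {-1..1})"
    by (rule infsum_Un_disjoint[OF assms assms]) simp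
  moreover have "{-1..1::int} = {-1, 0, 1}" by auto
  ultimately show ?thesis by simp
qed

lemma infsum_half_square_tail_le: "infsum (\<lambda>k::int. (1/2::real) ^ nat (k\<^sup>2)) (- {-1..1}) \<le> 13/100"
proof -
  have "(\<lambda>k::int. (1/2::real) ^ nat (k\<^sup>2)) summable_on A" for A
    by (rule summable_on_subset[OF summable_on_int_square_power]) auto
  from infsum_split_pm1[OF this] show ?thesis using infsum_half_square_le by simp
qed

text \<open>By monotonicity it suffices to take the nome equal to 1/8, that is y = ln 8 / pi <= 1.
  The value there is 1 - 2/8 up to a tail of at most 0.13/256.\<close>

lemma gauss_theta_half_le:
  assumes y: "0 < y" "exp (- (pi * y)) \<ge> 1/8"
  shows "gauss_theta y (1/2) \<le> 751/1000"
proof -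
  define z where "z = ln 8 / pi"
  have "exp (- 3) \<le> (1/20::real)" by (rule exp_neg_le_one_twentieth) simp
  then have "8 \<le> exp (3::real)" by (simp add: exp_minus field_simps)
  then have "ln 8 \<le> (3::real)" by (metis ln_exp ln_mono zero_less_numeral)
  then have z1: "z \<le> 1" "0 < z" using pi_gt3 by (auto simp: z_def field_simps)
  have "pi * y \<le> ln 8"
  proof -
    have "exp (pi * y) \<le> 8" using y by (simp add: exp_minus field_simps)
    then show ?thesis by (simp add: ln_ge_iff)
  qed
  then have yz: "y \<le> z" by (simp add: z_def field_simps)
  define f where "f l = exp (- (pi * z) * (of_int l)\<^sup>2) * cos (2 * pi * of_int l * (1/2))" for l :: int
  have e8: "exp (- (pi * z)) = 1/8" by (simp add: z_def exp_minus)
  have fe: "f l = (1/8) ^ nat (l\<^sup>2) * cos (of_int l * pi)" for l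
    unfolding f_def exp_int_square e8 by (simp add: mult_ac)
  have sf: "f summable_on A" for A unfolding f_def using z1 by (intro summable_gauss_theta)
  have sh: "(\<lambda>k::int. (1/2::real) ^ nat (k\<^sup>2)) summable_on A" for A
    by (rule summable_on_subset[OF summable_on_int_square_power]) auto
  have "infsum f (- {-1..1}) \<le> infsum (\<lambda>k. (1/256) * (1/2::real) ^ nat (k\<^sup>2)) (- {-1..1})"
  proof (rule infsum_mono[OF sf summable_on_cmult_right[OF sh]])
    fix k :: int assume "k \<in> - {-1..1}"
    then have "2 \<le> \<bar>k\<bar>" by auto
    from power_mono[OF this, of 2] have "4 \<le> k\<^sup>2" by simp
    then have k: "4 \<le> nat (k\<^sup>2)" by linarith
    have "f k \<le> (1/8) ^ nat (k\<^sup>2)" unfolding fe by (simp add: cos_int_pi)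
    also have "\<dots> = (1/4) ^ nat (k\<^sup>2) * (1/2) ^ nat (k\<^sup>2)" by (simp flip: power_mult_distrib)
    also have "\<dots> \<le> (1/4) ^ 4 * (1/2) ^ nat (k\<^sup>2)" using k by (intro mult_right_mono power_decreasing) auto
    finally show "f k \<le> (1/256) * (1/2) ^ nat (k\<^sup>2)" by (simp add: power4_eq_xxxx)
  qed
  also have "\<dots> = (1/256) * infsum (\<lambda>k. (1/2::real) ^ nat (k\<^sup>2)) (- {-1..1})" by (rule infsum_cmult_right')
  also have "\<dots> \<le> (1/256) * (13/100)" using infsum_half_square_tail_le by (intro mult_left_mono) auto
  finally have t: "infsum f (- {-1..1}) \<le> (1/256) * (13/100)" .
  have "gauss_theta z (1/2) = infsum f UNIV" by (simp only: gauss_theta_def f_def [abs_def])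
  also have "\<dots> = f (-1) + f 0 + f 1 + infsum f (- {-1..1})" by (rule infsum_split_pm1[OF sf])
  also have "\<dots> \<le> 751/1000" using t by (simp add: fe)
  finally show ?thesis using gauss_theta_half_mono[OF y(1) yz z1(1)] by linarith
qed

text \<open>Summing over l first leaves theta values, which are nonnegative; the sign reappears as
  the shift by nk/2.\<close>

lemma janssen_iterated:
  assumes n: "1 \<le> n" and s: "0 < s"
  shows "(\<lambda>k::int. exp (- (pi * n / 2) * s) ^ nat (k\<^sup>2) * cos (of_int k * (2 * pi * u))
       * gauss_theta (n / (2 * s)) (v + of_int (int n * k) / 2)) summable_on UNIV" (is ?A)
    and "janssen n s u v = (\<Sum>\<^sub>\<infinity>k::int. exp (- (pi * n / 2) * s) ^ nat (k\<^sup>2) * cos (of_int k * (2 * pi * u))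
       * gauss_theta (n / (2 * s)) (v + of_int (int n * k) / 2))" (is ?B)
proof -
  define x where "x = exp (- (pi * n / 2) * s)"
  define y where "y = exp (- (pi * n / 2) / s)"
  have xy: "0 \<le> x" "x < 1" "0 \<le> y" "y < 1" using n s by (auto simp: x_def y_def)
  define c where "c = (\<lambda>(k, l). janssen_sign n k l * cos (of_int k * (2 * pi * u)) * cos (of_int l * (2 * pi * v)))"
  have c1: "\<bar>c p\<bar> \<le> 1" for p
    by (cases p) (auto simp: c_def abs_mult abs_janssen_sign intro!: mult_le_one)
  have sm: "(\<lambda>p. c p * gauss_weight x y p) summable_on UNIV \<times> UNIV"
    by (rule summable_gauss_weight_mult[OF xy c1])
  have y: "y ^ nat (l\<^sup>2) = exp (- (pi * (n / (2 * s))) * (of_int l)\<^sup>2)" for l :: int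
    unfolding exp_int_square y_def by (simp add: field_simps)
  have cc: "janssen_sign n k l * cos (of_int l * (2 * pi * v)) = cos (2 * pi * of_int l * (v + of_int (int n * k) / 2))" for k l
  proof -
    have "2 * pi * of_int l * (v + of_int (int n * k) / 2) = of_int l * (2 * pi * v) + of_int (l * (int n * k)) * pi"
      by (simp add: algebra_simps)
    moreover have "janssen_sign n k l = cos (of_int (l * (int n * k)) * pi)"
      unfolding janssen_sign_cos by (simp add: mult.assoc)
    ultimately show ?thesis by (simp only: cos_add sin_int_pi) simp
  qed
  have inner: "(\<Sum>\<^sub>\<infinity>l. c (k, l) * gauss_weight x y (k, l)) = x ^ nat (k\<^sup>2) * cos (of_int k * (2 * pi * u))
       * gauss_theta (n / (2 * s)) (v + of_int (int n * k) / 2)" for k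
  proof -
    have "c (k, l) * gauss_weight x y (k, l) = (x ^ nat (k\<^sup>2) * cos (of_int k * (2 * pi * u))) *
        (exp (- (pi * (n / (2 * s))) * (of_int l)\<^sup>2) * cos (2 * pi * of_int l * (v + of_int (int n * k) / 2)))" for l
      unfolding cc[symmetric] y[symmetric] by (simp add: c_def gauss_weight_def mult_ac)
    then show ?thesis unfolding gauss_theta_def by (simp only: infsum_cmult_right')
  qed
  have "(\<lambda>k. \<Sum>\<^sub>\<infinity>l. c (k, l) * gauss_weight x y (k, l)) summable_on UNIV"
  proof (rule summable_on_SigmaD[OF sm])
    have "(\<lambda>(k, l). c (k, l) * gauss_weight x y (k, l)) summable_on UNIV \<times> UNIV"
      using sm by (simp add: case_prod_unfold)
    then show "(\<lambda>l. c (k, l) * gauss_weight x y (k, l)) summable_on UNIV" for k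
      by (rule summable_on_SigmaD1) simp
  qed
  then show ?A unfolding inner by (simp add: x_def)
  have "janssen n s u v = (\<Sum>\<^sub>\<infinity>p. c p * gauss_weight x y p)"
    unfolding janssen_def by (rule infsum_cong) (auto simp: c_def x_def y_def)
  also have "\<dots> = (\<Sum>\<^sub>\<infinity>k. \<Sum>\<^sub>\<infinity>l. c (k, l) * gauss_weight x y (k, l))"
    using infsum_Sigma_banach[OF sm] by simp
  finally show ?B unfolding inner by (simp add: x_def)
qed

text \<open>For q <= 1/20 the corners contribute at most 4/400 and the tail at most 0.54/10000, so
  both values lie within 0.02 of 1 + 4q and 1 - 4q.\<close>

lemma janssen_square_numeric:
  assumes n: "2 \<le> n"
  shows "janssen n 1 0 0 \<le> 125/100" "janssen n 1 (1/2) (1/2) \<ge> 78/100"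
proof -
  define q where "q = exp (- (pi * n / 2))"
  have "3 * 2 \<le> pi * real n" using n pi_gt3 by (intro mult_mono) auto
  then have q: "0 < q" "q \<le> 1/20" unfolding q_def using exp_neg_le_one_twentieth[of "pi * n / 2"] by auto
  have gen: "\<bar>(\<Sum>\<^sub>\<infinity>p. c p * gauss_weight q q p) - (1 + 4 * \<sigma> * q)\<bar> \<le> 2/100"
    if c: "\<And>p. \<bar>c p\<bar> \<le> 1" "c (0,0) = 1" "c (1,0) = \<sigma>" "c (-1,0) = \<sigma>" "c (0,1) = \<sigma>" "c (0,-1) = \<sigma>"
    for c :: "int \<times> int \<Rightarrow> real" and \<sigma>
  proof -
    have sm: "(\<lambda>p. c p * gauss_weight q q p) summable_on UNIV"
      by (rule summable_gauss_weight_mult[OF _ _ _ _ c(1)]) (use q in auto)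
    have "\<bar>infsum (\<lambda>p. c p * gauss_weight q q p) (- unit_box)\<bar> \<le> (1/10000) * (54/100)"
    proof (rule infsum_outside_le)
      fix p :: "int \<times> int" assume "p \<notin> unit_box"
      then obtain k l where p: "p = (k, l)" and kl: "(k, l) \<notin> unit_box" by (cases p) auto
      define M where "M = nat (k\<^sup>2) + nat (l\<^sup>2)"
      have M: "4 \<le> M" using outside_unit_box_squares(1)[OF kl] by (simp add: M_def)
      have "\<bar>c p * gauss_weight q q p\<bar> \<le> gauss_weight q q p"
        using c(1)[of p] gauss_weight_nonneg[of q q p] q by (simp add: abs_mult mult_left_le_one_le)
      also have "\<dots> = q ^ M" by (simp add: p gauss_weight_def M_def power_add)
      also have "\<dots> \<le> (1/20) ^ M" using q by (intro power_mono) auto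
      also have "\<dots> = (1/10) ^ M * (1/2) ^ M" by (simp flip: power_mult_distrib)
      also have "\<dots> \<le> (1/10) ^ 4 * (1/2) ^ M" using M by (intro mult_right_mono power_decreasing) auto
      finally show "\<bar>c p * gauss_weight q q p\<bar> \<le> 1/10000 * gauss_weight (1/2) (1/2) p"
        by (simp add: p gauss_weight_def M_def power_add power4_eq_xxxx)
    qed simp
    moreover have "\<bar>c p * (q * q)\<bar> \<le> 1/400" for p
    proof -
      have "\<bar>c p\<bar> * (q * q) \<le> 1 * ((1/20) * (1/20))" using c(1)[of p] q by (intro mult_mono) auto
      then show ?thesis using q by (simp add: abs_mult)
    qed
    from this[of "(1,1)"] this[of "(1,-1)"] this[of "(-1,1)"] this[of "(-1,-1)"]
    have "\<bar>c (1,1) * (q * q) + c (1,-1) * (q * q) + c (-1,1) * (q * q) + c (-1,-1) * (q * q)\<bar> \<le> 1/100"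
      by linarith
    moreover have "(\<Sum>p\<in>unit_box. c p * gauss_weight q q p)
        = (1 + 4 * \<sigma> * q) + (c (1,1) * (q * q) + c (1,-1) * (q * q) + c (-1,1) * (q * q) + c (-1,-1) * (q * q))"
      by (simp add: unit_box_eq gauss_weight_def c)
    ultimately show ?thesis unfolding infsum_split_unit_box[OF sm] by linarith
  qed
  have "janssen n 1 0 0 = (\<Sum>\<^sub>\<infinity>p. (case p of (k, l) \<Rightarrow> janssen_sign n k l) * gauss_weight q q p)"
    unfolding janssen_def by (rule infsum_cong) (auto simp: q_def)
  also have "\<bar>\<dots> - (1 + 4 * 1 * q)\<bar> \<le> 2/100"
    by (rule gen) (auto simp: abs_janssen_sign, auto simp: janssen_sign_def)
  finally show "janssen n 1 0 0 \<le> 125/100" using q by linarith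
  have "janssen n 1 (1/2) (1/2) = (\<Sum>\<^sub>\<infinity>p. (case p of (k, l) \<Rightarrow> janssen_sign n k l * cos (of_int k * pi) * cos (of_int l * pi)) * gauss_weight q q p)"
    unfolding janssen_def by (rule infsum_cong) (auto simp: q_def)
  also have "\<bar>\<dots> - (1 + 4 * (-1) * q)\<bar> \<le> 2/100"
    by (rule gen) (auto simp: abs_mult abs_janssen_sign cos_int_pi, auto simp: janssen_sign_def)
  finally show "janssen n 1 (1/2) (1/2) \<ge> 78/100" using q by linarith
qed

text \<open>For y <= 1/8 the sign-blind comparison applies. For larger y the values are far apart:
  the series over k is dominated by its term k = 0, which is at least 1.25 at (0, 0) and at most
  0.751 at (1/2, 1/2), beyond the limits 1.25 and 0.78 for the square lattice.\<close>

lemma janssen_monotone_ge1: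
  assumes n: "2 \<le> n" and s: "1 \<le> s"
  shows "janssen n 1 0 0 \<le> janssen n s 0 0" "janssen n s (1/2) (1/2) \<le> janssen n 1 (1/2) (1/2)"
proof -
  define X where "X = pi * n / 2"
  have "3 * 2 \<le> pi * real n" using n pi_gt3 by (intro mult_mono) auto
  then have X: "3 \<le> X" by (simp add: X_def)
  define x where "x = exp (- X * s)"
  define y where "y = exp (- X / s)"
  define q where "q = exp (- X)"
  interpret nome_pair x y q unfolding x_def y_def q_def by (rule nome_pair_exp[OF X s])
  have J: "janssen n s u v = (\<Sum>\<^sub>\<infinity>(k, l). janssen_sign n k l * cos (of_int k * (2 * pi * u)) * cos (of_int l * (2 * pi * v)) * gauss_weight x y (k, l))" for u v
    by (simp add: janssen_def x_def y_def X_def)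
  have J1: "janssen n 1 u v = (\<Sum>\<^sub>\<infinity>(k, l). janssen_sign n k l * cos (of_int k * (2 * pi * u)) * cos (of_int l * (2 * pi * v)) * gauss_weight q q (k, l))" for u v
    by (simp add: janssen_def q_def X_def)
  have "janssen n 1 0 0 \<le> janssen n s 0 0 \<and> janssen n s (1/2) (1/2) \<le> janssen n 1 (1/2) (1/2)"
  proof (cases "y \<le> 1/8")
    case True
    define c where "c = (\<lambda>(k, l). janssen_sign n k l)"
    define d where "d = (\<lambda>(k, l). janssen_sign n k l * cos (of_int k * pi) * cos (of_int l * pi))"
    have e: "janssen n s 0 0 = (\<Sum>\<^sub>\<infinity>p. c p * gauss_weight x y p)"
      "janssen n 1 0 0 = (\<Sum>\<^sub>\<infinity>p. c p * gauss_weight q q p)"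
      "janssen n s (1/2) (1/2) = (\<Sum>\<^sub>\<infinity>p. d p * gauss_weight x y p)"
      "janssen n 1 (1/2) (1/2) = (\<Sum>\<^sub>\<infinity>p. d p * gauss_weight q q p)"
      unfolding J J1 by (rule infsum_cong; auto simp: c_def d_def)+
    have oe: "odd e" if "\<bar>e\<bar> = 1" for e :: int using that by presburger
    have "1 * janssen n 1 0 0 \<le> 1 * janssen n s 0 0"
      unfolding e by (rule signed_sum_compare[OF True])
        (auto simp: c_def abs_janssen_sign janssen_sign_commute, auto simp: janssen_sign_def)
    moreover have "(-1) * janssen n 1 (1/2) (1/2) \<le> (-1) * janssen n s (1/2) (1/2)"
      unfolding e by (rule signed_sum_compare[OF True])
        (auto simp: d_def abs_mult abs_janssen_sign cos_int_pi janssen_sign_commute dest: oe,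
         auto simp: janssen_sign_def dest: oe)
    ultimately show ?thesis by simp
  next
    case False
    have n1: "1 \<le> n" and s0: "0 < s" using n s by auto
    define t where "t = n / (2 * s)"
    have t: "0 < t" using n1 s0 by (simp add: t_def)
    have yt: "exp (- (pi * t)) = y" by (simp add: y_def X_def t_def field_simps)
    have x: "0 \<le> x" "x \<le> 1/20" using x_le q_le x_pos by auto
    note it0 = janssen_iterated[OF n1 s0, of 0 0, folded X_def x_def t_def, simplified]
    \<comment> \<open>The terms l = -1, 0, 1 alone give 1 + 2y > 1.25.\<close>
    have "125/100 \<le> gauss_theta t 0"
    proof -
      have "(\<Sum>l\<in>{-1,0,1::int}. exp (- (pi * t) * (of_int l)\<^sup>2) * cos (2 * pi * of_int l * 0)) \<le> gauss_theta t 0"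
        unfolding gauss_theta_def by (rule finite_sum_le_infsum[OF summable_gauss_theta[OF t]]) auto
      then show ?thesis using False by (simp add: yt)
    qed
    also have "gauss_theta t 0 \<le> janssen n s 0 0"
    proof -
      have "(\<Sum>k\<in>{0::int}. x ^ nat (k\<^sup>2) * gauss_theta t (real n * of_int k / 2)) \<le> janssen n s 0 0"
        unfolding it0(2) by (rule finite_sum_le_infsum) (use it0(1) x gauss_theta_nonneg[OF t] in auto)
      then show ?thesis by simp
    qed
    finally have b: "125/100 \<le> janssen n s 0 0" .
    note ith = janssen_iterated[OF n1 s0, of "1/2" "1/2", folded X_def x_def t_def, simplified]
    have th: "gauss_theta t (1/2) \<le> 751/1000" using False t by (intro gauss_theta_half_le) (auto simp: yt)
    have sh: "(\<lambda>k::int. (1/2::real) ^ nat (k\<^sup>2)) summable_on A" for A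
      by (rule summable_on_subset[OF summable_on_int_square_power]) auto
    \<comment> \<open>At (1/2, 1/2) the odd k contribute at most 0. An even k shifts the theta
      argument by an integer, and for k other than 0 the weight x^(k^2) <= (1/20)^(k^2) is at most
      10^(-4) 2^(-k^2).\<close>
    define g where "g k = (if k = 0 then gauss_theta t (1/2) else 0) + (1/10000) * (1/2::real) ^ nat (k\<^sup>2)" for k :: int
    have "janssen n s (1/2) (1/2) \<le> infsum g UNIV"
      unfolding ith(2)
    proof (rule infsum_mono[OF ith(1)])
      have "(\<lambda>k::int. if k = 0 then gauss_theta t (1/2) else 0) summable_on UNIV"
        by (rule has_sum_imp_summable[OF has_sum_finite_neutralI[of "{0}"]]) auto
      then show "g summable_on UNIV" unfolding g_def by (intro summable_on_add summable_on_cmult_right sh)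
      fix k :: int
      have nn: "0 \<le> gauss_theta t v" for v by (rule gauss_theta_nonneg[OF t])
      show "x ^ nat (k\<^sup>2) * cos (of_int k * pi) * gauss_theta t (1/2 + real n * of_int k / 2) \<le> g k"
      proof (cases "even k")
        case False
        then have "x ^ nat (k\<^sup>2) * cos (of_int k * pi) * gauss_theta t (1/2 + real n * of_int k / 2) \<le> 0"
          using x nn by (simp add: cos_int_pi)
        also have "0 \<le> g k" using nn[of "1/2"] by (simp add: g_def)
        finally show ?thesis .
      next
        case True
        then obtain j where j: "k = 2 * j" by (elim evenE)
        have "gauss_theta t (1/2 + real n * of_int k / 2) = gauss_theta t (1/2)"
        proof -
          have "cos (2 * pi * of_int l * (1/2 + real n * of_int k / 2)) = cos (2 * pi * of_int l * (1/2))" for l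
          proof -
            have "2 * pi * of_int l * (1/2 + real n * of_int k / 2) = 2 * pi * of_int l * (1/2) + 2 * pi * of_int (l * int n * j)"
              by (simp add: j algebra_simps)
            then show ?thesis by (simp only: cos_add cos_int_2pin sin_int_2pin)
          qed
          then show ?thesis unfolding gauss_theta_def by (simp only:)
        qed
        then have eq: "x ^ nat (k\<^sup>2) * cos (of_int k * pi) * gauss_theta t (1/2 + real n * of_int k / 2) = x ^ nat (k\<^sup>2) * gauss_theta t (1/2)"
          using True by (simp add: cos_int_pi)
        show ?thesis
        proof (cases "k = 0")
          case True
          then show ?thesis unfolding eq by (simp add: g_def)
        next
          case False
          then have "2 \<le> \<bar>k\<bar>" using j by auto
          from power_mono[OF this, of 2] have "4 \<le> k\<^sup>2" by simp
          then have k: "4 \<le> nat (k\<^sup>2)" by linarith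
          have "x ^ nat (k\<^sup>2) * gauss_theta t (1/2) \<le> (1/20) ^ nat (k\<^sup>2) * 1"
            using x th nn by (intro mult_mono power_mono) auto
          also have "\<dots> = (1/10) ^ nat (k\<^sup>2) * (1/2) ^ nat (k\<^sup>2)" by (simp flip: power_mult_distrib)
          also have "\<dots> \<le> (1/10) ^ 4 * (1/2) ^ nat (k\<^sup>2)" using k by (intro mult_right_mono power_decreasing) auto
          finally show ?thesis unfolding eq using False by (simp add: g_def power4_eq_xxxx)
        qed
      qed
    qed
    also have "infsum g UNIV = gauss_theta t (1/2) + (1/10000) * (\<Sum>\<^sub>\<infinity>k::int. (1/2::real) ^ nat (k\<^sup>2))"
    proof (rule infsumI)
      have "((\<lambda>k::int. if k = 0 then gauss_theta t (1/2) else 0) has_sum gauss_theta t (1/2)) UNIV"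
        by (rule has_sum_finite_neutralI[of "{0}"]) auto
      then show "(g has_sum gauss_theta t (1/2) + (1/10000) * (\<Sum>\<^sub>\<infinity>k::int. (1/2::real) ^ nat (k\<^sup>2))) UNIV"
        unfolding g_def by (intro has_sum_add has_sum_cmult_right has_sum_infsum sh)
    qed
    also have "\<dots> \<le> 78/100" using th infsum_half_square_le by linarith
    finally show ?thesis using b janssen_square_numeric[OF n] by linarith
  qed
  then show "janssen n 1 0 0 \<le> janssen n s 0 0" "janssen n s (1/2) (1/2) \<le> janssen n 1 (1/2) (1/2)" by auto
qed

text \<open>After Poisson summation in l the exponent splits: k^2/2 + 2(j + w + k/2)^2 = (j + k +
  w)^2 + (j + w)^2. With p = j + k and the character relation e(k) = e(j + k) e(j), the double
  series becomes the square of a single one.\<close>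

lemma janssen_one:
  assumes s: "0 < s" and w: "w \<in> {0, 1/2}"
  shows "janssen 1 s w w = sqrt (2 * s) * (\<Sum>\<^sub>\<infinity>p::int. cos (of_int p * (2 * pi * w)) * exp (- (pi * s) * (of_int p + w)\<^sup>2))\<^sup>2"
proof -
  define g where "g p = exp (- (pi * s) * (of_int p + w)\<^sup>2)" for p :: int
  define e where "e p = cos (of_int p * (2 * pi * w))" for p :: int
  have ps: "0 < pi * s" using s by simp
  have gs: "g summable_on UNIV" unfolding g_def by (rule summable_shifted_gaussian[OF ps])
  have e1: "\<bar>e p\<bar> \<le> 1" for p by (simp add: e_def)
  have e: "e p = (if w = 0 \<or> even p then 1 else -1)" for p
  proof (cases "w = 0")
    case False
    then have "w = 1/2" using w by simp
    then have "e p = cos (of_int p * pi)" unfolding e_def by (simp only:) simp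
    then show ?thesis using False by (simp add: cos_int_pi)
  qed (simp add: e_def)
  have e_diff: "e k = e (j + k) * e j" for k j by (auto simp: e)
  have s2: "(\<lambda>(p, j). g p * g j) summable_on UNIV"
    using has_sum_prod_nonneg[OF has_sum_infsum[OF gs] has_sum_infsum[OF gs]]
    by (auto simp: g_def summable_on_def)
  define F where "F = (\<lambda>(p, j). (e p * g p) * (e j * g j))"
  have Fs: "F summable_on UNIV \<times> UNIV"
  proof (rule Infinite_Sum.abs_summable_summable, rule Infinite_Sum.abs_summable_on_comparison_test')
    show "(\<lambda>(p, j). g p * g j) summable_on UNIV \<times> UNIV" using s2 by simp
    have "\<bar>e p * e j\<bar> * (g p * g j) \<le> 1 * (g p * g j)" for p j
      using e1 by (intro mult_right_mono) (auto simp: abs_mult g_def intro!: mult_le_one)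
    then show "norm (F x) \<le> (case x of (p, j) \<Rightarrow> g p * g j)" for x
      by (cases x) (simp add: F_def abs_mult g_def mult_ac)
  qed
  have Fsum: "infsum F UNIV = (\<Sum>\<^sub>\<infinity>p. e p * g p)\<^sup>2"
  proof -
    have "infsum F (UNIV \<times> UNIV) = (\<Sum>\<^sub>\<infinity>p. \<Sum>\<^sub>\<infinity>j. F (p, j))"
      by (rule infsum_Sigma_banach[OF Fs, symmetric])
    also have "\<dots> = (\<Sum>\<^sub>\<infinity>p. (e p * g p) * (\<Sum>\<^sub>\<infinity>j. e j * g j))"
      by (simp add: F_def infsum_cmult_right')
    also have "\<dots> = (\<Sum>\<^sub>\<infinity>p. e p * g p) * (\<Sum>\<^sub>\<infinity>j. e j * g j)" by (rule infsum_cmult_left')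
    finally show ?thesis by (simp add: power2_eq_square)
  qed
  define H where "H = (\<lambda>(k, j). F (j + k, j))"
  \<comment> \<open>This shear decouples the two summation variables.\<close>
  have bij: "bij_betw (\<lambda>(k, j). (j + k, j)) (UNIV \<times> UNIV :: (int \<times> int) set) (UNIV \<times> UNIV)"
    by (rule bij_betwI[of _ _ _ "\<lambda>(p, j). (p - j, j)"]) auto
  have Hs: "H summable_on UNIV \<times> UNIV"
    using summable_on_reindex_bij_betw[OF bij, of F] Fs by (simp add: H_def case_prod_unfold)
  have Hsum: "infsum H (UNIV \<times> UNIV) = infsum F (UNIV \<times> UNIV)"
    using infsum_reindex_bij_betw[OF bij, of F] by (simp add: H_def case_prod_unfold)
  have "janssen 1 s w w = (\<Sum>\<^sub>\<infinity>k::int. exp (- (pi * 1 / 2) * s) ^ nat (k\<^sup>2) * e k * gauss_theta (1 / (2 * s)) (w + of_int k / 2))"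
    using janssen_iterated(2)[OF _ s, of 1 w w] by (simp add: e_def)
  also have "\<dots> = (\<Sum>\<^sub>\<infinity>k. sqrt (2 * s) * (\<Sum>\<^sub>\<infinity>j. H (k, j)))"
  proof (rule infsum_cong)
    fix k :: int
    have "gauss_theta (1 / (2 * s)) (w + of_int k / 2) = sqrt (2 * s) * (\<Sum>\<^sub>\<infinity>j::int. exp (- (2 * pi * s) * (of_int j + (w + of_int k / 2))\<^sup>2))"
      using s by (simp add: gauss_theta_Poisson real_sqrt_divide mult_ac)
    moreover have "exp (- (pi * 1 / 2) * s) ^ nat (k\<^sup>2) * exp (- (2 * pi * s) * (of_int j + (w + of_int k / 2))\<^sup>2) = g (j + k) * g j" for j
    proof -
      have "- (pi * 1 / 2 * s) * (of_int k)\<^sup>2 + - (2 * pi * s) * (of_int j + (w + of_int k / 2))\<^sup>2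
          = - (pi * s) * (of_int (j + k) + w)\<^sup>2 + - (pi * s) * (of_int j + w)\<^sup>2"
        by (simp add: power2_eq_square field_simps)
      then have "exp (- (pi * 1 / 2 * s) * (of_int k)\<^sup>2) * exp (- (2 * pi * s) * (of_int j + (w + of_int k / 2))\<^sup>2) = g (j + k) * g j"
        unfolding g_def exp_add[symmetric] by (simp only:)
      then show ?thesis unfolding exp_int_square by simp
    qed
    then have "exp (- (pi * 1 / 2) * s) ^ nat (k\<^sup>2) * e k * exp (- (2 * pi * s) * (of_int j + (w + of_int k / 2))\<^sup>2) = H (k, j)" for j
      using e_diff[of k j] by (simp add: H_def F_def mult_ac)
    then have "(\<Sum>\<^sub>\<infinity>j. H (k, j)) = exp (- (pi * 1 / 2) * s) ^ nat (k\<^sup>2) * e k * (\<Sum>\<^sub>\<infinity>j::int. exp (- (2 * pi * s) * (of_int j + (w + of_int k / 2))\<^sup>2))"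
      by (simp only: infsum_cmult_right'[symmetric])
    ultimately show "exp (- (pi * 1 / 2) * s) ^ nat (k\<^sup>2) * e k * gauss_theta (1 / (2 * s)) (w + of_int k / 2) = sqrt (2 * s) * (\<Sum>\<^sub>\<infinity>j. H (k, j))"
      by simp
  qed
  also have "\<dots> = sqrt (2 * s) * (\<Sum>\<^sub>\<infinity>k. \<Sum>\<^sub>\<infinity>j. H (k, j))" by (rule infsum_cmult_right')
  also have "(\<Sum>\<^sub>\<infinity>k. \<Sum>\<^sub>\<infinity>j. H (k, j)) = infsum H (UNIV \<times> UNIV)" by (rule infsum_Sigma_banach[OF Hs])
  also have "\<dots> = (\<Sum>\<^sub>\<infinity>p. e p * g p)\<^sup>2" unfolding Hsum using Fsum by simp
  finally show ?thesis by (simp only: e_def g_def)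
qed

text \<open>The reflection p -> -1 - p preserves (p + 1/2)^2 and reverses the sign (-1)^p, so the
  sum equals its own negative. This is the zero of the Zak transform of the Gaussian at critical
  density.\<close>

lemma janssen_one_half:
  assumes s: "0 < s" shows "janssen 1 s (1/2) (1/2) = 0"
proof -
  define f where "f p = cos (of_int p * pi) * exp (- (pi * s) * (of_int p + 1/2)\<^sup>2)" for p :: int
  have "infsum f UNIV = infsum (\<lambda>p. - f p) UNIV"
  proof (rule infsum_reindex_bij_witness[of _ "\<lambda>p. - 1 - p" "\<lambda>p. - 1 - p"])
    fix p :: int
    have "(of_int (- 1 - p) + 1/2)\<^sup>2 = (real_of_int p + 1/2)\<^sup>2" by (simp add: power2_eq_square algebra_simps)
    moreover have "cos (of_int (- 1 - p) * pi) = - cos (of_int p * pi)" unfolding cos_int_pi by simp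
    ultimately have "f (- 1 - p) = - f p" unfolding f_def by (simp only: mult_minus_left)
    then show "- f (- 1 - p) = f p" by linarith
  qed auto
  also have "\<dots> = - infsum f UNIV" by (rule infsum_uminus)
  finally have "infsum f UNIV = 0" by linarith
  then show ?thesis using janssen_one[OF s, of "1/2"] by (simp add: f_def [abs_def])
qed

text \<open>For n = 2 the shift nk/2 is an integer, so the theta factor does not depend on k; its
  Poisson dual is the same series as the remaining sum over k.\<close>

lemma janssen_two:
  assumes s: "0 < s"
  shows "janssen 2 s 0 0 = sqrt s * (\<Sum>\<^sub>\<infinity>p::int. exp (- (pi * s) * (of_int p)\<^sup>2))\<^sup>2"
proof -
  have th: "gauss_theta (1 / s) (of_int k) = sqrt s * (\<Sum>\<^sub>\<infinity>p::int. exp (- (pi * s) * (of_int p)\<^sup>2))" for k :: int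
    using s infsum_shifted_gaussian_int[of "pi * s" 0 k] by (simp add: gauss_theta_Poisson real_sqrt_divide)
  have "janssen 2 s 0 0 = (\<Sum>\<^sub>\<infinity>k::int. exp (- (pi * s) * (of_int k)\<^sup>2) * gauss_theta (1 / s) (of_int k))"
    using janssen_iterated(2)[OF _ s, of 2 0 0] unfolding exp_int_square by simp
  then show ?thesis unfolding th by (simp add: infsum_cmult_left' power2_eq_square)
qed

lemma janssen_one_eq_two:
  assumes s: "0 < s" shows "janssen 1 s 0 0 = sqrt 2 * janssen 2 s 0 0"
  using janssen_one[OF s, of 0] janssen_two[OF s] by (simp add: real_sqrt_mult)

lemma janssen_monotone_ge2:
  assumes n: "2 \<le> n" and s: "0 < s"
  shows "janssen n 1 0 0 \<le> janssen n s 0 0" "janssen n s (1/2) (1/2) \<le> janssen n 1 (1/2) (1/2)"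
  using janssen_monotone_ge1[OF n, of s] janssen_monotone_ge1[OF n, of "1 / s"] s
  by (cases "1 \<le> s"; simp add: janssen_swap)+

lemma janssen_monotone:
  assumes n: "1 \<le> n" and s: "0 < s"
  shows "janssen n 1 0 0 \<le> janssen n s 0 0" "janssen n s (1/2) (1/2) \<le> janssen n 1 (1/2) (1/2)"
proof -
  consider "n = 1" | "2 \<le> n" using n by linarith
  then have "janssen n 1 0 0 \<le> janssen n s 0 0 \<and> janssen n s (1/2) (1/2) \<le> janssen n 1 (1/2) (1/2)"
  proof cases
    case 1
    have "janssen 2 1 0 0 \<le> janssen 2 s 0 0" by (rule janssen_monotone_ge2(1)[OF _ s]) simp
    then show ?thesis
      unfolding 1 janssen_one_eq_two[OF s] janssen_one_eq_two[OF zero_less_one]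
        janssen_one_half[OF s] janssen_one_half[OF zero_less_one] by simp
  next
    case 2
    then show ?thesis using janssen_monotone_ge2[OF 2 s] by simp
  qed
  then show "janssen n 1 0 0 \<le> janssen n s 0 0" "janssen n s (1/2) (1/2) \<le> janssen n 1 (1/2) (1/2)" by auto
qed

section \<open>Toeplitz forms\<close>

lemma integral_trig_square_mult:
  fixes S :: "real \<Rightarrow> complex" and a :: "int \<Rightarrow> complex"
  assumes S: "continuous_on {0..1} S" and I: "finite I"
  shows "integral {0..1} (\<lambda>\<xi>. (\<Sum>m\<in>I. a m * fchar m \<xi>) * cnj (\<Sum>m\<in>I. a m * fchar m \<xi>) * S \<xi>)
     = (\<Sum>m\<in>I. \<Sum>m'\<in>I. a m * cnj (a m') * fcoeff S (m' - m))"
proof -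
  have "(\<Sum>m\<in>I. a m * fchar m \<xi>) * cnj (\<Sum>m\<in>I. a m * fchar m \<xi>) * S \<xi>
      = (\<Sum>m\<in>I. \<Sum>m'\<in>I. (a m * cnj (a m')) * (S \<xi> * fchar (- (m' - m)) \<xi>))" for \<xi>
  proof -
    have "fchar (- (m' - m)) \<xi> = fchar m \<xi> * fchar (- m') \<xi>" for m m'
      unfolding fchar_add[symmetric] by simp
    then show ?thesis by (simp add: fchar_cnj sum_distrib_left sum_distrib_right mult_ac) (rule sum.swap)
  qed
  then have "integral {0..1} (\<lambda>\<xi>. (\<Sum>m\<in>I. a m * fchar m \<xi>) * cnj (\<Sum>m\<in>I. a m * fchar m \<xi>) * S \<xi>)
      = integral {0..1} (\<lambda>\<xi>. \<Sum>m\<in>I. \<Sum>m'\<in>I. (a m * cnj (a m')) * (S \<xi> * fchar (- (m' - m)) \<xi>))" by (simp only:)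
  also have "\<dots> = (\<Sum>m\<in>I. integral {0..1} (\<lambda>\<xi>. \<Sum>m'\<in>I. (a m * cnj (a m')) * (S \<xi> * fchar (- (m' - m)) \<xi>)))"
    by (rule integral_sum[OF I]) (intro integrable_continuous_real continuous_intros S)
  also have "\<dots> = (\<Sum>m\<in>I. \<Sum>m'\<in>I. integral {0..1} (\<lambda>\<xi>. (a m * cnj (a m')) * (S \<xi> * fchar (- (m' - m)) \<xi>)))"
    by (intro sum.cong refl integral_sum[OF I] integrable_continuous_real continuous_intros S)
  finally show ?thesis by (simp add: fcoeff_def)
qed

text \<open>The form equals the integral of |A|^2 F, where A is the trigonometric polynomial with
  coefficients a and F the symbol, real because \<kappa> is real and even; the integral of |A|^2 is
  the sum of the squares.\<close>

lemma toeplitz_bounds: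
  fixes \<kappa> :: "int \<Rightarrow> real" and a :: "int \<Rightarrow> complex"
  assumes M: "M summable_on UNIV" "\<And>d. \<bar>\<kappa> d\<bar> \<le> M d" and even: "\<And>d. \<kappa> (- d) = \<kappa> d" and I: "finite I"
    and lo: "\<And>\<xi>. lo \<le> (\<Sum>\<^sub>\<infinity>d. \<kappa> d * cos (2 * pi * of_int d * \<xi>))"
    and hi: "\<And>\<xi>. (\<Sum>\<^sub>\<infinity>d. \<kappa> d * cos (2 * pi * of_int d * \<xi>)) \<le> hi"
  defines "Q \<equiv> \<Sum>m\<in>I. \<Sum>m'\<in>I. a m * cnj (a m') * complex_of_real (\<kappa> (m - m'))"
  shows "Q = complex_of_real (Re Q)" "lo * (\<Sum>m\<in>I. (cmod (a m))\<^sup>2) \<le> Re Q" "Re Q \<le> hi * (\<Sum>m\<in>I. (cmod (a m))\<^sup>2)"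
proof -
  define S where "S \<xi> = (\<Sum>\<^sub>\<infinity>d. complex_of_real (\<kappa> d) * fchar d \<xi>)" for \<xi>
  define F where "F \<xi> = (\<Sum>\<^sub>\<infinity>d. \<kappa> d * cos (2 * pi * of_int d * \<xi>))" for \<xi>
  define A where "A \<xi> = (\<Sum>m\<in>I. a m * fchar m \<xi>)" for \<xi>
  have M': "cmod (complex_of_real (\<kappa> d)) \<le> M d" for d using M(2) by simp
  have sm: "(\<lambda>d. complex_of_real (\<kappa> d) * fchar d \<xi>) summable_on UNIV" for \<xi>
    by (rule Infinite_Sum.abs_summable_summable, rule Infinite_Sum.abs_summable_on_comparison_test'[OF M(1)])
       (simp add: norm_mult fchar_norm M(2))
  have cS: "continuous_on {0..1} S" unfolding S_def by (rule fcoeff_fchar_series(1)[OF M(1) M'])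
  have fS: "fcoeff S l = complex_of_real (\<kappa> l)" for l unfolding S_def by (rule fcoeff_fchar_series(2)[OF M(1) M'])
  have SF: "S \<xi> = complex_of_real (F \<xi>)" for \<xi>
  proof (rule complex_eqI)
    show "Re (S \<xi>) = Re (complex_of_real (F \<xi>))"
      unfolding S_def infsum_Re[OF sm, symmetric] by (simp add: F_def fchar_def)
    have "S \<xi> = cnj (S \<xi>)"
    proof -
      have "cnj (S \<xi>) = (\<Sum>\<^sub>\<infinity>d. cnj (complex_of_real (\<kappa> d) * fchar d \<xi>))" unfolding S_def by (rule infsum_cnj[symmetric])
      also have "\<dots> = S \<xi>" unfolding S_def
        by (rule infsum_reindex_bij_witness[of _ uminus uminus]) (auto simp: fchar_cnj even)
      finally show ?thesis by simp
    qed
    then have "Im (S \<xi>) = - Im (S \<xi>)" by (metis cnj.simps(2))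
    then show "Im (S \<xi>) = Im (complex_of_real (F \<xi>))" by simp
  qed
  have cF: "continuous_on {0..1} F"
    using continuous_on_Re[OF cS] by (simp add: SF)
  have cA: "continuous_on {0..1} A" unfolding A_def by (intro continuous_intros)
  have re: "complex_of_real (integral {0..1} h) = integral {0..1} (\<lambda>\<xi>. complex_of_real (h \<xi>))" if "continuous_on {0..1} h" for h :: "real \<Rightarrow> real"
    by (rule integral_unique[OF has_integral_of_real[OF integrable_integral[OF integrable_continuous_real[OF that]]], symmetric])
  have "complex_of_real (integral {0..1} (\<lambda>\<xi>. (cmod (A \<xi>))\<^sup>2 * F \<xi>)) = integral {0..1} (\<lambda>\<xi>. A \<xi> * cnj (A \<xi>) * S \<xi>)"
    by (subst re) (auto intro!: continuous_intros cA cF simp: SF complex_norm_square simp del: of_real_power)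
  also have "\<dots> = (\<Sum>m\<in>I. \<Sum>m'\<in>I. a m * cnj (a m') * fcoeff S (m' - m))"
    unfolding A_def by (rule integral_trig_square_mult[OF cS I])
  also have "\<dots> = Q" unfolding Q_def fS using even[of "_ - _"] by (intro sum.cong refl) (metis minus_diff_eq)
  finally have Q: "Q = complex_of_real (integral {0..1} (\<lambda>\<xi>. (cmod (A \<xi>))\<^sup>2 * F \<xi>))" ..
  then show "Q = complex_of_real (Re Q)" by simp
  have "complex_of_real (integral {0..1} (\<lambda>\<xi>. (cmod (A \<xi>))\<^sup>2)) = integral {0..1} (\<lambda>\<xi>. A \<xi> * cnj (A \<xi>) * 1)"
    by (subst re) (auto intro!: continuous_intros cA simp: complex_norm_square simp del: of_real_power)
  also have "\<dots> = (\<Sum>m\<in>I. \<Sum>m'\<in>I. a m * cnj (a m') * fcoeff (\<lambda>_. 1) (m' - m))"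
    unfolding A_def by (rule integral_trig_square_mult[OF _ I]) (intro continuous_intros)
  also have "\<dots> = (\<Sum>m\<in>I. \<Sum>m'\<in>I. if m' = m then a m * cnj (a m') else 0)"
    by (intro sum.cong refl) (simp add: fcoeff_def integral_fchar)
  also have "\<dots> = complex_of_real (\<Sum>m\<in>I. (cmod (a m))\<^sup>2)"
    using I by (simp add: complex_norm_square del: of_real_power)
  finally have N: "integral {0..1} (\<lambda>\<xi>. (cmod (A \<xi>))\<^sup>2) = (\<Sum>m\<in>I. (cmod (a m))\<^sup>2)" by (simp only: of_real_eq_iff)
  have i1: "(\<lambda>\<xi>. (cmod (A \<xi>))\<^sup>2 * F \<xi>) integrable_on {0..1}"
    by (intro integrable_continuous_real continuous_intros cA cF)
  have i2: "(\<lambda>\<xi>. (cmod (A \<xi>))\<^sup>2 * c) integrable_on {0..1}" for c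
    by (intro integrable_continuous_real continuous_intros cA)
  have "integral {0..1} (\<lambda>\<xi>. (cmod (A \<xi>))\<^sup>2 * lo) \<le> integral {0..1} (\<lambda>\<xi>. (cmod (A \<xi>))\<^sup>2 * F \<xi>)"
    by (rule integral_le[OF i2 i1]) (simp add: F_def lo mult_left_mono)
  then show "lo * (\<Sum>m\<in>I. (cmod (a m))\<^sup>2) \<le> Re Q" by (simp add: Q N mult.commute)
  have "integral {0..1} (\<lambda>\<xi>. (cmod (A \<xi>))\<^sup>2 * F \<xi>) \<le> integral {0..1} (\<lambda>\<xi>. (cmod (A \<xi>))\<^sup>2 * hi)"
    by (rule integral_le[OF i1 i2]) (simp add: F_def hi mult_left_mono)
  then show "Re Q \<le> hi * (\<Sum>m\<in>I. (cmod (a m))\<^sup>2)" by (simp add: Q N mult.commute)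
qed

lemma sum_int_geometric_tail:
  fixes r :: real assumes r: "0 \<le> r" "r < 1"
  shows "(1 + r) / (1 - r) - (\<Sum>d\<in>{- int M..int M}. r ^ nat \<bar>d\<bar>) = 2 * r ^ Suc M / (1 - r)"
proof (induction M)
  case 0
  then show ?case using r by (simp add: field_simps)
next
  case (Suc M)
  have "{- int (Suc M)..int (Suc M)} = insert (- int (Suc M)) (insert (int (Suc M)) {- int M..int M})" by auto
  then have "(\<Sum>d\<in>{- int (Suc M)..int (Suc M)}. r ^ nat \<bar>d\<bar>) = 2 * r ^ Suc M + (\<Sum>d\<in>{- int M..int M}. r ^ nat \<bar>d\<bar>)"
    by (simp add: nat_add_distrib del: of_nat_Suc)
  then have "(1 + r) / (1 - r) - (\<Sum>d\<in>{- int (Suc M)..int (Suc M)}. r ^ nat \<bar>d\<bar>) = 2 * r ^ Suc M / (1 - r) - 2 * r ^ Suc M"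
    using Suc by simp
  also have "\<dots> = 2 * r ^ Suc (Suc M) / (1 - r)" using r by (simp add: field_simps)
  finally show ?case .
qed

text \<open>The form evaluated at the vector of M ones. It is M times the symbol at frequency 0 up
  to an error bounded independently of M, so the quotient by M converges to the symbol.\<close>

lemma toeplitz_square_sum:
  fixes \<kappa> :: "int \<Rightarrow> real"
  assumes r: "0 \<le> r" "r < 1" and \<kappa>: "\<And>d. \<bar>\<kappa> d\<bar> \<le> C * r ^ nat \<bar>d\<bar>"
  shows "\<bar>(\<Sum>m<M. \<Sum>m'<M. \<kappa> (int m - int m')) - real M * infsum \<kappa> UNIV\<bar> \<le> 2 * C / (1 - r)\<^sup>2"
proof -
  have C: "0 \<le> C" using \<kappa>[of 0] by simp
  have gs: "((\<lambda>d. C * r ^ nat \<bar>d\<bar>) has_sum (C * ((1 + r) / (1 - r)))) UNIV"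
    by (rule has_sum_cmult_right[OF has_sum_int_geometric[OF r]])
  have ks: "\<kappa> summable_on UNIV"
    by (rule Infinite_Sum.abs_summable_summable, rule Infinite_Sum.abs_summable_on_comparison_test'[OF has_sum_imp_summable[OF gs]]) (simp add: \<kappa>)
  have tail: "\<bar>infsum \<kappa> UNIV - (\<Sum>d\<in>{- int M..int M}. \<kappa> d)\<bar> \<le> C * (2 * r ^ Suc M / (1 - r))" for M
  proof -
    let ?D = "{- int M..int M}"
    have 1: "(\<kappa> has_sum (infsum \<kappa> UNIV - sum \<kappa> ?D)) (UNIV - ?D)"
      by (rule has_sum_Diff[OF has_sum_infsum[OF ks] has_sum_finite]) auto
    have 2: "((\<lambda>d. C * r ^ nat \<bar>d\<bar>) has_sum (C * ((1 + r) / (1 - r)) - (\<Sum>d\<in>?D. C * r ^ nat \<bar>d\<bar>))) (UNIV - ?D)"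
      by (rule has_sum_Diff[OF gs has_sum_finite]) auto
    have "norm (infsum \<kappa> UNIV - sum \<kappa> ?D) \<le> C * ((1 + r) / (1 - r)) - (\<Sum>d\<in>?D. C * r ^ nat \<bar>d\<bar>)"
      by (rule norm_infsum_le[OF 1 2]) (simp add: \<kappa>)
    also have "\<dots> = C * ((1 + r) / (1 - r) - (\<Sum>d\<in>?D. r ^ nat \<bar>d\<bar>))" by (simp add: sum_distrib_left right_diff_distrib)
    finally show ?thesis unfolding sum_int_geometric_tail[OF r] by simp
  qed
  have "\<bar>(\<Sum>m<M. \<Sum>m'<M. \<kappa> (int m - int m')) - real M * infsum \<kappa> UNIV\<bar> \<le> (\<Sum>j<M. C * (2 * r ^ Suc j / (1 - r)))"
  proof (induction M)
    case (Suc M)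
    \<comment> \<open>The new row, column and diagonal entry run through every lag from -M to M
      exactly once. The deficit from the full sum decays like r^(M+1) and is therefore summable in
      M.\<close>
    have step: "(\<Sum>m<Suc M. \<Sum>m'<Suc M. \<kappa> (int m - int m'))
        = (\<Sum>m<M. \<Sum>m'<M. \<kappa> (int m - int m')) + (\<Sum>d\<in>{- int M..int M}. \<kappa> d)"
    proof -
      have "(\<Sum>d\<in>{- int M..int M}. \<kappa> d) = (\<Sum>m<M. \<kappa> (int m - int M)) + \<kappa> 0 + (\<Sum>m<M. \<kappa> (int M - int m))"
      proof -
        have D: "{- int M..int M} = {- int M..<0} \<union> {0} \<union> {0<..int M}" by auto
        have "sum \<kappa> {- int M..int M} = sum \<kappa> {- int M..<0} + \<kappa> 0 + sum \<kappa> {0<..int M}"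
          unfolding D by (subst sum.union_disjoint; (subst sum.union_disjoint)?) auto
        moreover have "sum \<kappa> {- int M..<0} = (\<Sum>m<M. \<kappa> (int m - int M))"
          by (rule sum.reindex_bij_witness[of _ "\<lambda>m. int m - int M" "\<lambda>d. nat (d + int M)"]) auto
        moreover have "sum \<kappa> {0<..int M} = (\<Sum>m<M. \<kappa> (int M - int m))"
          by (rule sum.reindex_bij_witness[of _ "\<lambda>m. int M - int m" "\<lambda>d. nat (int M - d)"]) auto
        ultimately show ?thesis by simp
      qed
      then show ?thesis by (simp add: sum.distrib)
    qed
    have "\<bar>(\<Sum>m<Suc M. \<Sum>m'<Suc M. \<kappa> (int m - int m')) - real (Suc M) * infsum \<kappa> UNIV\<bar>
        \<le> \<bar>(\<Sum>m<M. \<Sum>m'<M. \<kappa> (int m - int m')) - real M * infsum \<kappa> UNIV\<bar> + \<bar>infsum \<kappa> UNIV - (\<Sum>d\<in>{- int M..int M}. \<kappa> d)\<bar>"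
      unfolding step by (simp add: distrib_right)
    also have "\<dots> \<le> (\<Sum>j<M. C * (2 * r ^ Suc j / (1 - r))) + C * (2 * r ^ Suc M / (1 - r))"
      by (rule add_mono[OF Suc tail])
    finally show ?case by simp
  qed simp
  also have "(\<Sum>j<M. C * (2 * r ^ Suc j / (1 - r))) = (2 * C / (1 - r)) * (r * (\<Sum>j<M. r ^ j))"
    by (simp add: sum_distrib_left sum_divide_distrib mult_ac)
  also have "\<dots> \<le> (2 * C / (1 - r)) * (1 * (1 / (1 - r)))"
  proof (intro mult_left_mono mult_mono)
    have "(\<Sum>j<M. r ^ j) \<le> (\<Sum>j. r ^ j)" using r by (intro sum_le_suminf summable_geometric) auto
    then show "(\<Sum>j<M. r ^ j) \<le> 1 / (1 - r)" using r by (simp add: suminf_geometric)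
  qed (use r C in \<open>auto intro: sum_nonneg\<close>)
  finally show ?thesis by (simp add: power2_eq_square)
qed

section \<open>Frame sums of compactly supported functions\<close>

lemma nn_integral_count_space_has_sum:
  fixes f :: "'a \<Rightarrow> real"
  assumes f: "(f has_sum S) UNIV" and nn: "\<And>x. 0 \<le> f x"
  shows "(\<integral>\<^sup>+x. ennreal (f x) \<partial>count_space UNIV) = ennreal S"
proof -
  have "(\<lambda>x. norm (f x)) summable_on UNIV" using has_sum_imp_summable[OF f] nn by simp
  note a = abs_summable_equivalent[THEN iffD1, OF this]
  show ?thesis using nn_integral_conv_infsetsum[OF a] nn infsetsum_infsum[OF a] infsumI[OF f] by simp
qed

lemma has_sum_finite_sum:
  fixes f :: "'i \<Rightarrow> 'a \<Rightarrow> 'b::{topological_comm_monoid_add}"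
  assumes "\<And>i. i \<in> I \<Longrightarrow> (f i has_sum S i) A"
  shows "((\<lambda>x. \<Sum>i\<in>I. f i x) has_sum (\<Sum>i\<in>I. S i)) A"
  using assms by (induction I rule: infinite_finite_induct) (auto intro!: has_sum_add)

lemma nn_integral_Icc_continuous:
  fixes h :: "real \<Rightarrow> real"
  assumes h: "continuous_on {a..b} h" and nn: "\<And>v. v \<in> {a..b} \<Longrightarrow> 0 \<le> h v"
  shows "(\<integral>\<^sup>+v\<in>{a..b}. ennreal (h v) \<partial>lborel) = ennreal (integral {a..b} h)"
proof -
  have si: "set_integrable lborel {a..b} h" by (rule borel_integrable_atLeastAtMost'[OF h])
  have "(\<integral>\<^sup>+v\<in>{a..b}. ennreal (h v) \<partial>lborel) = (\<integral>\<^sup>+v. ennreal (indicator {a..b} v *\<^sub>R h v) \<partial>lborel)"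
    by (intro nn_integral_cong) (auto simp: indicator_def)
  also have "\<dots> = ennreal (LINT v:{a..b}|lborel. h v)"
    using si nn unfolding set_integrable_def set_lebesgue_integral_def
    by (intro nn_integral_eq_integral) (auto simp: indicator_def)
  also have "(LINT v:{a..b}|lborel. h v) = integral {a..b} h" by (rule set_borel_integral_eq_integral(2)[OF si])
  finally show ?thesis .
qed

lemma lborel_integral_compact_support:
  fixes g :: "real \<Rightarrow> 'a::euclidean_space"
  assumes g: "continuous_on UNIV g" and 0: "\<And>v. \<bar>v\<bar> \<ge> real N \<Longrightarrow> g v = 0"
  shows "integrable lborel g" "(LINT v|lborel. g v) = (\<Sum>k\<in>{- int N..<int N}. integral {0..1} (\<lambda>v. g (v + of_int k)))"
proof -
  have si: "set_integrable lborel {- real N..real N} g"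
    by (rule borel_integrable_atLeastAtMost') (rule continuous_on_subset[OF g], simp)
  have eq: "g v = indicator {- real N..real N} v *\<^sub>R g v" for v
    using 0[of v] by (cases "\<bar>v\<bar> \<ge> real N") (auto simp: indicator_def)
  have "(\<lambda>v. indicator {- real N..real N} v *\<^sub>R g v) = g" using eq by auto
  then show "integrable lborel g" using si by (simp add: set_integrable_def)
  have "(LINT v|lborel. g v) = (LINT v:{- real N..real N}|lborel. g v)"
    unfolding set_lebesgue_integral_def using eq by (intro Bochner_Integration.integral_cong) auto
  also have "\<dots> = integral {- real N..real N} g" by (rule set_borel_integral_eq_integral(2)[OF si])
  finally show "(LINT v|lborel. g v) = (\<Sum>k\<in>{- int N..<int N}. integral {0..1} (\<lambda>v. g (v + of_int k)))"
    by (simp only: sum_unit_integrals[OF g])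
qed

text \<open>Guarantees that a finite periodisation over the half-open window takes equal values at 0
  and 1, as the periodic Parseval identity demands.\<close>

lemma sum_shift_support:
  fixes h :: "real \<Rightarrow> complex"
  assumes "h (real N) = 0" "h (- real N) = 0"
  shows "(\<Sum>m\<in>{- int N..<int N}. h (1 + of_int m)) = (\<Sum>m\<in>{- int N..<int N}. h (of_int m))"
proof -
  have "(\<Sum>m\<in>{- int N..<int N}. h (1 + of_int m)) = (\<Sum>m\<in>{- int N<..int N}. h (of_int m))"
    by (rule sum.reindex_bij_witness[of _ "\<lambda>m. m - 1" "\<lambda>m. m + 1"]) (auto simp: add.commute)
  also have "\<dots> = (\<Sum>m\<in>{- int N..int N}. h (of_int m))"
    by (rule sum.mono_neutral_left) (auto simp: assms intro: arg_cong[where f = h])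
  also have "\<dots> = (\<Sum>m\<in>{- int N..<int N}. h (of_int m))"
    by (rule sum.mono_neutral_right) (auto simp: assms)
  finally show ?thesis .
qed

lemma gauss_theta_add_int: "gauss_theta y (v + of_int j) = gauss_theta y v"
proof -
  have "cos (2 * pi * of_int l * (v + of_int j)) = cos (2 * pi * of_int l * v)" for l :: int
  proof -
    have "2 * pi * of_int l * (v + of_int j) = 2 * pi * of_int l * v + 2 * pi * of_int (l * j)" by (simp add: algebra_simps)
    then show ?thesis by (simp only: cos_add cos_int_2pin sin_int_2pin)
  qed
  then show ?thesis by (simp only: gauss_theta_def)
qed

lemma gauss_theta_le: "0 < y \<Longrightarrow> gauss_theta y v \<le> gauss_theta y 0"
  unfolding gauss_theta_def by (intro infsum_mono summable_gauss_theta) auto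

text \<open>Up to the factor n/T, this is the correlation of two samples of the window d periods
  apart, summed over all translates; see \<open>has_sum_gam\<close>.\<close>

definition gabor_kernel :: "nat \<Rightarrow> real \<Rightarrow> int \<Rightarrow> real \<Rightarrow> real" where
  "gabor_kernel n s d v = exp (- (pi * n / 2) * s) ^ nat (d\<^sup>2) * gauss_theta (n / (2 * s)) (v + of_int (int n * d) / 2)"

lemma gabor_kernel_even: "gabor_kernel n s (- d) v = gabor_kernel n s d v"
proof -
  have "v + of_int (int n * d) / 2 = (v + of_int (int n * (- d)) / 2) + of_int (int n * d)" by simp
  then have "gauss_theta y (v + of_int (int n * d) / 2) = gauss_theta y (v + of_int (int n * (- d)) / 2)" for y
    by (simp only: gauss_theta_add_int)
  then show ?thesis by (simp add: gabor_kernel_def)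
qed

text \<open>The Gaussian decay in d is weakened to a geometric one, uniform in v, which is the form
  that \<open>toeplitz_square_sum\<close> and the summability of the symbol need.\<close>

lemma gabor_kernel_bounds:
  assumes "1 \<le> n" "0 < s"
  shows "0 \<le> gabor_kernel n s d v"
    and "gabor_kernel n s d v \<le> gauss_theta (n / (2 * s)) 0 * exp (- (pi * n / 2) * s) ^ nat \<bar>d\<bar>"
proof -
  define r where "r = exp (- (pi * n / 2) * s)"
  have r: "0 \<le> r" "r < 1" using assms by (auto simp: r_def)
  have y: "0 < n / (2 * s)" using assms by simp
  show "0 \<le> gabor_kernel n s d v" unfolding gabor_kernel_def by (intro mult_nonneg_nonneg gauss_theta_nonneg[OF y]) simp
  have "\<bar>d\<bar> \<le> \<bar>d\<bar> * \<bar>d\<bar>" using mult_right_mono[of 1 "\<bar>d\<bar>" "\<bar>d\<bar>"] by (cases "d = 0") auto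
  then have "nat \<bar>d\<bar> \<le> nat (d\<^sup>2)" by (simp add: power2_eq_square abs_mult_self_eq)
  then have "r ^ nat (d\<^sup>2) \<le> r ^ nat \<bar>d\<bar>" using r by (intro power_decreasing) auto
  then have "r ^ nat (d\<^sup>2) * gauss_theta (n / (2 * s)) (v + of_int (int n * d) / 2) \<le> r ^ nat \<bar>d\<bar> * gauss_theta (n / (2 * s)) 0"
    using r by (intro mult_mono gauss_theta_le[OF y] gauss_theta_nonneg[OF y]) auto
  then show "gabor_kernel n s d v \<le> gauss_theta (n / (2 * s)) 0 * exp (- (pi * n / 2) * s) ^ nat \<bar>d\<bar>"
    by (simp add: gabor_kernel_def r_def mult.commute)
qed

lemma gabor_symbol:
  assumes "1 \<le> n" "0 < s"
  shows "(\<Sum>\<^sub>\<infinity>d. gabor_kernel n s d v * cos (2 * pi * of_int d * \<xi>)) = janssen n s \<xi> v"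
  unfolding janssen_iterated(2)[OF assms] gabor_kernel_def by (rule infsum_cong) (simp add: mult_ac)

section \<open>Folding along a fixed lattice\<close>

locale gabor_lattice =
  fixes n :: nat and \<alpha> \<beta> :: real
  assumes \<alpha>: "0 < \<alpha>" and \<beta>: "0 < \<beta>" and prod: "\<alpha> * \<beta> = 1 / real n"
begin

lemma n: "1 \<le> n"
proof (rule ccontr)
  assume "\<not> 1 \<le> n"
  then have "\<alpha> * \<beta> = 0" using prod by simp
  then show False using \<alpha> \<beta> by simp
qed

text \<open>T = 1/\<beta> is the common period of the modulations. It consists of exactly n
  translation steps, which is where the integrality of the redundancy enters.\<close>

definition "T = real n * \<alpha>"
definition "s = \<alpha> / \<beta>"

lemma T: "0 < T" "T * \<beta> = 1" and s: "0 < s"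
  and \<alpha>2: "\<alpha>\<^sup>2 * n = s" and y: "1 / (2 * \<alpha>\<^sup>2) = n / (2 * s)"
proof -
  have n0: "0 < real n" using n by simp
  show "0 < T" "0 < s" using \<alpha> \<beta> n0 by (simp_all add: T_def s_def)
  show Tb: "T * \<beta> = 1" using prod n0 by (simp add: T_def mult.assoc)
  show a: "\<alpha>\<^sup>2 * n = s" using Tb \<beta> by (simp add: T_def s_def field_simps power2_eq_square)
  show "1 / (2 * \<alpha>\<^sup>2) = n / (2 * s)" unfolding a[symmetric] using n0 by simp
qed

definition "gam t = 2 powr (1/4) * exp (- pi * t\<^sup>2)" for t :: real

lemma gauss0_gam: "gauss0 t = complex_of_real (gam t)"
  by (simp add: gauss0_def gam_def)

lemma continuous_on_gam [continuous_intros]: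
  "continuous_on A f \<Longrightarrow> continuous_on A (\<lambda>t. gam (f t))"
  unfolding gam_def by (intro continuous_intros)

text \<open>The two arguments are \<alpha> X and \<alpha> (X + nd), where X = nv + nm - k.
  Completing the square splits the product into a factor depending on d only and a Gaussian in X +
  nd/2, which Poisson summation turns into a theta value.\<close>

lemma has_sum_gam:
  fixes v :: real
  shows "((\<lambda>k::int. gam (T * (v + of_int m) - \<alpha> * of_int k) * gam (T * (v + of_int m') - \<alpha> * of_int k))
      has_sum (n / T * gabor_kernel n s (m - m') (n * v))) UNIV"
proof -
  define d where "d = m' - m"
  define w where "w = n * v + of_int (int n * d) / 2"
  define z where "z = n / (2 * s)"
  have z: "0 < z" "pi / z = 2 * pi * \<alpha>\<^sup>2" using y \<alpha> n s unfolding z_def by (simp_all add: y[symmetric])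
  have "((\<lambda>j::int. exp (- (pi / z) * (of_int j + w)\<^sup>2)) has_sum (sqrt z * gauss_theta z w)) UNIV"
  proof -
    have "0 < pi / z" using z(1) by simp
    from has_sum_infsum[OF summable_shifted_gaussian[OF this, of w]] show ?thesis
      using gauss_theta_Poisson[OF z(1), of w] z(1) by simp
  qed
  from has_sum_cmult_right[OF this, of "sqrt 2 * exp (- (pi * n / 2) * s) ^ nat (d\<^sup>2)"]
  have hs: "((\<lambda>j::int. sqrt 2 * exp (- (pi * n / 2) * s) ^ nat (d\<^sup>2) * exp (- (pi / z) * (of_int j + w)\<^sup>2)) has_sum
      (sqrt 2 * exp (- (pi * n / 2) * s) ^ nat (d\<^sup>2) * (sqrt z * gauss_theta z w))) UNIV" .
  have summand: "gam (T * (v + of_int m) - \<alpha> * of_int k) * gam (T * (v + of_int m') - \<alpha> * of_int k)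
      = sqrt 2 * exp (- (pi * n / 2) * s) ^ nat (d\<^sup>2) * exp (- (pi / z) * (of_int (int n * m - k) + w)\<^sup>2)" for k
  proof -
    have q: "2 powr (1/4) * 2 powr (1/4) = sqrt (2::real)" by (simp add: powr_half_sqrt flip: powr_add)
    define X where "X = n * v + of_int (int n * m - k)"
    have X1: "T * (v + of_int m) - \<alpha> * of_int k = \<alpha> * X" by (simp add: X_def T_def algebra_simps)
    have X2: "T * (v + of_int m') - \<alpha> * of_int k = \<alpha> * (X + n * of_int d)" by (simp add: X_def T_def d_def algebra_simps)
    have w: "of_int (int n * m - k) + w = X + n * of_int d / 2" by (simp add: X_def w_def)
    have "exp (- (pi * n / 2) * s) ^ nat (d\<^sup>2) = exp (- (pi * n / 2 * s) * (of_int d)\<^sup>2)"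
      unfolding exp_int_square by simp
    moreover have "- (pi * n / 2 * s) * (of_int d)\<^sup>2 + - (pi / z) * (X + n * of_int d / 2)\<^sup>2
        = - pi * (\<alpha> * X)\<^sup>2 + - pi * (\<alpha> * (X + n * of_int d))\<^sup>2"
      unfolding z(2) \<alpha>2[symmetric] by (simp add: power2_eq_square field_simps)
    ultimately have "exp (- (pi * n / 2) * s) ^ nat (d\<^sup>2) * exp (- (pi / z) * (X + n * of_int d / 2)\<^sup>2)
        = exp (- pi * (\<alpha> * X)\<^sup>2) * exp (- pi * (\<alpha> * (X + n * of_int d))\<^sup>2)"
      by (simp only: exp_add[symmetric])
    then show ?thesis unfolding X1 X2 w gam_def using q by (simp add: mult_ac)
  qed
  have "((\<lambda>k::int. gam (T * (v + of_int m) - \<alpha> * of_int k) * gam (T * (v + of_int m') - \<alpha> * of_int k)) has_sum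
      (sqrt 2 * exp (- (pi * n / 2) * s) ^ nat (d\<^sup>2) * (sqrt z * gauss_theta z w))) UNIV"
    unfolding summand
  proof -
    have "bij_betw (\<lambda>k. int n * m - k) UNIV UNIV"
      by (rule bij_betwI[of _ _ _ "\<lambda>k. int n * m - k"]) auto
    from has_sum_reindex_bij_betw[OF this, THEN iffD2, OF hs]
    show "((\<lambda>k. sqrt 2 * exp (- (pi * n / 2) * s) ^ nat (d\<^sup>2) * exp (- (pi / z) * (of_int (int n * m - k) + w)\<^sup>2)) has_sum
      (sqrt 2 * exp (- (pi * n / 2) * s) ^ nat (d\<^sup>2) * (sqrt z * gauss_theta z w))) UNIV" .
  qed
  \<comment> \<open>sqrt 2 is the squared normalisation 2^(1/4) of the window and sqrt z comes from
    Poisson summation; together they give 1/\<alpha> = n/T.\<close>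
  moreover have "sqrt 2 * sqrt z = n / T"
  proof -
    have "sqrt 2 * sqrt z = sqrt (2 * z)" by (simp add: real_sqrt_mult)
    also have "2 * z = (1 / \<alpha>)\<^sup>2" using y unfolding z_def[symmetric] by (simp add: power_divide field_simps)
    also have "sqrt ((1 / \<alpha>)\<^sup>2) = n / T" using \<alpha> n by (simp add: T_def)
    finally show ?thesis .
  qed
  then have "sqrt 2 * exp (- (pi * n / 2) * s) ^ nat (d\<^sup>2) * (sqrt z * gauss_theta z w) = n / T * gabor_kernel n s d (n * v)"
  proof -
    assume e: "sqrt 2 * sqrt z = n / T"
    have "sqrt 2 * exp (- (pi * n / 2) * s) ^ nat (d\<^sup>2) * (sqrt z * gauss_theta z w)
        = (sqrt 2 * sqrt z) * (exp (- (pi * n / 2) * s) ^ nat (d\<^sup>2) * gauss_theta z w)"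
      by (simp only: mult_ac)
    then show ?thesis unfolding e by (simp only: gabor_kernel_def w_def z_def)
  qed
  moreover have "gabor_kernel n s d (n * v) = gabor_kernel n s (m - m') (n * v)"
    using gabor_kernel_even[of n s d "n * v"] unfolding d_def minus_diff_eq by (rule sym)
  ultimately show ?thesis by simp
qed

text \<open>After t = Tv, integration against the modulations yields T times the Fourier
  coefficients of the periodisation of H.\<close>

lemma Parseval_lattice:
  fixes H :: "real \<Rightarrow> complex"
  assumes H: "continuous_on UNIV H" and H0: "\<And>t. \<bar>t\<bar> \<ge> real N * T \<Longrightarrow> H t = 0"
  shows "((\<lambda>l. (cmod (LINT t|lborel. H t * fchar (- l) (\<beta> * t)))\<^sup>2) has_sum
    (T\<^sup>2 * integral {0..1} (\<lambda>v. (cmod (\<Sum>m\<in>{- int N..<int N}. H (T * (v + of_int m))))\<^sup>2))) UNIV"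
proof -
  define h where "h v = H (T * v)" for v
  define p where "p v = (\<Sum>m\<in>{- int N..<int N}. h (v + of_int m))" for v
  have hc: "continuous_on A (\<lambda>v. h (v + c))" for A c
    unfolding h_def by (rule continuous_on_compose2[OF H]) (auto intro!: continuous_intros)
  have hc0: "continuous_on A h" for A using hc[of A 0] by simp
  have h0: "h v = 0" if "\<bar>v\<bar> \<ge> real N" for v
    unfolding h_def by (rule H0) (use that T in \<open>simp add: abs_mult mult.commute\<close>)
  have pc: "continuous_on {0..1} p" unfolding p_def by (intro continuous_intros hc)
  have p01: "p 0 = p 1"
    using sum_shift_support[of h N] h0[of "real N"] h0[of "- real N"] by (simp add: p_def)
  have coef: "(LINT t|lborel. H t * fchar (- l) (\<beta> * t)) = T * fcoeff p l" for l
  proof -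
    define g where "g v = h v * fchar (- l) v" for v
    have gc: "continuous_on UNIV g" unfolding g_def by (intro continuous_intros hc0)
    have "(LINT t|lborel. H t * fchar (- l) (\<beta> * t)) = \<bar>T\<bar> *\<^sub>R (LINT v|lborel. H (0 + T * v) * fchar (- l) (\<beta> * (0 + T * v)))"
      by (rule lborel_integral_real_affine) (use T in simp)
    also have "(\<lambda>v. H (0 + T * v) * fchar (- l) (\<beta> * (0 + T * v))) = g"
    proof
      fix v
      have "\<beta> * (0 + T * v) = (T * \<beta>) * v" by simp
      then have "\<beta> * (0 + T * v) = v" by (simp only: T(2) mult_1_left)
      then show "H (0 + T * v) * fchar (- l) (\<beta> * (0 + T * v)) = g v"
        by (simp only: g_def h_def add_0_left)
    qed
    also have "(LINT v|lborel. g v) = (\<Sum>k\<in>{- int N..<int N}. integral {0..1} (\<lambda>v. g (v + of_int k)))"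
      by (rule lborel_integral_compact_support(2)[OF gc]) (simp add: g_def h0)
    also have "\<dots> = (\<Sum>k\<in>{- int N..<int N}. integral {0..1} (\<lambda>v. h (v + of_int k) * fchar (- l) v))"
      by (simp add: g_def fchar_add_int)
    also have "\<dots> = integral {0..1} (\<lambda>v. \<Sum>k\<in>{- int N..<int N}. h (v + of_int k) * fchar (- l) v)"
      by (rule integral_sum[symmetric]) (auto intro!: integrable_continuous_real continuous_intros hc)
    also have "\<dots> = fcoeff p l" by (simp add: fcoeff_def p_def sum_distrib_right)
    finally show ?thesis using T by (simp add: scaleR_conv_of_real)
  qed
  have "((\<lambda>l. T\<^sup>2 * (cmod (fcoeff p l))\<^sup>2) has_sum (T\<^sup>2 * integral {0..1} (\<lambda>v. (cmod (p v))\<^sup>2))) UNIV"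
    by (rule has_sum_cmult_right[OF Parseval_periodic[OF pc p01]])
  then show ?thesis unfolding coef p_def h_def by (simp add: norm_mult power_mult_distrib)
qed

definition "gform f N v = (\<Sum>m\<in>{- int N..<int N}. \<Sum>m'\<in>{- int N..<int N}.
    f (T * (v + of_int m)) * cnj (f (T * (v + of_int m'))) * complex_of_real (gabor_kernel n s (m - m') (n * v)))" for v :: real

lemma has_sum_gform:
  "((\<lambda>k::int. (cmod (\<Sum>m\<in>{- int N..<int N}. f (T * (v + of_int m)) * gauss0 (T * (v + of_int m) - \<alpha> * of_int k)))\<^sup>2)
      has_sum (n / T * Re (gform f N v))) UNIV"
proof -
  define I where "I = {- int N..<int N}"
  define a where "a m = f (T * (v + of_int m))" for m :: int
  define g where "g m k = gam (T * (v + of_int m) - \<alpha> * of_int k)" for m k :: int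
  have "complex_of_real ((cmod (\<Sum>m\<in>I. a m * complex_of_real (g m k)))\<^sup>2)
      = (\<Sum>m\<in>I. \<Sum>m'\<in>I. (a m * cnj (a m')) * complex_of_real (g m k * g m' k))" for k
    unfolding complex_norm_square cnj_sum sum_product by (simp add: mult_ac)
  moreover have "((\<lambda>k. \<Sum>m\<in>I. \<Sum>m'\<in>I. (a m * cnj (a m')) * complex_of_real (g m k * g m' k)) has_sum
      (\<Sum>m\<in>I. \<Sum>m'\<in>I. (a m * cnj (a m')) * complex_of_real (n / T * gabor_kernel n s (m - m') (n * v)))) UNIV"
    unfolding g_def by (intro has_sum_finite_sum has_sum_cmult_right has_sum_of_real has_sum_gam)
  ultimately have "((\<lambda>k. complex_of_real ((cmod (\<Sum>m\<in>I. a m * complex_of_real (g m k)))\<^sup>2)) has_sum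
      (\<Sum>m\<in>I. \<Sum>m'\<in>I. (a m * cnj (a m')) * complex_of_real (n / T * gabor_kernel n s (m - m') (n * v)))) UNIV"
    by (simp only:)
  from has_sum_Re[OF this]
  have "((\<lambda>k. (cmod (\<Sum>m\<in>I. a m * complex_of_real (g m k)))\<^sup>2) has_sum
      Re (\<Sum>m\<in>I. \<Sum>m'\<in>I. (a m * cnj (a m')) * complex_of_real (n / T * gabor_kernel n s (m - m') (n * v)))) UNIV"
    by (simp only: Re_complex_of_real)
  also have "(\<Sum>m\<in>I. \<Sum>m'\<in>I. (a m * cnj (a m')) * complex_of_real (n / T * gabor_kernel n s (m - m') (n * v)))
      = complex_of_real (n / T) * gform f N v"
    unfolding gform_def I_def[symmetric] sum_distrib_left by (intro sum.cong refl) (simp add: a_def mult_ac)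
  finally have "((\<lambda>k. (cmod (\<Sum>m\<in>I. a m * complex_of_real (g m k)))\<^sup>2) has_sum Re (complex_of_real (n / T) * gform f N v)) UNIV" .
  moreover have "Re (complex_of_real (n / T) * gform f N v) = n / T * Re (gform f N v)" by simp
  ultimately show ?thesis by (simp only: I_def a_def g_def gauss0_gam)
qed

lemma lattice_bij: "bij_betw (\<lambda>(k, l). (\<alpha> * of_int k, \<beta> * of_int l)) UNIV (rect_lattice \<alpha> \<beta>)"
  unfolding bij_betw_def rect_lattice_def using \<alpha> \<beta> by (auto simp: inj_on_def)

lemma L2_inner_shift:
  "L2_inner f (tf_shift (\<alpha> * of_int k, \<beta> * of_int l) gauss0)
     = (LINT t|lborel. (f t * gauss0 (t - \<alpha> * of_int k)) * fchar (- l) (\<beta> * t))"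
proof -
  have "cnj (tf_shift (\<alpha> * of_int k, \<beta> * of_int l) gauss0 t) = gauss0 (t - \<alpha> * of_int k) * fchar (- l) (\<beta> * t)" for t
  proof -
    have "2 * complex_of_real pi * \<i> * complex_of_real (\<beta> * of_int l * t) = \<i> * complex_of_real (2 * pi * of_int l * (\<beta> * t))"
      by (simp add: mult_ac)
    then have "exp (2 * complex_of_real pi * \<i> * complex_of_real (\<beta> * of_int l * t)) = fchar l (\<beta> * t)"
      unfolding fchar_def cis_conv_exp by (simp only:)
    then show ?thesis by (simp add: tf_shift_def fchar_cnj gauss0_gam)
  qed
  then show ?thesis by (simp add: L2_inner_def mult_ac)
qed

text \<open>Parseval disposes of the modulation index l, the translations k are then summed inside
  the integral over v. For each v there remains a finite Toeplitz form in the samples f(T(v +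
  m)).\<close>

lemma frame_sum_compact:
  assumes f: "continuous_on UNIV f" and f0: "\<And>t. \<bar>t\<bar> \<ge> real N * T \<Longrightarrow> f t = 0"
  shows "frame_sum gauss0 (rect_lattice \<alpha> \<beta>) f = (\<integral>\<^sup>+v\<in>{0..1}. ennreal (T * n * Re (gform f N v)) \<partial>lborel)"
proof -
  define P where "P k v = (\<Sum>m\<in>{- int N..<int N}. f (T * (v + of_int m)) * gauss0 (T * (v + of_int m) - \<alpha> * of_int k))"
    for k :: int and v
  have fc: "continuous_on A (\<lambda>v. f (T * (v + c)))" for A c
    by (rule continuous_on_compose2[OF f]) (auto intro!: continuous_intros)
  have Pc: "continuous_on A (P k)" for A k
    unfolding P_def gauss0_gam by (intro continuous_intros fc)
  have Pm [measurable]: "P k \<in> borel_measurable borel" for k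
    by (rule borel_measurable_continuous_onI[OF Pc])
  have "frame_sum gauss0 (rect_lattice \<alpha> \<beta>) f
      = (\<integral>\<^sup>+p. ennreal ((cmod (L2_inner f (tf_shift (case p of (k, l) \<Rightarrow> (\<alpha> * of_int k, \<beta> * of_int l)) gauss0)))\<^sup>2) \<partial>count_space UNIV)"
    unfolding frame_sum_def by (rule nn_integral_bij_count_space[OF lattice_bij, symmetric])
  also have "\<dots> = (\<integral>\<^sup>+k. \<integral>\<^sup>+l. ennreal ((cmod (L2_inner f (tf_shift (\<alpha> * of_int k, \<beta> * of_int l) gauss0)))\<^sup>2) \<partial>count_space UNIV \<partial>count_space UNIV)"
    by (subst nn_integral_fst_count_space[symmetric]) simp
  also have "\<dots> = (\<integral>\<^sup>+k. ennreal (T\<^sup>2 * integral {0..1} (\<lambda>v. (cmod (P k v))\<^sup>2)) \<partial>count_space UNIV)"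
  proof (rule nn_integral_cong)
    fix k :: int
    have "((\<lambda>l. (cmod (L2_inner f (tf_shift (\<alpha> * of_int k, \<beta> * of_int l) gauss0)))\<^sup>2) has_sum (T\<^sup>2 * integral {0..1} (\<lambda>v. (cmod (P k v))\<^sup>2))) UNIV"
      unfolding L2_inner_shift P_def
      by (rule Parseval_lattice) (auto simp: f0 gauss0_gam intro!: continuous_intros f)
    then show "(\<integral>\<^sup>+l. ennreal ((cmod (L2_inner f (tf_shift (\<alpha> * of_int k, \<beta> * of_int l) gauss0)))\<^sup>2) \<partial>count_space UNIV)
        = ennreal (T\<^sup>2 * integral {0..1} (\<lambda>v. (cmod (P k v))\<^sup>2))"
      by (rule nn_integral_count_space_has_sum) simp
  qed
  also have "\<dots> = (\<integral>\<^sup>+k. (\<integral>\<^sup>+v\<in>{0..1}. ennreal (T\<^sup>2 * (cmod (P k v))\<^sup>2) \<partial>lborel) \<partial>count_space UNIV)"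
  proof (rule nn_integral_cong)
    fix k :: int
    have "(\<integral>\<^sup>+v\<in>{0..1}. ennreal (T\<^sup>2 * (cmod (P k v))\<^sup>2) \<partial>lborel) = ennreal (integral {0..1} (\<lambda>v. T\<^sup>2 * (cmod (P k v))\<^sup>2))"
      by (rule nn_integral_Icc_continuous) (auto intro!: continuous_intros Pc)
    then show "ennreal (T\<^sup>2 * integral {0..1} (\<lambda>v. (cmod (P k v))\<^sup>2)) = (\<integral>\<^sup>+v\<in>{0..1}. ennreal (T\<^sup>2 * (cmod (P k v))\<^sup>2) \<partial>lborel)"
      by simp
  qed
  also have "\<dots> = (\<integral>\<^sup>+v. \<integral>\<^sup>+k. ennreal (T\<^sup>2 * (cmod (P k v))\<^sup>2) * indicator {0..1} v \<partial>count_space UNIV \<partial>lborel)"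
  \<comment> \<open>Tonelli: the terms are nonnegative and both measures are sigma-finite.\<close>
  proof -
    interpret pair_sigma_finite "count_space (UNIV :: int set)" lborel
      by (intro pair_sigma_finite.intro sigma_finite_measure_count_space_countable sigma_finite_lborel) auto
    have "case_prod (\<lambda>k v. ennreal (T\<^sup>2 * (cmod (P k v))\<^sup>2) * indicator {0..1} v) \<in> borel_measurable (count_space UNIV \<Otimes>\<^sub>M lborel)"
      by (rule measurable_pair_measure_countable1) auto
    from Fubini'[OF this] show ?thesis by simp
  qed
  also have "\<dots> = (\<integral>\<^sup>+v\<in>{0..1}. ennreal (T * n * Re (gform f N v)) \<partial>lborel)"
  proof (rule nn_integral_cong)
    fix v :: real
    have "((\<lambda>k. T\<^sup>2 * (cmod (P k v))\<^sup>2) has_sum (T\<^sup>2 * (n / T * Re (gform f N v)))) UNIV"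
      unfolding P_def by (rule has_sum_cmult_right[OF has_sum_gform])
    then have "(\<integral>\<^sup>+k. ennreal (T\<^sup>2 * (cmod (P k v))\<^sup>2) \<partial>count_space UNIV) = ennreal (T\<^sup>2 * (n / T * Re (gform f N v)))"
      by (rule nn_integral_count_space_has_sum) simp
    moreover have "T\<^sup>2 * (n / T * Re (gform f N v)) = T * n * Re (gform f N v)"
      using T by (simp add: power2_eq_square)
    ultimately show "(\<integral>\<^sup>+k. ennreal (T\<^sup>2 * (cmod (P k v))\<^sup>2) * indicator {0..1} v \<partial>count_space UNIV)
        = ennreal (T * n * Re (gform f N v)) * indicator {0..1} v"
      by (subst nn_integral_multc) auto
  qed
  finally show ?thesis .
qed

lemma L2_norm_compact:
  assumes f: "continuous_on UNIV f" and f0: "\<And>t. \<bar>t\<bar> \<ge> real N * T \<Longrightarrow> f t = 0"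
  shows "f \<in> L2"
    and "ennreal (L2_norm_sq f) = (\<integral>\<^sup>+v\<in>{0..1}. ennreal (T * (\<Sum>m\<in>{- int N..<int N}. (cmod (f (T * (v + of_int m))))\<^sup>2)) \<partial>lborel)"
    and "L2_norm_sq f = T * integral {0..1} (\<lambda>v. \<Sum>m\<in>{- int N..<int N}. (cmod (f (T * (v + of_int m))))\<^sup>2)"
proof -
  define g where "g v = (cmod (f (T * v)))\<^sup>2" for v
  have fc: "continuous_on A (\<lambda>v. f (T * (v + c)))" for A c
    by (rule continuous_on_compose2[OF f]) (auto intro!: continuous_intros)
  have gc: "continuous_on UNIV g" unfolding g_def using fc[of UNIV 0] by (auto intro!: continuous_intros)
  have g0: "g v = 0" if "\<bar>v\<bar> \<ge> real N" for v
    unfolding g_def using f0[of "T * v"] that T by (simp add: abs_mult mult.commute)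
  have gi: "integrable lborel g" by (rule lborel_integral_compact_support(1)[OF gc g0])
  have "integrable lborel (\<lambda>t. g (0 + \<beta> * t))" by (rule lborel_integrable_real_affine[OF gi]) (use \<beta> in simp)
  moreover have "g (0 + \<beta> * t) = (cmod (f t))\<^sup>2" for t
  proof -
    have "T * (0 + \<beta> * t) = t" using T(2) by (simp add: mult.assoc[symmetric])
    then show ?thesis by (simp only: g_def)
  qed
  ultimately have "integrable lborel (\<lambda>t. (cmod (f t))\<^sup>2)" by simp
  then show "f \<in> L2" unfolding L2_def using borel_measurable_continuous_onI[OF f] by simp
  have "L2_norm_sq f = \<bar>T\<bar> *\<^sub>R (LINT v|lborel. (cmod (f (0 + T * v)))\<^sup>2)"
    unfolding L2_norm_sq_def by (rule lborel_integral_real_affine) (use T in simp)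
  also have "(LINT v|lborel. (cmod (f (0 + T * v)))\<^sup>2) = (LINT v|lborel. g v)" by (simp add: g_def)
  also have "\<dots> = (\<Sum>k\<in>{- int N..<int N}. integral {0..1} (\<lambda>v. g (v + of_int k)))"
    by (rule lborel_integral_compact_support(2)[OF gc g0])
  also have "\<dots> = integral {0..1} (\<lambda>v. \<Sum>k\<in>{- int N..<int N}. g (v + of_int k))"
    unfolding g_def by (rule integral_sum[symmetric]) (auto intro!: integrable_continuous_real continuous_intros fc)
  finally show eq: "L2_norm_sq f = T * integral {0..1} (\<lambda>v. \<Sum>m\<in>{- int N..<int N}. (cmod (f (T * (v + of_int m))))\<^sup>2)"
    using T by (simp add: g_def)
  have "(\<integral>\<^sup>+v\<in>{0..1}. ennreal (T * (\<Sum>m\<in>{- int N..<int N}. (cmod (f (T * (v + of_int m))))\<^sup>2)) \<partial>lborel)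
      = ennreal (integral {0..1} (\<lambda>v. T * (\<Sum>m\<in>{- int N..<int N}. (cmod (f (T * (v + of_int m))))\<^sup>2)))"
    by (rule nn_integral_Icc_continuous) (use T in \<open>auto intro!: continuous_intros fc sum_nonneg mult_nonneg_nonneg\<close>)
  then show "ennreal (L2_norm_sq f) = (\<integral>\<^sup>+v\<in>{0..1}. ennreal (T * (\<Sum>m\<in>{- int N..<int N}. (cmod (f (T * (v + of_int m))))\<^sup>2)) \<partial>lborel)"
    unfolding eq by simp
qed

lemma gform_bounds:
  fixes lo hi :: real
  assumes lo: "\<And>u w. lo \<le> janssen n s u w" and hi: "\<And>u w. janssen n s u w \<le> hi"
  shows "lo * (\<Sum>m\<in>{- int N..<int N}. (cmod (f (T * (v + of_int m))))\<^sup>2) \<le> Re (gform f N v)"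
    and "Re (gform f N v) \<le> hi * (\<Sum>m\<in>{- int N..<int N}. (cmod (f (T * (v + of_int m))))\<^sup>2)"
proof -
  define r where "r = exp (- (pi * n / 2) * s)"
  have r: "0 \<le> r" "r < 1" using n s by (auto simp: r_def)
  have M: "(\<lambda>d. gauss_theta (n / (2 * s)) 0 * r ^ nat \<bar>d\<bar>) summable_on UNIV"
    by (rule summable_on_cmult_right[OF has_sum_imp_summable[OF has_sum_int_geometric[OF r]]])
  have k: "\<bar>gabor_kernel n s d (n * v)\<bar> \<le> gauss_theta (n / (2 * s)) 0 * r ^ nat \<bar>d\<bar>" for d
    using gabor_kernel_bounds[OF n s, of d "n * v"] by (simp add: r_def)
  note tb = toeplitz_bounds[OF M k gabor_kernel_even, of "{- int N..<int N}" lo hi "\<lambda>m. f (T * (v + of_int m))"]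
  show "lo * (\<Sum>m\<in>{- int N..<int N}. (cmod (f (T * (v + of_int m))))\<^sup>2) \<le> Re (gform f N v)"
    unfolding gform_def by (rule tb(2)) (simp_all only: gabor_symbol[OF n s] lo hi finite_atLeastLessThan_int)
  show "Re (gform f N v) \<le> hi * (\<Sum>m\<in>{- int N..<int N}. (cmod (f (T * (v + of_int m))))\<^sup>2)"
    unfolding gform_def by (rule tb(3)) (simp_all only: gabor_symbol[OF n s] lo hi finite_atLeastLessThan_int)
qed

text \<open>The form bounds are assumed for the given f only. This serves two purposes: bounds valid
  for all f from the range of the symbol, and nearly extremal ones for a special test
  function.\<close>

lemma frame_bounds_pointwise:
  fixes lo hi :: real
  assumes f: "continuous_on UNIV f" and f0: "\<And>t. \<bar>t\<bar> \<ge> real N * T \<Longrightarrow> f t = 0"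
    and lo: "\<And>v. v \<in> {0..1} \<Longrightarrow> lo * (\<Sum>m\<in>{- int N..<int N}. (cmod (f (T * (v + of_int m))))\<^sup>2) \<le> Re (gform f N v)"
    and hi: "\<And>v. v \<in> {0..1} \<Longrightarrow> Re (gform f N v) \<le> hi * (\<Sum>m\<in>{- int N..<int N}. (cmod (f (T * (v + of_int m))))\<^sup>2)"
  shows "ennreal (n * lo) * ennreal (L2_norm_sq f) \<le> frame_sum gauss0 (rect_lattice \<alpha> \<beta>) f"
    and "frame_sum gauss0 (rect_lattice \<alpha> \<beta>) f \<le> ennreal (n * hi) * ennreal (L2_norm_sq f)"
proof -
  define S where "S v = (\<Sum>m\<in>{- int N..<int N}. (cmod (f (T * (v + of_int m))))\<^sup>2)" for v
  have fc: "continuous_on A (\<lambda>v. f (T * (v + c)))" for A c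
    by (rule continuous_on_compose2[OF f]) (auto intro!: continuous_intros)
  have Sm [measurable]: "S \<in> borel_measurable borel" unfolding S_def
    by (intro borel_measurable_continuous_onI continuous_intros fc)
  have S0: "0 \<le> S v" for v unfolding S_def by (intro sum_nonneg) simp
  \<comment> \<open>A negative c is allowed: then \<open>ennreal\<close> makes both sides 0.\<close>
  have e: "ennreal (n * c) * ennreal (L2_norm_sq f) = (\<integral>\<^sup>+v\<in>{0..1}. ennreal (T * n * (c * S v)) \<partial>lborel)" for c :: real
  proof -
    have "(\<integral>\<^sup>+v\<in>{0..1}. ennreal (T * n * (c * S v)) \<partial>lborel) = (\<integral>\<^sup>+v. ennreal (n * c) * (ennreal (T * S v) * indicator {0..1} v) \<partial>lborel)"
    proof (rule nn_integral_cong)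
      fix v
      have "ennreal (T * n * (c * S v)) = ennreal ((n * c) * (T * S v))" by (simp add: mult_ac)
      also have "\<dots> = ennreal (n * c) * ennreal (T * S v)" using T S0[of v] by (intro ennreal_mult'') simp
      finally show "ennreal (T * n * (c * S v)) * indicator {0..1} v = ennreal (n * c) * (ennreal (T * S v) * indicator {0..1} v)"
        by (simp add: mult_ac)
    qed
    also have "\<dots> = ennreal (n * c) * (\<integral>\<^sup>+v\<in>{0..1}. ennreal (T * S v) \<partial>lborel)" by (rule nn_integral_cmult) simp
    finally show ?thesis using L2_norm_compact(2)[OF f f0, of N] by (simp add: S_def)
  qed
  have g: "lo * S v \<le> Re (gform f N v)" "Re (gform f N v) \<le> hi * S v" if "v \<in> {0..1}" for v
    unfolding S_def using lo hi that by auto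
  have Tn: "0 \<le> T * n" using T by simp
  show "ennreal (n * lo) * ennreal (L2_norm_sq f) \<le> frame_sum gauss0 (rect_lattice \<alpha> \<beta>) f"
    unfolding e frame_sum_compact[OF f f0, of N, simplified]
  proof (rule nn_integral_mono)
    fix v :: real
    show "ennreal (T * n * (lo * S v)) * indicator {0..1} v \<le> ennreal (T * n * Re (gform f N v)) * indicator {0..1} v"
      using mult_left_mono[OF g(1) Tn, of v] by (cases "v \<in> {0..1}") (auto intro!: ennreal_leI)
  qed
  show "frame_sum gauss0 (rect_lattice \<alpha> \<beta>) f \<le> ennreal (n * hi) * ennreal (L2_norm_sq f)"
    unfolding e frame_sum_compact[OF f f0, of N, simplified]
  proof (rule nn_integral_mono)
    fix v :: real
    show "ennreal (T * n * Re (gform f N v)) * indicator {0..1} v \<le> ennreal (T * n * (hi * S v)) * indicator {0..1} v"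
      using mult_left_mono[OF g(2) Tn, of v] by (cases "v \<in> {0..1}") (auto intro!: ennreal_leI)
  qed
qed

lemma frame_bounds_compact:
  fixes lo hi :: real
  assumes lo: "\<And>u w. lo \<le> janssen n s u w" and hi: "\<And>u w. janssen n s u w \<le> hi"
    and f: "continuous_on UNIV f" and f0: "\<And>t. \<bar>t\<bar> \<ge> real N * T \<Longrightarrow> f t = 0"
  shows "ennreal (n * lo) * ennreal (L2_norm_sq f) \<le> frame_sum gauss0 (rect_lattice \<alpha> \<beta>) f"
    and "frame_sum gauss0 (rect_lattice \<alpha> \<beta>) f \<le> ennreal (n * hi) * ennreal (L2_norm_sq f)"
  using frame_bounds_pointwise[OF f f0 gform_bounds(1)[OF lo hi] gform_bounds(2)[OF lo hi]] by auto

end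

section \<open>Density of compactly supported functions\<close>

text \<open>The weight c lets the first coefficient be as close to 1 as desired, at the price of a
  large factor on a term that will be small.\<close>

lemma norm_add_sq_le:
  fixes z w :: complex assumes c: "0 < c"
  shows "(cmod (z + w))\<^sup>2 \<le> (1 + c) * (cmod z)\<^sup>2 + (1 + 1 / c) * (cmod w)\<^sup>2"
proof -
  have "(cmod (z + w))\<^sup>2 \<le> (cmod z + cmod w)\<^sup>2" by (intro power_mono norm_triangle_ineq) simp
  also have "2 * cmod z * cmod w \<le> c * (cmod z)\<^sup>2 + (cmod w)\<^sup>2 / c"
  proof -
    have "0 \<le> (c * cmod z - cmod w)\<^sup>2 / c" using c by simp
    then show ?thesis using c by (simp add: power2_eq_square field_simps)
  qed
  then have "(cmod z + cmod w)\<^sup>2 \<le> (1 + c) * (cmod z)\<^sup>2 + (1 + 1 / c) * (cmod w)\<^sup>2"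
    by (simp add: power2_sum algebra_simps)
  finally show ?thesis .
qed

lemma L2_add:
  assumes f: "f \<in> L2" and g: "g \<in> L2"
  shows "(\<lambda>t. f t + g t) \<in> L2"
    and "0 < c \<Longrightarrow> L2_norm_sq (\<lambda>t. f t + g t) \<le> (1 + c) * L2_norm_sq f + (1 + 1 / c) * L2_norm_sq g"
proof -
  have fm [measurable]: "f \<in> borel_measurable borel" "g \<in> borel_measurable borel" using f g by (auto simp: L2_def)
  have fi: "integrable lborel (\<lambda>t. (cmod (f t))\<^sup>2)" "integrable lborel (\<lambda>t. (cmod (g t))\<^sup>2)" using f g by (auto simp: L2_def)
  have bi: "integrable lborel (\<lambda>t. (1 + c) * (cmod (f t))\<^sup>2 + (1 + 1 / c) * (cmod (g t))\<^sup>2)" for c :: real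
    using fi by (intro Bochner_Integration.integrable_add integrable_mult_right)
  have si: "integrable lborel (\<lambda>t. (cmod (f t + g t))\<^sup>2)"
  proof (rule Bochner_Integration.integrable_bound[OF bi[of 1]])
    show "AE t in lborel. norm ((cmod (f t + g t))\<^sup>2) \<le> norm ((1 + 1) * (cmod (f t))\<^sup>2 + (1 + 1 / 1) * (cmod (g t))\<^sup>2)"
    proof (rule AE_I2)
      fix t
      have "(cmod (f t + g t))\<^sup>2 \<le> (1 + 1) * (cmod (f t))\<^sup>2 + (1 + 1 / 1) * (cmod (g t))\<^sup>2" by (rule norm_add_sq_le) simp
      then show "norm ((cmod (f t + g t))\<^sup>2) \<le> norm ((1 + 1) * (cmod (f t))\<^sup>2 + (1 + 1 / 1) * (cmod (g t))\<^sup>2)" by simp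
    qed
  qed simp
  then show "(\<lambda>t. f t + g t) \<in> L2" by (simp add: L2_def)
  assume c: "0 < c"
  have "L2_norm_sq (\<lambda>t. f t + g t) \<le> (LINT t|lborel. (1 + c) * (cmod (f t))\<^sup>2 + (1 + 1 / c) * (cmod (g t))\<^sup>2)"
    unfolding L2_norm_sq_def by (rule integral_mono[OF si bi]) (rule norm_add_sq_le[OF c])
  also have "\<dots> = (1 + c) * L2_norm_sq f + (1 + 1 / c) * L2_norm_sq g"
    unfolding L2_norm_sq_def using fi by (subst Bochner_Integration.integral_add) auto
  finally show "L2_norm_sq (\<lambda>t. f t + g t) \<le> (1 + c) * L2_norm_sq f + (1 + 1 / c) * L2_norm_sq g" .
qed

lemma L2_uminus: "g \<in> L2 \<Longrightarrow> (\<lambda>t. - g t) \<in> L2" and L2_norm_sq_uminus: "L2_norm_sq (\<lambda>t. - g t) = L2_norm_sq g"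
  by (auto simp: L2_def L2_norm_sq_def)

lemma L2_diff: "f \<in> L2 \<Longrightarrow> g \<in> L2 \<Longrightarrow> (\<lambda>t. f t - g t) \<in> L2"
  using L2_add(1)[of f "\<lambda>t. - g t"] L2_uminus[of g] by simp

lemma L2_norm_sq_nonneg: "0 \<le> L2_norm_sq f"
  by (simp add: L2_norm_sq_def)

text \<open>A weighted arithmetic-geometric inequality in place of Cauchy-Schwarz; the free
  parameter a is enough for the limit arguments.\<close>

lemma integrable_L2_mult:
  assumes f: "f \<in> L2" and g: "g \<in> L2"
  shows "integrable lborel (\<lambda>t. f t * cnj (g t))"
    and "0 < a \<Longrightarrow> cmod (L2_inner f g) \<le> a * L2_norm_sq f + L2_norm_sq g / a"
proof -
  have fm [measurable]: "f \<in> borel_measurable borel" "g \<in> borel_measurable borel" using f g by (auto simp: L2_def)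
  have fi: "integrable lborel (\<lambda>t. (cmod (f t))\<^sup>2)" "integrable lborel (\<lambda>t. (cmod (g t))\<^sup>2)" using f g by (auto simp: L2_def)
  have bi: "integrable lborel (\<lambda>t. a * (cmod (f t))\<^sup>2 + (cmod (g t))\<^sup>2 / a)" for a :: real
    using fi by (intro Bochner_Integration.integrable_add integrable_mult_right integrable_divide)
  have le: "cmod (f t * cnj (g t)) \<le> a * (cmod (f t))\<^sup>2 + (cmod (g t))\<^sup>2 / a" if a: "0 < a" for a t
  proof -
    have "0 \<le> (a * cmod (f t) - cmod (g t))\<^sup>2 / a" using a by simp
    then have "2 * (cmod (f t) * cmod (g t)) \<le> a * (cmod (f t))\<^sup>2 + (cmod (g t))\<^sup>2 / a"
      using a by (simp add: power2_eq_square field_simps)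
    moreover have "0 \<le> cmod (f t) * cmod (g t)" by simp
    ultimately show ?thesis unfolding norm_mult complex_mod_cnj by linarith
  qed
  show i: "integrable lborel (\<lambda>t. f t * cnj (g t))"
  proof (rule Bochner_Integration.integrable_bound[OF bi[of 1]])
    show "AE t in lborel. norm (f t * cnj (g t)) \<le> norm (1 * (cmod (f t))\<^sup>2 + (cmod (g t))\<^sup>2 / 1)"
      using le[of 1] by (intro AE_I2) simp
    have [measurable]: "cnj \<in> borel_measurable borel"
      by (intro borel_measurable_continuous_onI continuous_intros)
    show "(\<lambda>t. f t * cnj (g t)) \<in> borel_measurable lborel" by measurable
  qed
  assume a: "0 < a"
  have "cmod (L2_inner f g) \<le> (LINT t|lborel. cmod (f t * cnj (g t)))" unfolding L2_inner_def by (rule integral_norm_bound)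
  also have "\<dots> \<le> (LINT t|lborel. a * (cmod (f t))\<^sup>2 + (cmod (g t))\<^sup>2 / a)"
    by (rule integral_mono[OF integrable_norm[OF i] bi le[OF a]])
  also have "\<dots> = a * L2_norm_sq f + L2_norm_sq g / a"
    unfolding L2_norm_sq_def using fi by (subst Bochner_Integration.integral_add) auto
  finally show "cmod (L2_inner f g) \<le> a * L2_norm_sq f + L2_norm_sq g / a" .
qed

lemma L2_inner_add:
  assumes "f \<in> L2" "g \<in> L2" "h \<in> L2"
  shows "L2_inner (\<lambda>t. f t + g t) h = L2_inner f h + L2_inner g h"
  unfolding L2_inner_def distrib_right
  by (rule Bochner_Integration.integral_add) (intro integrable_L2_mult assms)+

lemma L2_inner_tendsto:
  assumes f: "f \<in> L2" and g: "\<And>j. g j \<in> L2" and h: "h \<in> L2"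
    and lim: "(\<lambda>j. L2_norm_sq (\<lambda>t. f t - g j t)) \<longlonglongrightarrow> 0"
  shows "(\<lambda>j. L2_inner (g j) h) \<longlonglongrightarrow> L2_inner f h"
proof -
  have "(\<lambda>j. cmod (L2_inner (\<lambda>t. f t - g j t) h)) \<longlonglongrightarrow> 0"
  proof (rule LIMSEQ_I)
    fix e :: real assume e: "0 < e"
    \<comment> \<open>Large enough to push the contribution of h below e/2; the approximation error
      then has to beat the factor a.\<close>
    define a where "a = 2 * (L2_norm_sq h + 1) / e"
    have a: "0 < a" using e L2_norm_sq_nonneg[of h] by (simp add: a_def)
    have ha: "L2_norm_sq h / a < e / 2"
      using e L2_norm_sq_nonneg[of h] by (simp add: a_def divide_simps)
    have "0 < e / (2 * a)" using e a by simp
    from LIMSEQ_D[OF lim this] obtain J where J: "\<And>j. j \<ge> J \<Longrightarrow> L2_norm_sq (\<lambda>t. f t - g j t) < e / (2 * a)"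
      using L2_norm_sq_nonneg by (auto simp: abs_of_nonneg)
    have "norm (cmod (L2_inner (\<lambda>t. f t - g j t) h) - 0) < e" if "j \<ge> J" for j
    proof -
      have "cmod (L2_inner (\<lambda>t. f t - g j t) h) \<le> a * L2_norm_sq (\<lambda>t. f t - g j t) + L2_norm_sq h / a"
        by (rule integrable_L2_mult(2)[OF L2_diff[OF f g] h a])
      also have "a * L2_norm_sq (\<lambda>t. f t - g j t) < a * (e / (2 * a))" using J[OF that] a by (intro mult_strict_left_mono)
      also have "a * (e / (2 * a)) = e / 2" using a by simp
      finally have "cmod (L2_inner (\<lambda>t. f t - g j t) h) < e" using ha by linarith
      then show ?thesis by simp
    qed
    then show "\<exists>no. \<forall>j\<ge>no. norm (cmod (L2_inner (\<lambda>t. f t - g j t) h) - 0) < e" by blast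
  qed
  then have "(\<lambda>j. L2_inner (\<lambda>t. f t - g j t) h) \<longlonglongrightarrow> 0" by (rule tendsto_norm_zero_cancel)
  moreover have "L2_inner f h - L2_inner (\<lambda>t. f t - g j t) h = L2_inner (g j) h" for j
    using L2_inner_add[OF L2_diff[OF f g[of j]] g[of j] h] by simp
  ultimately show ?thesis using tendsto_diff[OF tendsto_const[of "L2_inner f h"], of "\<lambda>j. L2_inner (\<lambda>t. f t - g j t) h" 0] by simp
qed

lemma L2_norm_tendsto:
  assumes f: "f \<in> L2" and g: "\<And>j. g j \<in> L2"
    and lim: "(\<lambda>j. L2_norm_sq (\<lambda>t. f t - g j t)) \<longlonglongrightarrow> 0"
  shows "(\<lambda>j. L2_norm_sq (g j)) \<longlonglongrightarrow> L2_norm_sq f"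
proof -
  let ?d = "\<lambda>j. L2_norm_sq (\<lambda>t. f t - g j t)"
  have up: "L2_norm_sq (g j) \<le> (1 + c) * L2_norm_sq f + (1 + 1 / c) * ?d j" if c: "0 < c" for c j
  proof -
    have "L2_norm_sq (\<lambda>t. f t + - (f t - g j t)) \<le> (1 + c) * L2_norm_sq f + (1 + 1 / c) * L2_norm_sq (\<lambda>t. - (f t - g j t))"
      by (rule L2_add(2)[OF f L2_uminus[OF L2_diff[OF f g]] c])
    then show ?thesis unfolding L2_norm_sq_uminus by simp
  qed
  have dn: "L2_norm_sq f \<le> (1 + c) * L2_norm_sq (g j) + (1 + 1 / c) * ?d j" if c: "0 < c" for c j
  proof -
    have "L2_norm_sq (\<lambda>t. g j t + (f t - g j t)) \<le> (1 + c) * L2_norm_sq (g j) + (1 + 1 / c) * ?d j"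
      by (rule L2_add(2)[OF g L2_diff[OF f g] c])
    then show ?thesis by simp
  qed
  define N where "N = L2_norm_sq f"
  have N0: "0 \<le> N" by (simp add: N_def L2_norm_sq_nonneg)
  show ?thesis
  proof (rule LIMSEQ_I)
    fix e :: real assume e: "0 < e"
    \<comment> \<open>With c N <= e/4 and the error term below e/8, the two one-sided estimates lose
      less than 3e/8 and 3e/4.\<close>
    define c where "c = min 1 (e / (4 * (N + 1)))"
    have c: "0 < c" "c \<le> 1" "c * N \<le> e / 4"
    proof -
      show "0 < c" "c \<le> 1" using e N0 by (auto simp: c_def)
      have "c * N \<le> e / (4 * (N + 1)) * (N + 1)" using N0 e by (intro mult_mono) (auto simp: c_def)
      also have "e / (4 * (N + 1)) * (N + 1) = e / 4" using N0 by (simp add: field_simps)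
      finally show "c * N \<le> e / 4" .
    qed
    have "0 < e / 8 / (1 + 1 / c)" using e c by (simp add: add_pos_pos)
    from LIMSEQ_D[OF lim this] obtain J where J: "\<And>j. j \<ge> J \<Longrightarrow> ?d j < e / 8 / (1 + 1 / c)"
      using L2_norm_sq_nonneg by (auto simp: abs_of_nonneg)
    have "norm (L2_norm_sq (g j) - N) < e" if "j \<ge> J" for j
    proof -
      have pc: "0 < 1 + 1 / c" using c by (simp add: add_pos_pos)
      have "(1 + 1 / c) * ?d j < (1 + 1 / c) * (e / 8 / (1 + 1 / c))"
        by (rule mult_strict_left_mono[OF J[OF that] pc])
      also have "\<dots> = e / 8" using pc by (subst times_divide_eq_right, subst nonzero_mult_div_cancel_left) auto
      finally have d: "(1 + 1 / c) * ?d j < e / 8" .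
      have 1: "L2_norm_sq (g j) \<le> N + c * N + (1 + 1 / c) * ?d j"
        using up[OF c(1), of j] by (simp add: N_def algebra_simps)
      have "c * L2_norm_sq (g j) \<le> c * (N + c * N + (1 + 1 / c) * ?d j)" using 1 c by (intro mult_left_mono) auto
      also have "\<dots> = c * N + c * (c * N + (1 + 1 / c) * ?d j)" by (simp add: algebra_simps)
      also have "\<dots> \<le> c * N + 1 * (c * N + (1 + 1 / c) * ?d j)"
        using c N0 pc L2_norm_sq_nonneg by (intro add_left_mono mult_right_mono) (auto intro!: add_nonneg_nonneg mult_nonneg_nonneg)
      finally have 2: "c * L2_norm_sq (g j) \<le> c * N + (c * N + (1 + 1 / c) * ?d j)" by simp
      have "N \<le> L2_norm_sq (g j) + c * L2_norm_sq (g j) + (1 + 1 / c) * ?d j"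
        using dn[OF c(1), of j] by (simp add: N_def algebra_simps)
      then show ?thesis using 1 2 d c(3) e unfolding real_norm_def by linarith
    qed
    then show "\<exists>no. \<forall>j\<ge>no. norm (L2_norm_sq (g j) - L2_norm_sq f) < e" unfolding N_def by blast
  qed
qed

section \<open>Truncation and continuous approximation\<close>

lemma L2_truncate:
  assumes f: "f \<in> L2" and e: "0 < e"
  obtains k :: nat where "1 \<le> k" "L2_norm_sq (\<lambda>t. f t - (if \<bar>t\<bar> \<le> real k \<and> cmod (f t) \<le> real k then f t else 0)) < e"
proof -
  have fm [measurable]: "f \<in> borel_measurable borel" and fi: "integrable lborel (\<lambda>t. (cmod (f t))\<^sup>2)"
    using f by (auto simp: L2_def)
  define D where "D k t = (cmod (f t - (if \<bar>t\<bar> \<le> real k \<and> cmod (f t) \<le> real k then f t else 0)))\<^sup>2" for k :: nat and t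
  have [measurable]: "D k \<in> borel_measurable borel" for k unfolding D_def by measurable
  have "(\<lambda>k. LINT t|lborel. D k t) \<longlonglongrightarrow> integral\<^sup>L lborel (\<lambda>t::real. 0::real)"
  proof (rule integral_dominated_convergence[where w = "\<lambda>t. (cmod (f t))\<^sup>2"])
    show "AE t in lborel. (\<lambda>k. D k t) \<longlonglongrightarrow> 0"
    proof (rule AE_I2)
      fix t
      have "\<forall>\<^sub>F k in sequentially. D k t = 0"
        using eventually_ge_at_top[of "nat \<lceil>max \<bar>t\<bar> (cmod (f t))\<rceil>"]
      proof eventually_elim
        case (elim k)
        then have "max \<bar>t\<bar> (cmod (f t)) \<le> real k" by linarith
        then show ?case by (simp add: D_def)
      qed
      then show "(\<lambda>k. D k t) \<longlonglongrightarrow> 0" by (rule tendsto_eventually)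
    qed
    show "AE t in lborel. norm (D k t) \<le> (cmod (f t))\<^sup>2" for k
      by (rule AE_I2) (simp add: D_def)
    show "integrable lborel (\<lambda>t. (cmod (f t))\<^sup>2)" by (rule fi)
  qed auto
  then have "(\<lambda>k. L2_norm_sq (\<lambda>t. f t - (if \<bar>t\<bar> \<le> real k \<and> cmod (f t) \<le> real k then f t else 0))) \<longlonglongrightarrow> 0"
    by (simp add: L2_norm_sq_def D_def)
  from order_tendstoD(2)[OF this e] eventually_ge_at_top[of 1]
  have "\<forall>\<^sub>F k in sequentially. 1 \<le> k \<and> L2_norm_sq (\<lambda>t. f t - (if \<bar>t\<bar> \<le> real k \<and> cmod (f t) \<le> real k then f t else 0)) < e"
    by eventually_elim simp
  then show ?thesis using that eventually_happens'[OF sequentially_bot] by blast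
qed

text \<open>A measurable function is an almost-everywhere limit of continuous ones, which may be
  neither bounded nor compactly supported. The radial retraction \<open>cl\<close> and the
  trapezoidal cutoff \<open>cut\<close> repair this without moving the limit f, so dominated
  convergence applies.\<close>

lemma L2_bounded_approx:
  fixes f :: "real \<Rightarrow> complex" and k :: nat
  assumes f: "f \<in> borel_measurable borel" and k: "1 \<le> k" and b: "\<And>t. cmod (f t) \<le> real k" and s: "\<And>t. \<bar>t\<bar> > real k \<Longrightarrow> f t = 0" and e: "0 < e"
  obtains g where "continuous_on UNIV g" "\<And>t. \<bar>t\<bar> \<ge> real k + 1 \<Longrightarrow> g t = 0" "L2_norm_sq (\<lambda>t. f t - g t) < e"
proof -
  have "f \<in> borel_measurable lebesgue" using f by (simp add: measurable_completion)
  then have "f measurable_on UNIV" by (rule lebesgue_measurable_imp_measurable_on) simp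
  then obtain N g where Ng: "negligible N \<and> (\<forall>i::nat. continuous_on UNIV (g i)) \<and> (\<forall>t. t \<notin> N \<longrightarrow> (\<lambda>i. g i t) \<longlonglongrightarrow> (if t \<in> UNIV then f t else 0))"
    unfolding measurable_on_def by blast
  then have N: "negligible N" and gc: "continuous_on UNIV (g i)"
    and gl: "t \<notin> N \<Longrightarrow> (\<lambda>i. g i t) \<longlonglongrightarrow> f t" for i t
    by simp_all
  define cl where "cl z = z /\<^sub>R max 1 (cmod z / k)" for z :: complex
  define cut where "cut t = max 0 (min 1 (real k + 1 - \<bar>t\<bar>))" for t :: real
  define h where "h i t = cut t *\<^sub>R cl (g i t)" for i t
  have k0: "0 < real k" using k by simp
  have clc: "continuous_on UNIV cl" unfolding cl_def using k0 by (intro continuous_intros) (auto simp: max_def)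
  have clb: "cmod (cl z) \<le> k" for z
  proof -
    have m: "0 < max 1 (cmod z / k)" by (simp add: max_def)
    have "cmod z \<le> k * max 1 (cmod z / k)" using k0 by (simp add: max_def field_simps)
    then show ?thesis unfolding cl_def using m by (simp add: divide_simps mult.commute)
  qed
  have cli: "cl z = z" if "cmod z \<le> k" for z unfolding cl_def using that k0 by (simp add: max_def)
  have cut01: "0 \<le> cut t" "cut t \<le> 1" for t by (auto simp: cut_def)
  have cut0: "cut t = 0" if "\<bar>t\<bar> \<ge> real k + 1" for t using that by (simp add: cut_def)
  have hc: "continuous_on UNIV (h i)" for i
    unfolding h_def cut_def by (intro continuous_intros continuous_on_compose2[OF clc gc]) auto
  have hm [measurable]: "h i \<in> borel_measurable borel" for i by (rule borel_measurable_continuous_onI[OF hc])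
  have [measurable]: "f \<in> borel_measurable borel" by (rule f)
  have hb: "cmod (h i t) \<le> k" for i t
  proof -
    have "cmod (h i t) = cut t * cmod (cl (g i t))" unfolding h_def using cut01 by simp
    also have "\<dots> \<le> 1 * real k" using cut01 clb by (intro mult_mono) auto
    finally show ?thesis by simp
  qed
  have "(\<lambda>i. LINT t|lborel. (cmod (f t - h i t))\<^sup>2) \<longlonglongrightarrow> integral\<^sup>L lborel (\<lambda>t::real. 0::real)"
  proof (rule integral_dominated_convergence[where w = "\<lambda>t. (2 * real k)\<^sup>2 * indicator {- (real k + 1)..real k + 1} t"])
    show "integrable lborel (\<lambda>t. (2 * real k)\<^sup>2 * indicator {- (real k + 1)..real k + 1} t)"
      by (intro integrable_mult_right integrable_real_indicator) (auto simp: emeasure_lborel_Icc_eq)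
    have "AE t in lebesgue. t \<notin> N" using N by (simp add: negligible_iff_null_sets AE_not_in)
    then have "AE t in lborel. t \<notin> N" by (simp add: AE_completion_iff)
    then show "AE t in lborel. (\<lambda>i. (cmod (f t - h i t))\<^sup>2) \<longlonglongrightarrow> 0"
    proof (rule AE_mp, intro AE_I2 impI)
      fix t assume "t \<notin> N"
      have "(\<lambda>i. cl (g i t)) \<longlonglongrightarrow> cl (f t)"
        by (rule continuous_on_tendsto_compose[OF clc gl[OF \<open>t \<notin> N\<close>]]) auto
      then have "(\<lambda>i. h i t) \<longlonglongrightarrow> cut t *\<^sub>R f t" unfolding h_def cli[OF b] by (intro tendsto_intros)
      moreover have "cut t *\<^sub>R f t = f t" using s[of t] by (cases "\<bar>t\<bar> > real k") (auto simp: cut_def)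
      ultimately have "(\<lambda>i. h i t) \<longlonglongrightarrow> f t" by simp
      then have "(\<lambda>i. (cmod (f t - h i t))\<^sup>2) \<longlonglongrightarrow> (cmod (f t - f t))\<^sup>2" by (intro tendsto_intros)
      then show "(\<lambda>i. (cmod (f t - h i t))\<^sup>2) \<longlonglongrightarrow> 0" by simp
    qed
    show "AE t in lborel. norm ((cmod (f t - h i t))\<^sup>2) \<le> (2 * real k)\<^sup>2 * indicator {- (real k + 1)..real k + 1} t" for i
    proof (rule AE_I2)
      fix t
      show "norm ((cmod (f t - h i t))\<^sup>2) \<le> (2 * real k)\<^sup>2 * indicator {- (real k + 1)..real k + 1} t"
      proof (cases "\<bar>t\<bar> \<le> real k + 1")
        case True
        then have t: "t \<in> {- (real k + 1)..real k + 1}" by auto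
        have "cmod (f t - h i t) \<le> 2 * k" using norm_triangle_ineq4[of "f t" "h i t"] b[of t] hb[of i t] by simp
        then have "(cmod (f t - h i t))\<^sup>2 \<le> (2 * real k)\<^sup>2" by (intro power_mono) auto
        then show ?thesis using t by simp
      next
        case False
        then have "f t = 0" "h i t = 0" using s[of t] cut0[of t] by (auto simp: h_def)
        then show ?thesis by simp
      qed
    qed
  qed auto
  then have "(\<lambda>i. L2_norm_sq (\<lambda>t. f t - h i t)) \<longlonglongrightarrow> 0" by (simp add: L2_norm_sq_def)
  from order_tendstoD(2)[OF this e] obtain i where i: "L2_norm_sq (\<lambda>t. f t - h i t) < e"
    using eventually_happens'[OF sequentially_bot] by blast
  show ?thesis by (rule that[OF hc _ i]) (simp add: h_def cut0)
qed

lemma L2_compact_approx: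
  assumes f: "f \<in> L2" and e: "0 < e"
  obtains g R where "continuous_on UNIV g" "\<And>t. \<bar>t\<bar> \<ge> R \<Longrightarrow> g t = 0" "L2_norm_sq (\<lambda>t. f t - g t) < e"
proof -
  have fm [measurable]: "f \<in> borel_measurable borel" using f by (auto simp: L2_def)
  obtain k :: nat where k: "1 \<le> k" "L2_norm_sq (\<lambda>t. f t - (if \<bar>t\<bar> \<le> real k \<and> cmod (f t) \<le> real k then f t else 0)) < e / 4"
    using L2_truncate[OF f, of "e / 4"] e by auto
  define u where "u t = (if \<bar>t\<bar> \<le> real k \<and> cmod (f t) \<le> real k then f t else 0)" for t
  have um: "u \<in> borel_measurable borel" unfolding u_def by measurable
  have ub: "cmod (u t) \<le> real k" "\<bar>t\<bar> > real k \<Longrightarrow> u t = 0" for t by (auto simp: u_def)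
  obtain g where g: "continuous_on UNIV g" "\<And>t. \<bar>t\<bar> \<ge> real k + 1 \<Longrightarrow> g t = 0" "L2_norm_sq (\<lambda>t. u t - g t) < e / 4"
    using L2_bounded_approx[OF um k(1) ub, of "e / 4"] e by auto
  have "integrable lborel (\<lambda>t. (cmod (u t))\<^sup>2)"
  proof (rule Bochner_Integration.integrable_bound)
    show "integrable lborel (\<lambda>t. (cmod (f t))\<^sup>2)" using f by (simp add: L2_def)
    show "AE t in lborel. norm ((cmod (u t))\<^sup>2) \<le> norm ((cmod (f t))\<^sup>2)" by (auto simp: u_def)
  qed (use um in auto)
  then have uL: "u \<in> L2" using um by (simp add: L2_def)
  have gL: "g \<in> L2"
  proof -
    have "g t = 0" if "\<bar>t\<bar> \<ge> real (k + 1)" for t using g(2) that by simp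
    then have "integrable lborel (\<lambda>t. (cmod (g t))\<^sup>2)"
      by (intro lborel_integral_compact_support(1)[of _ "k + 1"] continuous_intros g(1)) auto
    then show ?thesis using borel_measurable_continuous_onI[OF g(1)] by (simp add: L2_def)
  qed
  have "L2_norm_sq (\<lambda>t. (f t - u t) + (u t - g t)) \<le> (1 + 1) * L2_norm_sq (\<lambda>t. f t - u t) + (1 + 1 / 1) * L2_norm_sq (\<lambda>t. u t - g t)"
    by (rule L2_add(2)[OF L2_diff[OF f uL] L2_diff[OF uL gL]]) simp
  also have "\<dots> < e" using k(2) g(3) by (simp add: u_def)
  finally have "L2_norm_sq (\<lambda>t. f t - g t) < e" by simp
  then show ?thesis using that[of g "real k + 1"] g by blast
qed

section \<open>Sharpness of the bounds\<close>

lemma continuous_on_janssen: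
  assumes n: "1 \<le> n" and s: "0 < s"
  shows "continuous_on UNIV (janssen n s u)"
proof -
  define x where "x = exp (- (pi * n / 2) * s)"
  define y where "y = exp (- (pi * n / 2) / s)"
  have xy: "0 \<le> x" "x < 1" "0 \<le> y" "y < 1" using n s by (auto simp: x_def y_def)
  define f where "f = (\<lambda>(k, l) v. janssen_sign n k l * cos (of_int k * (2 * pi * u)) * cos (of_int l * (2 * pi * v)) * gauss_weight x y (k, l))"
  have u: "uniform_limit UNIV (\<lambda>X v. \<Sum>p\<in>X. f p v) (\<lambda>v. \<Sum>\<^sub>\<infinity>p. f p v) (finite_subsets_at_top UNIV)"
  proof (rule Weierstrass_m_test_general[OF _ summable_gauss_weight[OF xy]])
    fix p :: "int \<times> int" and v
    obtain k l where p: "p = (k, l)" by (cases p)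
    have "\<bar>janssen_sign n k l * cos (of_int k * (2 * pi * u)) * cos (of_int l * (2 * pi * v))\<bar> \<le> 1"
      by (auto simp: abs_mult abs_janssen_sign intro!: mult_le_one)
    then have "\<bar>janssen_sign n k l * cos (of_int k * (2 * pi * u)) * cos (of_int l * (2 * pi * v))\<bar> * gauss_weight x y (k, l) \<le> 1 * gauss_weight x y (k, l)"
      by (rule mult_right_mono) (rule gauss_weight_nonneg[OF xy(1,3)])
    then show "norm (f p v) \<le> gauss_weight x y p"
      using gauss_weight_nonneg[OF xy(1,3), of "(k, l)"] by (simp add: f_def p abs_mult)
  qed
  have "continuous_on UNIV (\<lambda>v. \<Sum>p\<in>X. f p v)" for X
    unfolding f_def by (auto simp: case_prod_unfold intro!: continuous_intros)
  then have "continuous_on UNIV (\<lambda>v. \<Sum>\<^sub>\<infinity>p. f p v)"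
    by (intro uniform_limit_theorem[OF _ u] always_eventually) auto
  moreover have "(\<Sum>\<^sub>\<infinity>p. f p v) = janssen n s u v" for v
    unfolding janssen_def f_def x_def y_def by (rule infsum_cong) auto
  ultimately show ?thesis by simp
qed

context gabor_lattice
begin

text \<open>f consists of M translates, with step T, of one bump b, weighted by e. Its samples at v
  are b(v) times the values e(0), ..., e(M - 1), a truncated eigenvector of the Toeplitz form for
  frequency \<xi>, and b concentrates v near v0. The choice of \<xi> makes e a real character with
  values 1 and -1.\<close>

lemma sharp_test_function:
  fixes \<xi> v0 \<eta> :: real
  assumes \<xi>: "\<xi> \<in> {0, 1/2}" and v0: "0 \<le> v0" "v0 < 1" and \<eta>: "0 < \<eta>"
  obtains f where "f \<in> L2" "0 < L2_norm_sq f"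
    "ennreal (n * (janssen n s \<xi> (n * v0) - \<eta>)) * ennreal (L2_norm_sq f) \<le> frame_sum gauss0 (rect_lattice \<alpha> \<beta>) f"
    "frame_sum gauss0 (rect_lattice \<alpha> \<beta>) f \<le> ennreal (n * (janssen n s \<xi> (n * v0) + \<eta>)) * ennreal (L2_norm_sq f)"
proof -
  define J where "J v = janssen n s \<xi> (n * v)" for v :: real
  have "continuous_on UNIV J" unfolding J_def
    by (rule continuous_on_compose2[OF continuous_on_janssen[OF n s]]) (auto intro!: continuous_intros)
  then have "isCont J v0" by (simp add: continuous_on_eq_continuous_at)
  then obtain \<delta>0 :: real where \<delta>0: "0 < \<delta>0" "\<And>v. \<bar>v - v0\<bar> < \<delta>0 \<Longrightarrow> \<bar>J v - J v0\<bar> < \<eta> / 2"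
    unfolding continuous_at_eps_delta dist_real_def using half_gt_zero[OF \<eta>] by blast
  \<comment> \<open>The bump occupies [v0, v0 + \<delta>] within one period, so its translates do
    not overlap. It lies on one side of v0, which admits v0 = 0.\<close>
  define \<delta> where "\<delta> = min \<delta>0 (1 - v0)"
  have \<delta>: "0 < \<delta>" "\<delta> \<le> \<delta>0" "v0 + \<delta> \<le> 1" using \<delta>0 v0 by (auto simp: \<delta>_def)
  define b where "b v = max 0 (min (v - v0) (v0 + \<delta> - v))" for v :: real
  have bc: "continuous_on A b" for A unfolding b_def by (intro continuous_intros)
  have b0: "b v = 0" if "v \<le> 0 \<or> 1 \<le> v" for v using that v0 \<delta> by (auto simp: b_def)
  have bnz: "\<bar>v - v0\<bar> < \<delta>0" if "b v \<noteq> 0" for v using that \<delta> by (auto simp: b_def max_def min_def split: if_splits)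
  define e where "e d = cos (2 * pi * of_int d * \<xi>)" for d :: int
  have e: "e d = (if \<xi> = 0 \<or> even d then 1 else -1)" for d
  proof (cases "\<xi> = 0")
    case False
    then have "\<xi> = 1/2" using \<xi> by simp
    then have "2 * pi * of_int d * \<xi> = of_int d * pi" by (simp only:) simp
    then have "e d = cos (of_int d * pi)" by (simp only: e_def)
    then show ?thesis using False by (simp add: cos_int_pi)
  qed (simp add: e_def)
  have ee: "e m * e m' = e (m - m')" for m m' by (auto simp: e)
  have e2: "(e m)\<^sup>2 = 1" for m by (simp add: e)
  define r where "r = exp (- (pi * n / 2) * s)"
  have r: "0 \<le> r" "r < 1" using n s by (auto simp: r_def)
  define C where "C = gauss_theta (n / (2 * s)) 0"
  define K where "K = 2 * C / (1 - r)\<^sup>2"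
  \<comment> \<open>The truncation error K does not grow with M, so K <= M \<eta>/2 for large M; the
    other half of \<eta> pays for the variation of J over the bump.\<close>
  define M where "M = nat \<lceil>2 * K / \<eta>\<rceil> + 1"
  have M: "1 \<le> M" "K \<le> M * (\<eta> / 2)"
  proof -
    show "1 \<le> M" by (simp add: M_def)
    have "2 * K / \<eta> \<le> M" unfolding M_def by linarith
    then show "K \<le> M * (\<eta> / 2)" using \<eta> by (simp add: field_simps)
  qed
  define f where "f t = (\<Sum>j<M. complex_of_real (e (int j) * b (t / T - real j)))" for t
  have fc: "continuous_on UNIV f" unfolding f_def
    using T by (intro continuous_intros continuous_on_compose2[OF bc[of UNIV]]) auto
  have f0: "f t = 0" if t: "\<bar>t\<bar> \<ge> real M * T" for t
  proof -
    have "b (t / T - real j) = 0" if "j < M" for j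
    proof (rule b0)
      have "real j + 1 \<le> real M" using that by simp
      moreover have "t / T \<le> - real M \<or> real M \<le> t / T" using t T by (auto simp: field_simps abs_real_def split: if_splits)
      ultimately show "t / T - real j \<le> 0 \<or> 1 \<le> t / T - real j" by linarith
    qed
    then show ?thesis by (simp add: f_def)
  qed
  have fv: "f (T * (v + of_int m)) = (if 0 \<le> m then complex_of_real (e m * b v) else 0)"
    if v: "v \<in> {0..1}" and m: "m \<in> {- int M..<int M}" for v m
  proof -
    have "f (T * (v + of_int m)) = (\<Sum>j<M. if int j = m then complex_of_real (e m * b v) else 0)"
      unfolding f_def
    proof (rule sum.cong)
      fix j
      have "T * (v + of_int m) / T = v + of_int m" using T by simp
      moreover have "b (v + of_int m - real j) = 0" if "int j \<noteq> m"
      proof (rule b0)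
        have "m - int j \<le> -1 \<or> 1 \<le> m - int j" using that by linarith
        then have "real_of_int (m - int j) \<le> -1 \<or> 1 \<le> real_of_int (m - int j)" by linarith
        then show "v + of_int m - real j \<le> 0 \<or> 1 \<le> v + of_int m - real j" using v by auto
      qed
      ultimately show "complex_of_real (e (int j) * b (T * (v + of_int m) / T - real j)) = (if int j = m then complex_of_real (e m * b v) else 0)"
        by auto
    qed simp
    also have "\<dots> = (if 0 \<le> m then complex_of_real (e m * b v) else 0)"
    proof (cases "0 \<le> m")
      case True
      then have "(\<Sum>j<M. if int j = m then complex_of_real (e m * b v) else 0) = (\<Sum>j<M. if j = nat m then complex_of_real (e m * b v) else 0)"
        by (intro sum.cong) auto
      also have "\<dots> = complex_of_real (e m * b v)" using True m by simp
      finally show ?thesis using True by simp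
    qed auto
    finally show ?thesis .
  qed
  have S: "(\<Sum>m\<in>{- int M..<int M}. (cmod (f (T * (v + of_int m))))\<^sup>2) = M * (b v)\<^sup>2" if v: "v \<in> {0..1}" for v
  proof -
    have "(\<Sum>m\<in>{- int M..<int M}. (cmod (f (T * (v + of_int m))))\<^sup>2) = (\<Sum>m\<in>{- int M..<int M}. if 0 \<le> m then (b v)\<^sup>2 else 0)"
      by (rule sum.cong) (auto simp: fv[OF v] abs_mult power_mult_distrib e2 simp flip: of_real_mult)
    also have "\<dots> = (\<Sum>m\<in>{0..<int M}. (b v)\<^sup>2)"
      by (rule sum.mono_neutral_cong_right) auto
    finally show ?thesis by simp
  qed
  have G: "\<bar>Re (gform f M v) - J v0 * (M * (b v)\<^sup>2)\<bar> \<le> \<eta> * (M * (b v)\<^sup>2)" if v: "v \<in> {0..1}" for v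
  proof -
    define \<kappa> where "\<kappa> d = gabor_kernel n s d (n * v) * e d" for d
    have "gform f M v = (\<Sum>m\<in>{- int M..<int M}. \<Sum>m'\<in>{- int M..<int M}.
        if 0 \<le> m \<and> 0 \<le> m' then complex_of_real ((b v)\<^sup>2 * \<kappa> (m - m')) else 0)"
      unfolding gform_def
      by (intro sum.cong refl) (auto simp: fv[OF v] \<kappa>_def power2_eq_square mult_ac simp flip: ee)
    also have "\<dots> = (\<Sum>m\<in>{0..<int M}. \<Sum>m'\<in>{0..<int M}. complex_of_real ((b v)\<^sup>2 * \<kappa> (m - m')))"
    proof (rule sum.mono_neutral_cong_right)
      fix m assume "m \<in> {0..<int M}"
      then show "(\<Sum>m'\<in>{- int M..<int M}. if 0 \<le> m \<and> 0 \<le> m' then complex_of_real ((b v)\<^sup>2 * \<kappa> (m - m')) else 0)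
          = (\<Sum>m'\<in>{0..<int M}. complex_of_real ((b v)\<^sup>2 * \<kappa> (m - m')))"
        by (intro sum.mono_neutral_cong_right) auto
    qed auto
    also have "\<dots> = complex_of_real ((b v)\<^sup>2 * (\<Sum>m\<in>{0..<int M}. \<Sum>m'\<in>{0..<int M}. \<kappa> (m - m')))"
      by (simp add: sum_distrib_left)
    also have "(\<Sum>m\<in>{0..<int M}. \<Sum>m'\<in>{0..<int M}. \<kappa> (m - m')) = (\<Sum>m<M. \<Sum>m'<M. \<kappa> (int m - int m'))"
    proof -
      have re: "sum h {0..<int M} = (\<Sum>m<M. h (int m))" for h :: "int \<Rightarrow> real"
        by (rule sum.reindex_bij_witness[of _ int nat]) auto
      show ?thesis by (simp only: re)
    qed
    finally have gf: "Re (gform f M v) = (b v)\<^sup>2 * (\<Sum>m<M. \<Sum>m'<M. \<kappa> (int m - int m'))" by simp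
    have "\<bar>\<kappa> d\<bar> \<le> C * r ^ nat \<bar>d\<bar>" for d
      using gabor_kernel_bounds[OF n s, of d "n * v"] by (simp add: \<kappa>_def e abs_mult C_def r_def)
    from toeplitz_square_sum[OF r this, of M]
    have "\<bar>(\<Sum>m<M. \<Sum>m'<M. \<kappa> (int m - int m')) - M * infsum \<kappa> UNIV\<bar> \<le> K" by (simp add: K_def)
    also have "infsum \<kappa> UNIV = J v" unfolding J_def gabor_symbol[OF n s, symmetric] by (simp add: \<kappa>_def[abs_def] e_def)
    finally have t: "\<bar>(\<Sum>m<M. \<Sum>m'<M. \<kappa> (int m - int m')) - M * J v\<bar> \<le> M * (\<eta> / 2)" using M by linarith
    show ?thesis
    proof (cases "b v = 0")
      case True
      then show ?thesis by (simp add: gf)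
    next
      case False
      then have "\<bar>J v - J v0\<bar> \<le> \<eta> / 2" using \<delta>0(2)[OF bnz] by (simp add: less_imp_le)
      then have "M * \<bar>J v - J v0\<bar> \<le> M * (\<eta> / 2)" by (intro mult_left_mono) auto
      then have "\<bar>M * J v - M * J v0\<bar> \<le> M * (\<eta> / 2)" by (simp add: abs_mult flip: right_diff_distrib)
      with t have "\<bar>(\<Sum>m<M. \<Sum>m'<M. \<kappa> (int m - int m')) - M * J v0\<bar> \<le> M * \<eta>" by argo
      then have "(b v)\<^sup>2 * \<bar>(\<Sum>m<M. \<Sum>m'<M. \<kappa> (int m - int m')) - M * J v0\<bar> \<le> (b v)\<^sup>2 * (M * \<eta>)"
        by (intro mult_left_mono) auto
      moreover have "Re (gform f M v) - J v0 * (M * (b v)\<^sup>2) = (b v)\<^sup>2 * ((\<Sum>m<M. \<Sum>m'<M. \<kappa> (int m - int m')) - M * J v0)"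
        unfolding gf by (simp add: algebra_simps)
      ultimately show ?thesis by (simp add: abs_mult mult_ac)
    qed
  qed
  have Gl: "(J v0 - \<eta>) * (\<Sum>m\<in>{- int M..<int M}. (cmod (f (T * (v + of_int m))))\<^sup>2) \<le> Re (gform f M v)"
    and Gu: "Re (gform f M v) \<le> (J v0 + \<eta>) * (\<Sum>m\<in>{- int M..<int M}. (cmod (f (T * (v + of_int m))))\<^sup>2)" if v: "v \<in> {0..1}" for v
    using G[OF v] unfolding S[OF v] left_diff_distrib distrib_right by linarith+
  have "0 < L2_norm_sq f"
  proof -
    have "L2_norm_sq f = T * integral {0..1} (\<lambda>v. \<Sum>m\<in>{- int M..<int M}. (cmod (f (T * (v + of_int m))))\<^sup>2)"
      by (rule L2_norm_compact(3)[OF fc f0])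
    also have "integral {0..1} (\<lambda>v. \<Sum>m\<in>{- int M..<int M}. (cmod (f (T * (v + of_int m))))\<^sup>2) = integral {0..1} (\<lambda>v. M * (b v)\<^sup>2)"
      by (rule Henstock_Kurzweil_Integration.integral_cong[OF S])
    finally have N: "L2_norm_sq f = T * integral {0..1} (\<lambda>v. M * (b v)\<^sup>2)" .
    have c: "continuous_on {0..1} (\<lambda>v. M * (b v)\<^sup>2)" by (intro continuous_intros bc)
    \<comment> \<open>A continuous nonnegative function with integral 0 vanishes everywhere, but b
      is \<delta>/2 at the middle of its support.\<close>
    have "integral {0..1} (\<lambda>v. M * (b v)\<^sup>2) \<noteq> 0"
    proof
      assume "integral {0..1} (\<lambda>v. M * (b v)\<^sup>2) = 0"
      then have "((\<lambda>v. M * (b v)\<^sup>2) has_integral 0) (cbox 0 1)"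
        using integrable_integral[OF integrable_continuous_real[OF c]] by (simp only: box_real)
      then have "M * (b (v0 + \<delta> / 2))\<^sup>2 = 0"
        using c \<delta> v0 by (intro has_integral_0_cbox_imp_0[of 0 1 "\<lambda>v. M * (b v)\<^sup>2" "v0 + \<delta> / 2"]) auto
      moreover have "b (v0 + \<delta> / 2) = \<delta> / 2" using \<delta> by (simp add: b_def)
      ultimately show False using M \<delta> by simp
    qed
    then have "L2_norm_sq f \<noteq> 0" unfolding N using T by simp
    then show ?thesis using L2_norm_sq_nonneg[of f] by simp
  qed
  then show ?thesis
    using that[of f] L2_norm_compact(1)[OF fc f0] frame_bounds_pointwise[OF fc f0 Gl Gu] by (simp add: J_def)
qed

text \<open>Every admissible constant must pass the test functions. Their norms are positive and
  finite and can be cancelled, after which \<eta> tends to 0.\<close>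

lemma lower_frame_bound_le:
  fixes \<xi> v0 :: real
  assumes \<xi>: "\<xi> \<in> {0, 1/2}" and v0: "0 \<le> v0" "v0 < 1"
  shows "lower_frame_bound gauss0 (rect_lattice \<alpha> \<beta>) \<le> ennreal (n * janssen n s \<xi> (n * v0))"
  unfolding lower_frame_bound_def
proof (rule Sup_least, clarsimp)
  fix A :: ennreal
  assume A: "\<forall>f\<in>L2. A * ennreal (L2_norm_sq f) \<le> frame_sum gauss0 (rect_lattice \<alpha> \<beta>) f"
  define J where "J = janssen n s \<xi> (n * v0)"
  have step: "A \<le> ennreal (n * (J + \<eta>))" if \<eta>: "0 < \<eta>" for \<eta>
  proof -
    obtain f where f: "f \<in> L2" "0 < L2_norm_sq f"
      "frame_sum gauss0 (rect_lattice \<alpha> \<beta>) f \<le> ennreal (n * (J + \<eta>)) * ennreal (L2_norm_sq f)"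
      by (rule sharp_test_function[OF \<xi> v0 \<eta>, folded J_def]) (rule that)
    have "A * ennreal (L2_norm_sq f) \<le> ennreal (n * (J + \<eta>)) * ennreal (L2_norm_sq f)"
      using A f(1,3) by (meson order_trans)
    then show ?thesis using f(2) by (simp add: ennreal_mult_le_mult_iff mult.commute[of _ "ennreal (L2_norm_sq f)"])
  qed
  show "A \<le> ennreal (n * J)"
  proof (rule ennreal_le_epsilon)
    fix \<epsilon> :: real assume "0 < \<epsilon>"
    then have "0 < \<epsilon> / n" using n by simp
    then have "A \<le> ennreal (n * (J + \<epsilon> / n))" by (rule step)
    also have "n * (J + \<epsilon> / n) = n * J + \<epsilon>" using n by (simp add: distrib_left)
    also have "ennreal (n * J + \<epsilon>) \<le> ennreal (n * J) + ennreal \<epsilon>" using \<open>0 < \<epsilon>\<close>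
      by (cases "0 \<le> n * J") (auto simp: ennreal_plus ennreal_neg intro!: ennreal_leI)
    finally show "A \<le> ennreal (n * J) + ennreal \<epsilon>" .
  qed
qed

lemma upper_frame_bound_ge:
  fixes \<xi> v0 :: real
  assumes \<xi>: "\<xi> \<in> {0, 1/2}" and v0: "0 \<le> v0" "v0 < 1"
  shows "ennreal (n * janssen n s \<xi> (n * v0)) \<le> upper_frame_bound gauss0 (rect_lattice \<alpha> \<beta>)"
  unfolding upper_frame_bound_def
proof (rule Inf_greatest, clarsimp)
  fix B :: ennreal
  assume B: "\<forall>f\<in>L2. frame_sum gauss0 (rect_lattice \<alpha> \<beta>) f \<le> B * ennreal (L2_norm_sq f)"
  define J where "J = janssen n s \<xi> (n * v0)"
  have step: "ennreal (n * (J - \<eta>)) \<le> B" if \<eta>: "0 < \<eta>" for \<eta>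
  proof -
    obtain f where f: "f \<in> L2" "0 < L2_norm_sq f"
      "ennreal (n * (J - \<eta>)) * ennreal (L2_norm_sq f) \<le> frame_sum gauss0 (rect_lattice \<alpha> \<beta>) f"
      by (rule sharp_test_function[OF \<xi> v0 \<eta>, folded J_def]) (rule that)
    have "ennreal (n * (J - \<eta>)) * ennreal (L2_norm_sq f) \<le> B * ennreal (L2_norm_sq f)"
      using B f(1,3) by (meson order_trans)
    then show ?thesis using f(2) by (simp add: ennreal_mult_le_mult_iff mult.commute[of _ "ennreal (L2_norm_sq f)"])
  qed
  show "ennreal (n * J) \<le> B"
  proof (rule ennreal_le_epsilon)
    fix \<epsilon> :: real assume \<epsilon>: "0 < \<epsilon>"
    then have "0 < \<epsilon> / n" using n by simp
    then have "ennreal (n * (J - \<epsilon> / n)) \<le> B" by (rule step)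
    moreover have "n * J = n * (J - \<epsilon> / n) + \<epsilon>" using n by (simp add: right_diff_distrib)
    moreover have "ennreal (n * (J - \<epsilon> / n) + \<epsilon>) \<le> ennreal (n * (J - \<epsilon> / n)) + ennreal \<epsilon>" using \<epsilon>
      by (cases "0 \<le> n * (J - \<epsilon> / n)") (auto simp: ennreal_plus ennreal_neg intro!: ennreal_leI)
    ultimately show "ennreal (n * J) \<le> B + ennreal \<epsilon>" by (metis add_right_mono order_trans)
  qed
qed

end

section \<open>The square lattice is optimal\<close>

text \<open>The squared modulus is sqrt 2 exp(-2 pi (t - x)^2), whose integrability is the Gaussian
  Fourier lemma at y = 1/2 and frequency 0, translated.\<close>

lemma tf_shift_gauss0_L2: "tf_shift lam gauss0 \<in> L2"
proof -
  have m: "tf_shift lam gauss0 \<in> borel_measurable borel"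
    unfolding tf_shift_def gauss0_def by (intro borel_measurable_continuous_onI continuous_intros)
  have eq: "(cmod (tf_shift lam gauss0 t))\<^sup>2 = sqrt 2 * exp (- pi * (t - fst lam)\<^sup>2 / (1/2))" for t
  proof -
    have "cmod (exp (2 * complex_of_real pi * \<i> * complex_of_real (snd lam * t))) = 1"
      by (simp add: norm_exp_eq_Re)
    moreover have "cmod (gauss0 (t - fst lam)) = 2 powr (1/4) * exp (- pi * (t - fst lam)\<^sup>2)"
      unfolding gauss0_def norm_of_real by simp
    ultimately have "cmod (tf_shift lam gauss0 t) = 2 powr (1/4) * exp (- pi * (t - fst lam)\<^sup>2)"
      by (simp add: tf_shift_def norm_mult)
    moreover have "(2 powr (1/4))\<^sup>2 = sqrt (2::real)" by (simp add: power2_eq_square powr_half_sqrt flip: powr_add)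
    moreover have "(exp (- pi * (t - fst lam)\<^sup>2))\<^sup>2 = exp (- pi * (t - fst lam)\<^sup>2 / (1/2))"
      by (simp add: power2_eq_square flip: exp_add)
    ultimately show ?thesis by (simp only: power_mult_distrib)
  qed
  have "integrable lborel (\<lambda>v. complex_of_real (exp (- pi * v\<^sup>2 / (1/2))) * fchar (- 0) v)"
    by (rule gaussian_fourier(1)) simp
  then have "integrable lborel (\<lambda>v. exp (- pi * v\<^sup>2 / (1/2)))"
    by (simp add: fchar_0 complex_of_real_integrable_eq del: of_real_exp)
  from lborel_integrable_real_affine[OF this, of 1 "- fst lam"]
  have "integrable lborel (\<lambda>t. exp (- pi * (t - fst lam)\<^sup>2 / (1/2)))" by (simp add: algebra_simps)
  then have "integrable lborel (\<lambda>t. sqrt 2 * exp (- pi * (t - fst lam)\<^sup>2 / (1/2)))" by (rule integrable_mult_right)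
  then have "integrable lborel (\<lambda>t. (cmod (tf_shift lam gauss0 t))\<^sup>2)" by (simp only: eq)
  then show ?thesis using m by (simp add: L2_def)
qed

lemma frame_sum_add:
  assumes f: "f \<in> L2" and g: "g \<in> L2" and c: "0 < c"
  shows "frame_sum gauss0 \<Lambda> (\<lambda>t. f t + g t) \<le> ennreal (1 + c) * frame_sum gauss0 \<Lambda> f + ennreal (1 + 1 / c) * frame_sum gauss0 \<Lambda> g"
proof -
  let ?i = "\<lambda>f lam. (cmod (L2_inner f (tf_shift lam gauss0)))\<^sup>2"
  have "frame_sum gauss0 \<Lambda> (\<lambda>t. f t + g t)
      \<le> (\<integral>\<^sup>+lam. ennreal (1 + c) * ennreal (?i f lam) + ennreal (1 + 1 / c) * ennreal (?i g lam) \<partial>count_space \<Lambda>)"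
    unfolding frame_sum_def
  proof (rule nn_integral_mono)
    fix lam
    have "?i (\<lambda>t. f t + g t) lam \<le> (1 + c) * ?i f lam + (1 + 1 / c) * ?i g lam"
      unfolding L2_inner_add[OF f g tf_shift_gauss0_L2] by (rule norm_add_sq_le[OF c])
    then have "ennreal (?i (\<lambda>t. f t + g t) lam) \<le> ennreal ((1 + c) * ?i f lam + (1 + 1 / c) * ?i g lam)" by (rule ennreal_leI)
    also have "\<dots> = ennreal (1 + c) * ennreal (?i f lam) + ennreal (1 + 1 / c) * ennreal (?i g lam)"
      using c by (subst ennreal_plus) (auto simp: ennreal_mult)
    finally show "ennreal (?i (\<lambda>t. f t + g t) lam) \<le> ennreal (1 + c) * ennreal (?i f lam) + ennreal (1 + 1 / c) * ennreal (?i g lam)" .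
  qed
  also have "\<dots> = ennreal (1 + c) * frame_sum gauss0 \<Lambda> f + ennreal (1 + 1 / c) * frame_sum gauss0 \<Lambda> g"
    unfolding frame_sum_def by (subst nn_integral_add) (auto simp: nn_integral_cmult)
  finally show ?thesis .
qed

context gabor_lattice
begin

lemma L2_compact_sequence:
  assumes f: "f \<in> L2"
  obtains g where "\<And>j::nat. continuous_on UNIV (g j)" "\<And>j. \<exists>N::nat. \<forall>t. \<bar>t\<bar> \<ge> real N * T \<longrightarrow> g j t = 0"
    "\<And>j. L2_norm_sq (\<lambda>t. f t - g j t) \<le> 1 / (j + 1)" "\<And>j. g j \<in> L2"
proof -
  have "\<exists>h. continuous_on UNIV h \<and> (\<exists>N::nat. \<forall>t. \<bar>t\<bar> \<ge> real N * T \<longrightarrow> h t = 0) \<and> L2_norm_sq (\<lambda>t. f t - h t) \<le> 1 / (real j + 1)" for j :: nat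
  proof -
    obtain h R where h: "continuous_on UNIV h" "\<And>t. \<bar>t\<bar> \<ge> R \<Longrightarrow> h t = 0" "L2_norm_sq (\<lambda>t. f t - h t) < 1 / (real j + 1)"
      using L2_compact_approx[OF f, of "1 / (real j + 1)"] by auto
    define N where "N = nat \<lceil>R / T\<rceil>"
    have "R / T \<le> real N" unfolding N_def by linarith
    then have "R \<le> real N * T" using T by (simp add: field_simps)
    then have "\<forall>t. \<bar>t\<bar> \<ge> real N * T \<longrightarrow> h t = 0" using h(2) by auto
    then show ?thesis using h(1,3) by (intro exI[of _ h]) auto
  qed
  then obtain g where g: "\<And>j::nat. continuous_on UNIV (g j) \<and> (\<exists>N::nat. \<forall>t. \<bar>t\<bar> \<ge> real N * T \<longrightarrow> g j t = 0) \<and> L2_norm_sq (\<lambda>t. f t - g j t) \<le> 1 / (real j + 1)"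
    by metis
  have "g j \<in> L2" for j
  proof -
    obtain N :: nat where N: "\<forall>t. \<bar>t\<bar> \<ge> real N * T \<longrightarrow> g j t = 0" using g by blast
    show ?thesis by (rule L2_norm_compact(1)[of "g j" N]) (use g N in auto)
  qed
  then show ?thesis using that[of g] g by simp
qed

lemma compact_bounds:
  fixes lo hi :: real
  assumes lo: "\<And>u w. lo \<le> janssen n s u w" and hi: "\<And>u w. janssen n s u w \<le> hi"
    and g: "continuous_on UNIV g" and g0: "\<exists>N::nat. \<forall>t. \<bar>t\<bar> \<ge> real N * T \<longrightarrow> g t = 0"
  shows "ennreal (n * lo) * ennreal (L2_norm_sq g) \<le> frame_sum gauss0 (rect_lattice \<alpha> \<beta>) g"
    and "frame_sum gauss0 (rect_lattice \<alpha> \<beta>) g \<le> ennreal (n * hi) * ennreal (L2_norm_sq g)"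
proof -
  obtain N :: nat where N: "\<And>t. \<bar>t\<bar> \<ge> real N * T \<Longrightarrow> g t = 0" using g0 by blast
  show "ennreal (n * lo) * ennreal (L2_norm_sq g) \<le> frame_sum gauss0 (rect_lattice \<alpha> \<beta>) g"
    and "frame_sum gauss0 (rect_lattice \<alpha> \<beta>) g \<le> ennreal (n * hi) * ennreal (L2_norm_sq g)"
    using frame_bounds_compact[OF lo hi g N] by auto
qed

text \<open>Each coefficient is continuous in f, so Fatou's lemma passes the bound from the
  approximations to their limit.\<close>

lemma frame_sum_le:
  fixes lo hi :: real
  assumes lo: "\<And>u w. lo \<le> janssen n s u w" and hi: "\<And>u w. janssen n s u w \<le> hi"
    and f: "f \<in> L2"
  shows "frame_sum gauss0 (rect_lattice \<alpha> \<beta>) f \<le> ennreal (n * hi) * ennreal (L2_norm_sq f)"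
proof -
  obtain g where g: "\<And>j::nat. continuous_on UNIV (g j)" "\<And>j. \<exists>N::nat. \<forall>t. \<bar>t\<bar> \<ge> real N * T \<longrightarrow> g j t = 0"
    "\<And>j. L2_norm_sq (\<lambda>t. f t - g j t) \<le> 1 / (j + 1)" "\<And>j. g j \<in> L2"
    using L2_compact_sequence[OF f] by blast
  have lim: "(\<lambda>j. L2_norm_sq (\<lambda>t. f t - g j t)) \<longlonglongrightarrow> 0"
  proof (rule tendsto_sandwich[OF _ _ tendsto_const])
    show "(\<lambda>j. 1 / (real j + 1)) \<longlonglongrightarrow> 0" using LIMSEQ_inverse_real_of_nat by (simp add: inverse_eq_divide add.commute)
  qed (use g(3) L2_norm_sq_nonneg in \<open>auto intro!: always_eventually\<close>)
  have "frame_sum gauss0 (rect_lattice \<alpha> \<beta>) f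
      = (\<integral>\<^sup>+lam. liminf (\<lambda>j. ennreal ((cmod (L2_inner (g j) (tf_shift lam gauss0)))\<^sup>2)) \<partial>count_space (rect_lattice \<alpha> \<beta>))"
    unfolding frame_sum_def
  proof (rule nn_integral_cong)
    fix lam
    have "(\<lambda>j. ennreal ((cmod (L2_inner (g j) (tf_shift lam gauss0)))\<^sup>2)) \<longlonglongrightarrow> ennreal ((cmod (L2_inner f (tf_shift lam gauss0)))\<^sup>2)"
      by (intro tendsto_ennrealI tendsto_intros L2_inner_tendsto[OF f g(4) tf_shift_gauss0_L2 lim])
    then show "ennreal ((cmod (L2_inner f (tf_shift lam gauss0)))\<^sup>2) = liminf (\<lambda>j. ennreal ((cmod (L2_inner (g j) (tf_shift lam gauss0)))\<^sup>2))"
      by (intro lim_imp_Liminf[symmetric]) auto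
  qed
  also have "\<dots> \<le> liminf (\<lambda>j. frame_sum gauss0 (rect_lattice \<alpha> \<beta>) (g j))"
    unfolding frame_sum_def by (rule nn_integral_liminf) simp
  also have "\<dots> \<le> liminf (\<lambda>j. ennreal (n * hi) * ennreal (L2_norm_sq (g j)))"
    by (intro Liminf_mono always_eventually allI compact_bounds(2)[OF lo hi] g)
  also have "\<dots> = ennreal (n * hi) * ennreal (L2_norm_sq f)"
  proof (rule lim_imp_Liminf)
    have "(\<lambda>j. L2_norm_sq (g j)) \<longlonglongrightarrow> L2_norm_sq f" by (rule L2_norm_tendsto[OF f g(4) lim])
    then have "(\<lambda>j. ennreal (n * hi * L2_norm_sq (g j))) \<longlonglongrightarrow> ennreal (n * hi * L2_norm_sq f)"
      by (intro tendsto_ennrealI tendsto_intros)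
    then show "(\<lambda>j. ennreal (n * hi) * ennreal (L2_norm_sq (g j))) \<longlonglongrightarrow> ennreal (n * hi) * ennreal (L2_norm_sq f)"
      by (simp add: ennreal_mult''[OF L2_norm_sq_nonneg])
  qed simp
  finally show ?thesis .
qed

text \<open>Fatou points the wrong way here. Instead g j = f + d is expanded with weight c, and the
  upper bound just obtained makes the frame sum of the error d vanish in the limit; afterwards c
  tends to 0.\<close>

lemma frame_sum_ge:
  fixes lo hi :: real
  assumes lo: "\<And>u w. lo \<le> janssen n s u w" and hi: "\<And>u w. janssen n s u w \<le> hi"
    and f: "f \<in> L2"
  shows "ennreal (n * lo) * ennreal (L2_norm_sq f) \<le> frame_sum gauss0 (rect_lattice \<alpha> \<beta>) f"
proof (cases "0 \<le> lo")
  case True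
  define F where "F = frame_sum gauss0 (rect_lattice \<alpha> \<beta>)"
  define A where "A = n * lo"
  define B where "B = \<bar>n * hi\<bar>"
  have A0: "0 \<le> A" and B0: "0 \<le> B" using True by (auto simp: A_def B_def)
  have up: "F h \<le> ennreal (B * L2_norm_sq h)" if "h \<in> L2" for h
  proof -
    have "F h \<le> ennreal (n * hi) * ennreal (L2_norm_sq h)" unfolding F_def by (rule frame_sum_le[OF lo hi that])
    also have "\<dots> = ennreal (n * hi * L2_norm_sq h)" by (simp add: ennreal_mult''[OF L2_norm_sq_nonneg])
    also have "\<dots> \<le> ennreal (B * L2_norm_sq h)"
      unfolding B_def by (intro ennreal_leI mult_right_mono L2_norm_sq_nonneg) simp
    finally show ?thesis .
  qed
  \<comment> \<open>The upper bound makes the frame sum finite, so the limit can be taken in the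
    reals.\<close>
  obtain \<phi> where \<phi>: "F f = ennreal \<phi>" "0 \<le> \<phi>"
    using up[OF f] by (cases "F f") (auto simp: top_unique)
  obtain g where g: "\<And>j::nat. continuous_on UNIV (g j)" "\<And>j. \<exists>N::nat. \<forall>t. \<bar>t\<bar> \<ge> real N * T \<longrightarrow> g j t = 0"
    "\<And>j. L2_norm_sq (\<lambda>t. f t - g j t) \<le> 1 / (j + 1)" "\<And>j. g j \<in> L2"
    using L2_compact_sequence[OF f] by blast
  have lim0: "(\<lambda>j. 1 / (real j + 1)) \<longlonglongrightarrow> 0" using LIMSEQ_inverse_real_of_nat by (simp add: inverse_eq_divide add.commute)
  have lim: "(\<lambda>j. L2_norm_sq (\<lambda>t. f t - g j t)) \<longlonglongrightarrow> 0"
    by (rule tendsto_sandwich[OF _ _ tendsto_const lim0]) (use g(3) L2_norm_sq_nonneg in \<open>auto intro!: always_eventually\<close>)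
  have c_step: "A * L2_norm_sq f \<le> (1 + c) * \<phi>" if c: "0 < c" for c
  proof (rule LIMSEQ_le)
    show "(\<lambda>j. A * L2_norm_sq (g j)) \<longlonglongrightarrow> A * L2_norm_sq f"
      by (intro tendsto_intros L2_norm_tendsto[OF f g(4) lim])
    show "(\<lambda>j. (1 + c) * \<phi> + (1 + 1 / c) * (B * (1 / (real j + 1)))) \<longlonglongrightarrow> (1 + c) * \<phi>"
      using tendsto_add[OF tendsto_const[of "(1 + c) * \<phi>"] tendsto_mult[OF tendsto_const[of "(1 + 1 / c)"] tendsto_mult[OF tendsto_const[of B] lim0]]] by simp
    have "A * L2_norm_sq (g j) \<le> (1 + c) * \<phi> + (1 + 1 / c) * (B * (1 / (real j + 1)))" for j
    proof -
      define d where "d t = - (f t - g j t)" for t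
      have dL: "d \<in> L2" unfolding d_def by (rule L2_uminus[OF L2_diff[OF f g(4)]])
      have dN: "L2_norm_sq d \<le> 1 / (real j + 1)" unfolding d_def L2_norm_sq_uminus using g(3)[of j] .
      have "ennreal (A * L2_norm_sq (g j)) = ennreal A * ennreal (L2_norm_sq (g j))"
        by (rule ennreal_mult''[OF L2_norm_sq_nonneg])
      also have "\<dots> \<le> F (g j)" unfolding A_def F_def by (rule compact_bounds(1)[OF lo hi g(1,2)])
      also have "F (g j) = F (\<lambda>t. f t + d t)" by (simp add: d_def)
      also have "\<dots> \<le> ennreal (1 + c) * F f + ennreal (1 + 1 / c) * F d" unfolding F_def by (rule frame_sum_add[OF f dL c])
      also have "\<dots> \<le> ennreal (1 + c) * ennreal \<phi> + ennreal (1 + 1 / c) * ennreal (B * (1 / (real j + 1)))"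
      proof (intro add_mono mult_left_mono)
        have "F d \<le> ennreal (B * L2_norm_sq d)" by (rule up[OF dL])
        also have "\<dots> \<le> ennreal (B * (1 / (real j + 1)))" by (intro ennreal_leI mult_left_mono dN B0)
        finally show "F d \<le> ennreal (B * (1 / (real j + 1)))" .
      qed (use \<phi> in auto)
      also have "\<dots> = ennreal ((1 + c) * \<phi> + (1 + 1 / c) * (B * (1 / (real j + 1))))"
      proof -
        have c0: "0 \<le> 1 + c" "0 \<le> 1 + 1 / c" "0 \<le> B * (1 / (real j + 1))" using c B0 by auto
        show ?thesis
          unfolding ennreal_plus[OF mult_nonneg_nonneg[OF c0(1) \<phi>(2)] mult_nonneg_nonneg[OF c0(2,3)]]
            ennreal_mult[OF c0(1) \<phi>(2)] ennreal_mult[OF c0(2,3)] ..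
      qed
      finally show ?thesis using c \<phi>(2) B0 by (subst (asm) ennreal_le_iff) (auto intro!: add_nonneg_nonneg mult_nonneg_nonneg)
    qed
    then show "\<exists>N. \<forall>j\<ge>N. A * L2_norm_sq (g j) \<le> (1 + c) * \<phi> + (1 + 1 / c) * (B * (1 / (real j + 1)))" by blast
  qed
  have "A * L2_norm_sq f \<le> \<phi>"
  proof (rule field_le_epsilon)
    fix e :: real assume e: "0 < e"
    \<comment> \<open>This c makes the excess c \<phi> at most e, also when \<phi> = 0.\<close>
    have "A * L2_norm_sq f \<le> (1 + e / (\<phi> + 1)) * \<phi>" by (rule c_step) (use e \<phi> in auto)
    also have "\<dots> = \<phi> + e * (\<phi> / (\<phi> + 1))" by (simp add: distrib_right)
    also have "e * (\<phi> / (\<phi> + 1)) \<le> e * 1" using e \<phi>(2) by (intro mult_left_mono) auto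
    finally show "A * L2_norm_sq f \<le> \<phi> + e" by simp
  qed
  then have "ennreal (A * L2_norm_sq f) \<le> F f" unfolding \<phi>(1) by (rule ennreal_leI)
  then show ?thesis by (simp add: ennreal_mult''[OF L2_norm_sq_nonneg] A_def F_def)
next
  case False
  then have "ennreal (n * lo) = 0" by (intro ennreal_neg) (simp add: mult_nonneg_nonpos)
  then show ?thesis by simp
qed

end

theorem theorem1:
  fixes n :: nat and \<alpha> \<beta> :: real
  assumes "\<alpha> > 0" and "\<beta> > 0" and "\<alpha> * \<beta> = 1 / real n"
  shows "lower_frame_bound gauss0 (rect_lattice \<alpha> \<beta>)
           \<le> lower_frame_bound gauss0 (rect_lattice (1 / sqrt (real n)) (1 / sqrt (real n)))
         \<and> upper_frame_bound gauss0 (rect_lattice \<alpha> \<beta>)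
           \<ge> upper_frame_bound gauss0 (rect_lattice (1 / sqrt (real n)) (1 / sqrt (real n)))"
proof -
  interpret R: gabor_lattice n \<alpha> \<beta> using assms by unfold_locales
  have n: "1 \<le> n" by (rule R.n)
  interpret S: gabor_lattice n "1 / sqrt (real n)" "1 / sqrt (real n)"
    using n by unfold_locales (auto simp flip: real_sqrt_mult)
  have s1: "S.s = 1" using n by (simp add: S.s_def)
  let ?\<Lambda> = "rect_lattice \<alpha> \<beta>" and ?\<Lambda>' = "rect_lattice (1 / sqrt (real n)) (1 / sqrt (real n))"
  define a where "a = janssen n 1 (1/2) (1/2)"
  define b where "b = janssen n 1 0 0"
  have lo: "a \<le> janssen n S.s u w" and hi: "janssen n S.s u w \<le> b" for u w
    unfolding s1 a_def b_def by (rule janssen_square_bounds[OF n])+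
  \<comment> \<open>The symbol is evaluated at n v, so v0 = 1/(2n) in [0, 1) produces the point
    (1/2, 1/2).\<close>
  have "lower_frame_bound gauss0 ?\<Lambda> \<le> ennreal (n * janssen n R.s (1/2) (n * (1 / (2 * n))))"
    by (rule R.lower_frame_bound_le) (use n in auto)
  also have "\<dots> \<le> ennreal (n * a)"
    unfolding a_def using n janssen_monotone(2)[OF n R.s] by (intro ennreal_leI mult_left_mono) auto
  also have "\<dots> \<le> lower_frame_bound gauss0 ?\<Lambda>'"
    unfolding lower_frame_bound_def by (rule Sup_upper) (use S.frame_sum_ge[OF lo hi] in auto)
  finally have L: "lower_frame_bound gauss0 ?\<Lambda> \<le> lower_frame_bound gauss0 ?\<Lambda>'" .
  have "upper_frame_bound gauss0 ?\<Lambda>' \<le> ennreal (n * b)"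
    unfolding upper_frame_bound_def by (rule Inf_lower) (use S.frame_sum_le[OF lo hi] in auto)
  also have "\<dots> \<le> ennreal (n * janssen n R.s 0 (real n * 0))"
    unfolding b_def using janssen_monotone(1)[OF n R.s] by (intro ennreal_leI mult_left_mono) auto
  also have "\<dots> \<le> upper_frame_bound gauss0 ?\<Lambda>"
    by (rule R.upper_frame_bound_ge) auto
  finally show ?thesis using L by simp
qed

end
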